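(* Let $V_*\in\mathbb{U}^{n\times k}$ be a solution of the NEPv $H(V)V=V\Lambda$ satisfying the eigenvalue gap condition $\delta_*:=\lambda_{k+1}(H(V_* ))-\lambda_k(H(V_* ))>0$. Let $\|\cdot\|_{\mathrm{ui}}$ be a unitarily invariant norm, take the metric $d(\cdot,\cdot):=\|\Theta(\cdot,\cdot)\|_{\mathrm{ui}}$ on $\mathbf{Gr}(k,\mathbb{C}^n)$, and let $\eta_{\sup}$, $\eta_{\sup,\infty}$ be the corresponding local contraction factor and local asymptotic average contraction factor of the plain SCF iteration at $V_*$. (a) If $H$ is Lipschitz continuous at $V_*$, then $$\eta_{\sup}=\limsup_{V\in\mathbb{U}^{n\times k},\ \|\tan\Theta(V,V_* )\|_{\mathrm{ui}}\to 0}\frac{\|S(V)\|_{\mathrm{ui}}}{\|\tan\Theta(V,V_* )\|_{\mathrm{ui}}}<\infty,$$ where $S(V)$ is the unique solution $X$ of the Sylvester equation $\Lambda_{*\perp}X-X\Lambda_*=V_{*\perp}^{H}[H(V_* )-H(V)]V_*$. (b) If $H$ is differentiable at $V_*$, then $$\eta_{\sup}=\|\mathcal{L}\|_{\mathrm{op}}\ \ge\ \eta_{\sup,\infty}=\rho(\mathcal{L}),$$ where $\mathcal{L}:\mathbb{C}^{(n-k)\times k}\to\mathbb{C}^{(n-k)\times k}$ is the $\mathbb{R}$-linear operator $$\mathcal{L}(Z)=D(V_* )\odot\big(V_{*\perp}^{H}\,\mathbf{D}H(V_* )[V_{*\perp}Z]\,V_*\big)$$ and $\|\mathcal{L}\|_{\mathrm{op}}:=\sup_{Z\ne0}\|\mathcal{L}(Z)\|_{\mathrm{ui}}/\|Z\|_{\mathrm{ui}}$.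 Consequently, the plain SCF is locally convergent to $V_*$ with its asymptotic average convergence rate bounded by $\rho(\mathcal{L})$ if $\rho(\mathcal{L})<1$, and it is locally divergent from $V_*$ if $\rho(\mathcal{L})>1$.
   Context: **Problem.** $\mathbb{U}^{n\times k}$ is the set of $n\times k$ complex matrices $V$ with $V^HV=I_k$ ($^H$ is conjugate transpose). $H:\mathbb{C}^{n\times k}\to\mathbb{C}^{n\times n}$ is a continuous Hermitian-matrix-valued function with $H(VQ)=H(V)$ for every unitary $Q\in\mathbb{U}^{k\times k}$. For a matrix $M$ with real eigenvalues, $\lambda_1(M)\le\dots\le\lambda_n(M)$ are its eigenvalues in ascending order. A solution of the NEPv is $V_*\in\mathbb{U}^{n\times k}$ with $H(V_* )V_*=V_*\Lambda_*$, where the eigenvalues of $\Lambda_*$ are the $k$ smallest eigenvalues of $H(V_* )$. Fix the eigendecomposition $H(V_* )[V_*,V_{*\perp}]=[V_*,V_{*\perp}]\,\mathrm{diag}(\Lambda_*,\Lambda_{*\perp})$ with $[V_*,V_{*\perp}]$ unitary, $\Lambda_*=\mathrm{diag}(\lambda_1,\dots,\lambda_k)$, $\Lambda_{*\perp}=\mathrm{diag}(\lambda_{k+1},\dots,\lambda_n)$, $\lambda_i=\lambda_i(H(V_* ))$. Let $D(V_* )\in\mathbb{R}^{(n-k)\times k}$ have entries $D(V_* )_{ij}=(\lambda_{k+i}-\lambda_j)^{-1}$; $\odot$ is the entrywise product. Explicitly $S(V)=D(V_* )\odot(V_{*\perp}^H[H(V_* )-H(V)]V_* )$. **Plain SCF.**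 Given $V_0\in\mathbb{U}^{n\times k}$, $H(V_i)V_{i+1}=V_{i+1}\Lambda_{i+1}$, $i=0,1,2,\dots$, where $V_{i+1}\in\mathbb{U}^{n\times k}$ and $\Lambda_{i+1}$ is diagonal and consists of the $k$ smallest eigenvalues of $H(V_i)$. It is viewed as an iteration on subspaces, i.e. on the Grassmann manifold $\mathbf{Gr}(k,\mathbb{C}^n)$ of $k$-dimensional subspaces of $\mathbb{C}^n$; $V\in\mathbb{U}^{n\times k}$ is identified with its range. **Norms and angles.** A unitarily invariant norm $\|\cdot\|_{\mathrm{ui}}$ is a matrix norm with $\|XAY\|_{\mathrm{ui}}=\|A\|_{\mathrm{ui}}$ for unitary $X,Y$ and $\|A\|_{\mathrm{ui}}=\|A\|_2$ (spectral norm) for $A$ of rank 1; it is defined for matrices of all sizes compatibly, i.e. matrices with the same nonzero singular values have the same norm. For $X,Y\in\mathbb{U}^{n\times k}$, $\Theta(X,Y)=\mathrm{diag}(\theta_1,\dots,\theta_k)$ with $\theta_j=\arccos\sigma_j\in[0,\pi/2]$, $\sigma_1\ge\dots\ge\sigma_k$ the singular values of $Y^HX$; $\tan\Theta$ is taken on the diagonal entries. **Contraction factors** for a metric $d$ on $\mathbf{Gr}(k,\mathbb{C}^n)$ (ratios are over points with nonzero denominator): $$\eta_{\sup}=\limsup_{V_0\in\mathbb{U}^{n\times k},\,d(V_0,V_* )\to0}\frac{d(V_1,V_* )}{d(V_0,V_* )},\quad \eta_{\sup,m}=\limsup_{V_0\in\mathbb{U}^{n\times k},\,d(V_0,V_*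 )\to0}\Big(\frac{d(V_m,V_* )}{d(V_0,V_* )}\Big)^{1/m},\quad \eta_{\sup,\infty}=\limsup_{m\to\infty}\eta_{\sup,m}.$$ **Local convergence/divergence.** SCF is locally convergent to $V_*$ if $d(V_i,V_* )\to0$ as $i\to\infty$ for any initial $V_0$ with $d(V_0,V_* )$ sufficiently small. It is locally divergent from $V_*$ if for all $\varepsilon>0$ there is $V_0$ with $d(V_0,V_* )\le\varepsilon$ such that $d(V_i,V_* )$ does not converge to $0$. "Asymptotic average convergence rate bounded by $\rho$" means $\limsup_{m\to\infty}d(V_m,V_* )^{1/m}\le\rho$ for all $V_0$ with $d(V_0,V_* )$ sufficiently small. **Differentiability.** $H$ is Lipschitz continuous at $V_*$ if $\|H(V)-H(V_* )\|\le\alpha\|V-V_*\|$ for some constant $\alpha<\infty$ and all $V$ near $V_*$. $H$ is differentiable (at $V_*$) if each entry of $H(V)$ is a smooth function of the real and imaginary parts of $V$ (near $V_*$); then $\mathbf{D}H(V_* )[X]=\frac{d}{dt}H(V_*+tX)\big|_{t=0}$, $t\in\mathbb{R}$, which is $\mathbb{R}$-linear in $X\in\mathbb{C}^{n\times k}$ and is the real Fréchet derivative. **Spectral radius.** An $\mathbb{R}$-linear map is a map additive and homogeneous over real scalars. $\rho(\mathcal{L})$ is the largest modulus of the (complex) eigenvalues of a real $2(n-k)k\times 2(n-k)k$ matrix representing $\mathcal{L}$ on $\mathbb{C}^{(n-k)\times k}$ viewed as a real vector space.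
   Formalization: Local divergence is read locally: for some r>0, arbitrarily near V_* there are V_0 whose iterates do not converge to V_* while staying within distance r. With the literal definition the claim for ρ(L)>1 fails, as orbits may leave and be mapped back exactly onto the stable set. *)

theory Defs
  imports
    "HOL-Analysis.Analysis"
    "HOL-Computational_Algebra.Polynomial"
    "HOL-Library.Multiset"
    "Jordan_Normal_Form.Spectral_Radius"
begin

no_notation Matrix.vec_index (infixl \<open>$\<close> 100)

text \<open>
  An \<open>r \<times> c\<close> complex matrix is an element of \<^typ>\<open>complex^'c^'r\<close>; as a real normed vector space
  this type carries the Frobenius norm. Throughout, \<open>n = CARD('n)\<close>, \<open>k = CARD('k)\<close> and
  \<open>n - k = CARD('m)\<close>.
\<close>

subsection \<open>Matrices and eigenvalues\<close>

text \<open>The zero-based position of an index, under the library's enumeration of a finite type. It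
  identifies a finite index type with \<open>{0..<CARD('a)}\<close>.\<close>

definition ix :: "'a::finite \<Rightarrow> nat" where
  "ix j = to_nat_on (UNIV :: 'a set) j"

definition ctranspose :: "complex^'c^'r \<Rightarrow> complex^'r^'c" (\<open>(_\<^sup>H)\<close> [1000] 1000) where
  "A\<^sup>H = (\<chi> i j. cnj (A $ j $ i))"

definition stiefel :: "(complex^'k^'n) set" where
  "stiefel = {V. V\<^sup>H ** V = Finite_Cartesian_Product.mat 1}"

definition rdiag :: "('a::finite \<Rightarrow> real) \<Rightarrow> complex^'a^'a" where
  "rdiag l = (\<chi> i j. if i = j then complex_of_real (l i) else 0)"

definition hcat :: "complex^'k^'n \<Rightarrow> complex^'m^'n \<Rightarrow> complex^('k + 'm)^'n" where
  "hcat V W = (\<chi> i j. case j of Inl a \<Rightarrow> V $ i $ a | Inr b \<Rightarrow> W $ i $ b)"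

definition hadamard :: "real^'c^'r \<Rightarrow> complex^'c^'r \<Rightarrow> complex^'c^'r" (infixl \<open>\<odot>\<close> 70) where
  "D \<odot> A = (\<chi> i j. complex_of_real (D $ i $ j) * A $ i $ j)"

definition charpoly :: "complex^'a^'a \<Rightarrow> complex poly" where
  "charpoly M = Determinants.det (\<chi> i j. (if i = j then [:0, 1:] else 0) - [:M $ i $ j:])"

text \<open>The eigenvalues with algebraic multiplicity, in ascending order. Only used for matrices whose
  eigenvalues are real. The index of \<open>eigval\<close> starts at 1.\<close>

definition eigvals_asc :: "complex^'a^'a \<Rightarrow> real list" where
  "eigvals_asc M = sorted_list_of_multiset (image_mset Re (proots (charpoly M)))"

definition eigval :: "nat \<Rightarrow> complex^'a^'a \<Rightarrow> real" where
  "eigval i M = eigvals_asc M ! (i - 1)"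

text \<open>In descending order. The list has one entry per column, so for a matrix with more columns
  than rows it ends in additional zeros.\<close>

definition singular_values :: "complex^'c^'r \<Rightarrow> real list" where
  "singular_values A = rev (map sqrt (eigvals_asc (A\<^sup>H ** A)))"


subsection \<open>The eigenvector-dependent problem and the plain SCF iteration\<close>

definition nepv_solution :: "(complex^'k^'n \<Rightarrow> complex^'n^'n) \<Rightarrow> complex^'k^'n \<Rightarrow> bool" where
  "nepv_solution H V \<longleftrightarrow> V \<in> stiefel \<and>
     (\<exists>\<Lambda> :: complex^'k^'k. H V ** V = V ** \<Lambda> \<and>
        proots (charpoly \<Lambda>) =
          image_mset complex_of_real (mset (take CARD('k) (eigvals_asc (H V)))))"

definition Lam :: "complex^'n^'n \<Rightarrow> complex^'k^'k" where
  "Lam M = rdiag (\<lambda>j. eigval (ix j + 1) M)"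

definition Lam_perp :: "'k itself \<Rightarrow> complex^'n^'n \<Rightarrow> complex^'m^'m" where
  "Lam_perp _ M = rdiag (\<lambda>i. eigval (CARD('k) + (ix i + 1)) M)"

definition eigendecomposition ::
  "complex^'n^'n \<Rightarrow> complex^'k^'n \<Rightarrow> complex^'m^'n \<Rightarrow> bool" where
  "eigendecomposition M V W \<longleftrightarrow>
     (hcat V W)\<^sup>H ** hcat V W = Finite_Cartesian_Product.mat 1 \<and>
     hcat V W ** (hcat V W)\<^sup>H = Finite_Cartesian_Product.mat 1 \<and>
     M ** hcat V W = hcat V W **
       rdiag (\<lambda>s. case s of Inl j \<Rightarrow> eigval (ix j + 1) M
                          | Inr i \<Rightarrow> eigval (CARD('k) + (ix i + 1)) M)"

definition gap_matrix :: "complex^'n^'n \<Rightarrow> real^'k^'m" where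
  "gap_matrix M =
     (\<chi> i j. inverse (eigval (CARD('k) + (ix i + 1)) M - eigval (ix j + 1) M))"

text \<open>One step is a relation, since the iteration does not determine \<open>V\<^sub>i\<^sub>+\<^sub>1\<close> uniquely.\<close>

definition scf_step ::
  "(complex^'k^'n \<Rightarrow> complex^'n^'n) \<Rightarrow> complex^'k^'n \<Rightarrow> complex^'k^'n \<Rightarrow> bool" where
  "scf_step H V W \<longleftrightarrow> W \<in> stiefel \<and>
     (\<exists>l :: 'k \<Rightarrow> real. H V ** W = W ** rdiag l \<and>
        image_mset l (mset_set UNIV) = mset (take CARD('k) (eigvals_asc (H V))))"

definition scf_run ::
  "(complex^'k^'n \<Rightarrow> complex^'n^'n) \<Rightarrow> (nat \<Rightarrow> complex^'k^'n) \<Rightarrow> bool" where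
  "scf_run H V \<longleftrightarrow> V 0 \<in> stiefel \<and> (\<forall>i. scf_step H (V i) (V (Suc i)))"


subsection \<open>Unitarily invariant norms and canonical angles\<close>

definition ui_norm :: "(complex^'c^'r \<Rightarrow> real) \<Rightarrow> bool" where
  "ui_norm N \<longleftrightarrow>
     (\<forall>A. N A = 0 \<longleftrightarrow> A = 0) \<and>
     (\<forall>A B. N (A + B) \<le> N A + N B) \<and>
     (\<forall>z A. N (\<chi> i j. z * A $ i $ j) = cmod z * N A) \<and>
     (\<forall>X \<in> stiefel. \<forall>Y \<in> stiefel. \<forall>A. N (X ** A ** Y) = N A) \<and>
     (\<forall>A. rank A = 1 \<longrightarrow> N A = onorm ((*v) A))"

text \<open>A unitarily invariant norm on matrices of several sizes is a family with one member per size
  whose members are pairwise compatible.\<close>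

definition ui_compatible :: "(complex^'c^'r \<Rightarrow> real) \<Rightarrow> (complex^'d^'s \<Rightarrow> real) \<Rightarrow> bool" where
  "ui_compatible N N' \<longleftrightarrow>
     (\<forall>A B. filter (\<lambda>s. s \<noteq> 0) (singular_values A) = filter (\<lambda>s. s \<noteq> 0) (singular_values B)
            \<longrightarrow> N A = N' B)"

definition angle :: "complex^'k^'n \<Rightarrow> complex^'k^'n \<Rightarrow> 'k \<Rightarrow> real" where
  "angle X Y j = arccos (singular_values (Y\<^sup>H ** X) ! ix j)"

definition Theta :: "complex^'k^'n \<Rightarrow> complex^'k^'n \<Rightarrow> complex^'k^'k" where
  "Theta X Y = rdiag (angle X Y)"

definition tan_Theta :: "complex^'k^'n \<Rightarrow> complex^'k^'n \<Rightarrow> complex^'k^'k" where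
  "tan_Theta X Y = rdiag (\<lambda>j. tan (angle X Y j))"

definition gr_dist ::
  "(complex^'k^'k \<Rightarrow> real) \<Rightarrow> complex^'k^'n \<Rightarrow> complex^'k^'n \<Rightarrow> real" where
  "gr_dist N X Y = N (Theta X Y)"


subsection \<open>Local contraction factors\<close>

text \<open>The limit superior ranges over runs \<open>V\<close>, so that it does not depend on a choice of \<open>V\<^sub>m\<close>. The
  filter \<^term>\<open>at_right (0::real)\<close> excludes the points with zero denominator.\<close>

definition eta_sup ::
  "(complex^'k^'k \<Rightarrow> real) \<Rightarrow> (complex^'k^'n \<Rightarrow> complex^'n^'n) \<Rightarrow> complex^'k^'n \<Rightarrow> ereal" where
  "eta_sup N H Vs =
     Limsup (inf (principal {V. scf_run H V}) (filtercomap (\<lambda>V. gr_dist N (V 0) Vs) (at_right 0)))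
       (\<lambda>V. ereal (gr_dist N (V 1) Vs / gr_dist N (V 0) Vs))"

definition eta_sup_m ::
  "nat \<Rightarrow> (complex^'k^'k \<Rightarrow> real) \<Rightarrow> (complex^'k^'n \<Rightarrow> complex^'n^'n) \<Rightarrow> complex^'k^'n \<Rightarrow> ereal" where
  "eta_sup_m m N H Vs =
     Limsup (inf (principal {V. scf_run H V}) (filtercomap (\<lambda>V. gr_dist N (V 0) Vs) (at_right 0)))
       (\<lambda>V. ereal (root m (gr_dist N (V m) Vs / gr_dist N (V 0) Vs)))"

definition eta_sup_inf ::
  "(complex^'k^'k \<Rightarrow> real) \<Rightarrow> (complex^'k^'n \<Rightarrow> complex^'n^'n) \<Rightarrow> complex^'k^'n \<Rightarrow> ereal" where
  "eta_sup_inf N H Vs = limsup (\<lambda>m. eta_sup_m m N H Vs)"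

text \<open>\<^term>\<open>tan (pi/2)\<close> is \<open>0\<close> in HOL, whereas here a right angle makes \<open>tan \<Theta>\<close> infinite, so points
  with a right angle are excluded explicitly.\<close>

definition Limsup_tan ::
  "(complex^'k^'k \<Rightarrow> real) \<Rightarrow> complex^'k^'n \<Rightarrow> (complex^'k^'n \<Rightarrow> ereal) \<Rightarrow> ereal" where
  "Limsup_tan N Vs f =
     Limsup (inf (principal {V \<in> stiefel. \<forall>j. angle V Vs j < pi / 2})
                 (filtercomap (\<lambda>V. N (tan_Theta V Vs)) (at_right 0))) f"


subsection \<open>Local convergence and divergence\<close>

definition locally_convergent ::
  "(complex^'k^'k \<Rightarrow> real) \<Rightarrow> (complex^'k^'n \<Rightarrow> complex^'n^'n) \<Rightarrow> complex^'k^'n \<Rightarrow> bool" where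
  "locally_convergent N H Vs \<longleftrightarrow>
     (\<exists>\<epsilon>>0. \<forall>V. scf_run H V \<and> gr_dist N (V 0) Vs \<le> \<epsilon> \<longrightarrow>
        (\<lambda>i. gr_dist N (V i) Vs) \<longlonglongrightarrow> 0)"

definition avg_rate_bounded ::
  "(complex^'k^'k \<Rightarrow> real) \<Rightarrow> (complex^'k^'n \<Rightarrow> complex^'n^'n) \<Rightarrow> complex^'k^'n \<Rightarrow> real \<Rightarrow> bool" where
  "avg_rate_bounded N H Vs \<rho> \<longleftrightarrow>
     (\<exists>\<epsilon>>0. \<forall>V. scf_run H V \<and> gr_dist N (V 0) Vs \<le> \<epsilon> \<longrightarrow>
        limsup (\<lambda>m. ereal (root m (gr_dist N (V m) Vs))) \<le> ereal \<rho>)"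

text \<open>
  Divergence is understood locally: the iterates fail to converge to \<open>V\<^sub>*\<close> inside some fixed
  neighbourhood of \<open>V\<^sub>*\<close>. Without the bound \<open>r\<close>, a spectral radius above \<open>1\<close> would not imply
  divergence. The assumptions on \<open>H\<close> say nothing about the iteration far from \<open>V\<^sub>*\<close>; when the
  linearisation has eigenvalues of modulus below and above \<open>1\<close>, all orbits that are driven away from
  \<open>V\<^sub>*\<close> can be mapped, away from \<open>V\<^sub>*\<close>, exactly onto the stable set and so return to \<open>V\<^sub>*\<close>.
\<close>

definition locally_divergent ::
  "(complex^'k^'k \<Rightarrow> real) \<Rightarrow> (complex^'k^'n \<Rightarrow> complex^'n^'n) \<Rightarrow> complex^'k^'n \<Rightarrow> bool" where
  "locally_divergent N H Vs \<longleftrightarrow>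
     (\<exists>r>0. \<forall>\<epsilon>>0. \<exists>V0 \<in> stiefel. gr_dist N V0 Vs \<le> \<epsilon> \<and>
        (\<forall>V. scf_run H V \<and> V 0 = V0 \<longrightarrow>
           \<not> ((\<forall>i. gr_dist N (V i) Vs \<le> r) \<and> (\<lambda>i. gr_dist N (V i) Vs) \<longlonglongrightarrow> 0)))"


subsection \<open>Regularity and linearisation\<close>

definition lipschitz_at :: "('a::real_normed_vector \<Rightarrow> 'b::real_normed_vector) \<Rightarrow> 'a \<Rightarrow> bool" where
  "lipschitz_at H Vs \<longleftrightarrow>
     (\<exists>\<alpha>. eventually (\<lambda>V. norm (H V - H Vs) \<le> \<alpha> * norm (V - Vs)) (nhds Vs))"

text \<open>Entrywise continuous real differentiability near \<open>V\<^sub>*\<close>, the weakest customary meaning of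
  smoothness.\<close>

definition smooth_near :: "(complex^'k^'n \<Rightarrow> complex^'b^'a) \<Rightarrow> complex^'k^'n \<Rightarrow> bool" where
  "smooth_near H Vs \<longleftrightarrow>
     (\<exists>U. open U \<and> Vs \<in> U \<and>
        (\<forall>i j. \<exists>h'. (\<forall>V\<in>U. ((\<lambda>W. H W $ i $ j) has_derivative h' V) (at V)) \<and>
                    (\<forall>X. continuous_on U (\<lambda>V. h' V X))))"

definition dir_deriv ::
  "('a::real_normed_vector \<Rightarrow> 'b::real_normed_vector) \<Rightarrow> 'a \<Rightarrow> 'a \<Rightarrow> 'b" where
  "dir_deriv H V X = vector_derivative (\<lambda>t::real. H (V + t *\<^sub>R X)) (at 0)"

definition scf_S ::
  "(complex^'k^'n \<Rightarrow> complex^'n^'n) \<Rightarrow> complex^'k^'n \<Rightarrow> complex^'m^'n \<Rightarrow> complex^'k^'n \<Rightarrow> complex^'k^'m"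
  where
  "scf_S H Vs Vp V = gap_matrix (H Vs) \<odot> (Vp\<^sup>H ** (H Vs - H V) ** Vs)"

definition scf_L ::
  "(complex^'k^'n \<Rightarrow> complex^'n^'n) \<Rightarrow> complex^'k^'n \<Rightarrow> complex^'m^'n \<Rightarrow> complex^'k^'m \<Rightarrow> complex^'k^'m"
  where
  "scf_L H Vs Vp Z = gap_matrix (H Vs) \<odot> (Vp\<^sup>H ** dir_deriv H Vs (Vp ** Z) ** Vs)"

definition op_norm :: "(complex^'k^'m \<Rightarrow> real) \<Rightarrow> (complex^'k^'m \<Rightarrow> complex^'k^'m) \<Rightarrow> ereal" where
  "op_norm N L = (SUP Z \<in> {Z. Z \<noteq> 0}. ereal (N (L Z) / N Z))"

text \<open>The matrix representing a real-linear map in the standard real basis of its space, with its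
  entries regarded as complex numbers.\<close>

definition real_rep :: "('a::euclidean_space \<Rightarrow> 'a) \<Rightarrow> complex Matrix.mat" where
  "real_rep L = Matrix.mat DIM('a) DIM('a)
     (\<lambda>(i, j). complex_of_real
        (inner (L (from_nat_into Basis j)) (from_nat_into (Basis :: 'a set) i)))"

definition real_spectral_radius :: "('a::euclidean_space \<Rightarrow> 'a) \<Rightarrow> real" where
  "real_spectral_radius L = spectral_radius (real_rep L)"

end

theory Submission
  imports Defs
begin

text \<open>
  A subspace without right angle to \<open>V\<^sub>*\<close> is the graph of a unique matrix \<open>Z\<close>: it is the range of
  \<open>V\<^sub>* + V\<^sub>*\<^sub>\<bottom> Z\<close>, and the singular values of \<open>Z\<close> are the tangents of the canonical angles. Thus
  \<open>d(V, V\<^sub>*) = (1 + o(1)) \<parallel>Z\<parallel>\<close>. Multiplying the two block rows of \<open>H(V) W = W \<Lambda>\<close> by the inverse of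
  \<open>V\<^sub>*\<^sup>H W\<close> turns one SCF step into the perturbed Sylvester equation \<open>\<Lambda>\<^sub>*\<^sub>\<bottom> Z - Z \<Lambda>\<^sub>* = R(V) + o(Z)\<close> with
  \<open>R(V)\<close> the right-hand side defining \<open>S(V)\<close>, so the new coordinate is \<open>S(V)\<close> up to a small relative
  error. If \<open>H\<close> is differentiable then \<open>S(V) = - L(Z) + o(Z)\<close>, hence \<open>m\<close> steps act as \<open>(- L)\<^sup>m\<close> to first
  order and Gelfand's formula gives the asymptotic factor. Convergence follows from a norm in which
  \<open>L\<close> contracts. For divergence, solve \<open>L\<^sup>T P L - c P = I\<close> with \<open>1 < c < \<rho>(L)\<^sup>2\<close>: the quadratic form of
  \<open>P\<close> takes a positive value and grows by the factor \<open>c\<close> in every step that stays near \<open>V\<^sub>*\<close>.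
\<close>

section \<open>Complex matrices\<close>

text \<open>The regularity hypotheses bear on \<open>H\<close> near the single matrix
  \<open>Vs\<close>, whereas the iteration lives on subspaces and its steps are not unique. Graph
  coordinates depend only on the range, which removes the ambiguity. Invariance of \<open>H\<close>
  allows each iterate to be rotated to a representative within O(|Z|^2) of
  \<open>Vs + Vp ** Z\<close>, where the hypotheses apply.

  The error in the perturbed Sylvester equation is a product of \<open>H V - H Vs\<close> with the
  new coordinate. It is therefore small relative to \<open>S V\<close> itself, even where
  \<open>S V\<close> is far smaller than the old coordinate. A cruder bound from eigenvalue
  perturbation must come first, to show that the new iterate has a coordinate at all.

  Estimates are made in the Frobenius norm. The constant lost in passing to the given norm
  multiplies an arbitrarily small error in ratios, and stands under an m-th root in averaged
  factors.

  Under a nonlinear perturbation an orbit need not stay near an expanding eigenvector. The quadratic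
  form replaces that direction by a cone, and the summand I of its equation pays for the nonlinear
  error.\<close>

abbreviation idm :: "complex^'a^'a" where
  "idm \<equiv> Finite_Cartesian_Product.mat 1"

text \<open>The real inner product \<open>inner\<close> is only the real part of this form.
  Unitarity also requires the imaginary part to vanish.\<close>

definition hip :: "complex^'n \<Rightarrow> complex^'n \<Rightarrow> complex" where
  "hip x y = (\<Sum>i\<in>UNIV. cnj (x $ i) * y $ i)"

lemma matrix_eqI:
  assumes "\<And>i j. A $ i $ j = B $ i $ j"
  shows "A = B"
  using assms by (metis Finite_Cartesian_Product.vec_eq_iff)

lemma ctranspose_mult: "(A ** B)\<^sup>H = B\<^sup>H ** A\<^sup>H"
  by (simp add: ctranspose_def matrix_matrix_mult_def Finite_Cartesian_Product.vec_eq_iff mult.commute)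

lemma ctranspose_ctranspose [simp]: "(A\<^sup>H)\<^sup>H = A"
  by (simp add: ctranspose_def Finite_Cartesian_Product.vec_eq_iff)

lemma ctranspose_add: "(A + B)\<^sup>H = A\<^sup>H + B\<^sup>H"
  by (rule matrix_eqI) (simp add: ctranspose_def)

lemma ctranspose_idm [simp]: "idm\<^sup>H = idm"
  by (rule matrix_eqI) (simp add: ctranspose_def Finite_Cartesian_Product.mat_def)

lemma ctranspose_rdiag [simp]: "(rdiag l)\<^sup>H = rdiag l"
  by (rule matrix_eqI) (simp add: ctranspose_def rdiag_def)

lemma ctranspose_nth [simp]: "A\<^sup>H $ i $ j = cnj (A $ j $ i)"
  by (simp add: ctranspose_def)

lemma rdiag_mult: "rdiag f ** rdiag g = rdiag (\<lambda>i. f i * g i)"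
proof -
  have "(\<Sum>k\<in>UNIV. (if i = k then complex_of_real (f i) else 0) * (if k = j then complex_of_real (g k) else 0))
    = (if i = j then complex_of_real (f i * g i) else 0)" for i j :: 'a
    by (simp add: if_distrib [of "\<lambda>x. x * _"] cong: if_cong)
  then show ?thesis
    by (simp add: rdiag_def matrix_matrix_mult_def Finite_Cartesian_Product.vec_eq_iff)
qed

lemma rdiag_one: "rdiag (\<lambda>_. 1) = idm"
  by (rule matrix_eqI) (simp add: rdiag_def Finite_Cartesian_Product.mat_def)

lemma rdiag_add: "rdiag f + rdiag g = rdiag (\<lambda>i. f i + g i)"
  by (rule matrix_eqI) (simp add: rdiag_def)

lemma rdiag_diff: "rdiag f - rdiag g = rdiag (\<lambda>i. f i - g i)"
  by (rule matrix_eqI) (simp add: rdiag_def)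

lemma matrix_mult_rdiag_nth: "(A ** rdiag l) $ i $ j = A $ i $ j * complex_of_real (l j)"
  by (simp add: matrix_matrix_mult_def rdiag_def if_distrib [of "\<lambda>x. _ * x"] cong: if_cong)

lemma rdiag_matrix_mult_nth: "(rdiag l ** A) $ i $ j = complex_of_real (l i) * A $ i $ j"
  by (simp add: matrix_matrix_mult_def rdiag_def if_distrib [of "\<lambda>x. x * _"] cong: if_cong)

lemma matrix_diff_ldistrib: "A ** (B - C) = A ** B - A ** (C :: complex^'a^'b)"
  by (rule matrix_eqI) (simp add: matrix_matrix_mult_def right_diff_distrib sum_subtractf)

lemma matrix_diff_rdistrib: "(B - C) ** A = B ** A - (C :: complex^'a^'b) ** A"
  by (rule matrix_eqI) (simp add: matrix_matrix_mult_def left_diff_distrib sum_subtractf)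

lemma matrix_minus_mult: "(- A) ** B = - (A ** (B :: complex^'a^'b))"
  by (rule matrix_eqI) (simp add: matrix_matrix_mult_def sum_negf)

lemma matrix_mult_minus: "A ** (- B) = - (A ** (B :: complex^'a^'b))"
  by (rule matrix_eqI) (simp add: matrix_matrix_mult_def sum_negf)

section \<open>Frobenius norm estimates\<close>

lemma norm_matrix_sq:
  "(norm (A :: complex^'c^'r))\<^sup>2 = (\<Sum>i\<in>UNIV. \<Sum>j\<in>UNIV. (cmod (A $ i $ j))\<^sup>2)"
  by (simp add: norm_vec_def L2_set_def sum_nonneg)

lemma norm_ctranspose [simp]: "norm (A\<^sup>H) = norm (A :: complex^'c^'r)"
proof -
  have "(norm (A\<^sup>H))\<^sup>2 = (norm A)\<^sup>2"
    unfolding norm_matrix_sq by (subst sum.swap) simp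
  then show ?thesis by simp
qed

lemma cmod_sum_mult_sq_le:
  "(cmod (\<Sum>k\<in>K. f k * g k))\<^sup>2 \<le> (\<Sum>k\<in>K. (cmod (f k))\<^sup>2) * (\<Sum>k\<in>K. (cmod (g k))\<^sup>2)"
proof -
  have "cmod (\<Sum>k\<in>K. f k * g k) \<le> (\<Sum>k\<in>K. cmod (f k) * cmod (g k))"
    by (rule order_trans [OF norm_sum]) (simp add: norm_mult)
  then have "(cmod (\<Sum>k\<in>K. f k * g k))\<^sup>2 \<le> (\<Sum>k\<in>K. cmod (f k) * cmod (g k))\<^sup>2"
    by (intro power_mono) auto
  also have "\<dots> \<le> (\<Sum>k\<in>K. (cmod (f k))\<^sup>2) * (\<Sum>k\<in>K. (cmod (g k))\<^sup>2)"
    by (rule Cauchy_Schwarz_ineq_sum)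
  finally show ?thesis .
qed

lemma norm_matrix_mult_le:
  "norm (A ** B) \<le> norm A * norm (B :: complex^'a^'b)" for A :: "complex^'b^'c"
proof (rule power2_le_imp_le)
  have "(norm (A ** B))\<^sup>2 \<le> (\<Sum>i\<in>UNIV. \<Sum>j\<in>UNIV.
      (\<Sum>k\<in>UNIV. (cmod (A $ i $ k))\<^sup>2) * (\<Sum>k\<in>UNIV. (cmod (B $ k $ j))\<^sup>2))"
    unfolding norm_matrix_sq matrix_matrix_mult_def
    by (intro sum_mono) (simp add: cmod_sum_mult_sq_le)
  also have "\<dots> = (\<Sum>i\<in>UNIV. \<Sum>k\<in>UNIV. (cmod (A $ i $ k))\<^sup>2) * (\<Sum>j\<in>UNIV. \<Sum>k\<in>UNIV. (cmod (B $ k $ j))\<^sup>2)"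
    by (simp add: sum_product)
  also have "\<dots> = (norm A * norm B)\<^sup>2"
    unfolding power_mult_distrib norm_matrix_sq by (subst (2) sum.swap) simp
  finally show "(norm (A ** B))\<^sup>2 \<le> (norm A * norm B)\<^sup>2" .
qed simp

lemma norm_vec_sq: "(norm (x :: complex^'r))\<^sup>2 = (\<Sum>i\<in>UNIV. (cmod (x $ i))\<^sup>2)"
  by (simp add: norm_vec_def L2_set_def sum_nonneg)

lemma norm_matrix_vector_le: "norm (A *v x) \<le> norm A * norm x" for A :: "complex^'b^'c"
proof (rule power2_le_imp_le)
  have "(norm (A *v x))\<^sup>2 \<le> (\<Sum>i\<in>UNIV.
      (\<Sum>k\<in>UNIV. (cmod (A $ i $ k))\<^sup>2) * (\<Sum>k\<in>UNIV. (cmod (x $ k))\<^sup>2))"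
    unfolding norm_vec_sq matrix_vector_mult_def
    by (intro sum_mono) (simp add: cmod_sum_mult_sq_le)
  also have "\<dots> = (norm A * norm x)\<^sup>2"
    unfolding power_mult_distrib norm_matrix_sq norm_vec_sq by (simp add: sum_distrib_right)
  finally show "(norm (A *v x))\<^sup>2 \<le> (norm A * norm x)\<^sup>2" .
qed simp

lemma norm_matrix_nth_le: "cmod (A $ i $ j) \<le> norm (A :: complex^'c^'r)"
  by (meson Finite_Cartesian_Product.norm_nth_le order_trans)

section \<open>The complex inner product\<close>

lemma hip_add_right: "hip x (y + z) = hip x y + hip x z"
  by (simp add: hip_def sum.distrib algebra_simps)

lemma hip_scaleR_right: "hip x (c *\<^sub>R y) = complex_of_real c * hip x y"
  by (simp add: hip_def sum_distrib_left scaleR_conv_of_real [where 'a = complex] mult_ac)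

lemma hip_smult_left: "hip (c *s x) y = cnj c * hip x y"
  by (simp add: hip_def sum_distrib_left algebra_simps)

lemma hip_commute: "hip y x = cnj (hip x y)"
  by (simp add: hip_def mult.commute)

lemma Re_hip: "Re (hip x y) = inner x y"
  by (simp add: hip_def inner_vec_def inner_complex_def)

lemma hip_self: "hip x x = complex_of_real ((norm x)\<^sup>2)"
proof -
  have "Im (hip x x) = 0"
    by (simp add: hip_def)
  moreover have "Re (hip x x) = (norm x)\<^sup>2"
    by (simp add: Re_hip power2_norm_eq_inner)
  ultimately show ?thesis by (simp add: complex_eq_iff)
qed

lemma hip_matrix: "hip x (A *v y) = hip (A\<^sup>H *v x) y"
proof -
  have "(\<Sum>i\<in>UNIV. \<Sum>k\<in>UNIV. cnj (x $ i) * (A $ i $ k * y $ k)) =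
    (\<Sum>k\<in>UNIV. \<Sum>i\<in>UNIV. cnj (x $ i) * (A $ i $ k * y $ k))"
    by (rule sum.swap)
  then show ?thesis
    by (simp add: hip_def matrix_vector_mult_def sum_distrib_left sum_distrib_right mult_ac)
qed

lemma matrix_vector_smult: "A *v (c *s x) = c *s (A *v (x :: complex^'a))"
  by (simp add: matrix_vector_mult_def Finite_Cartesian_Product.vec_eq_iff sum_distrib_left mult_ac)

lemma scaleR_eq_smult: "c *\<^sub>R x = complex_of_real c *s (x :: complex^'a)"
  by (simp add: Finite_Cartesian_Product.vec_eq_iff scaleR_conv_of_real [where 'a = complex])

lemma matrix_vector_scaleR: "A *v (c *\<^sub>R x) = c *\<^sub>R (A *v (x :: complex^'a))"
  by (simp only: scaleR_eq_smult matrix_vector_smult)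

lemma stiefel_columns:
  "(\<chi> i j. u j $ i) \<in> stiefel \<longleftrightarrow> (\<forall>i j. hip (u i) (u j) = (if i = j then 1 else 0))"
  by (simp add: stiefel_def Finite_Cartesian_Product.vec_eq_iff matrix_matrix_mult_def hip_def
      Finite_Cartesian_Product.mat_def)

text \<open>The conditions become the rows of a square matrix whose row \<open>a\<close> is zero.
  Its determinant vanishes, so it has a kernel.\<close>

lemma exists_orthogonal_to_fewer:
  fixes u :: "'i::finite \<Rightarrow> complex^'i"
  assumes "a \<notin> I"
  shows "\<exists>x. x \<noteq> 0 \<and> (\<forall>i\<in>I. hip (u i) x = 0)"
proof -
  define R :: "complex^'i^'i" where "R = (\<chi> i. if i \<in> I then (\<chi> j. cnj (u i $ j)) else 0)"
  have "Finite_Cartesian_Product.row a R = 0"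
    using assms by (simp add: R_def Finite_Cartesian_Product.row_def Finite_Cartesian_Product.vec_eq_iff)
  then have "Determinants.det R = 0"
    by (rule det_zero_row)
  then have "\<not> (\<exists>B. B ** R = idm)"
    using invertible_det_nz invertible_left_inverse by metis
  then obtain x where x: "R *v x = 0" "x \<noteq> 0"
    unfolding matrix_left_invertible_ker by blast
  have "hip (u i) x = 0" if "i \<in> I" for i
  proof -
    have "(R *v x) $ i = 0" using x by simp
    then show ?thesis
      using that by (simp add: R_def matrix_vector_mult_def hip_def)
  qed
  with x show ?thesis by blast
qed

section \<open>The spectral theorem for Hermitian matrices\<close>

lemma quadratic_nonneg_imp_zero:
  fixes a b :: real
  assumes "\<And>t. 2 * t * a + t\<^sup>2 * b \<ge> 0"
  shows "a = 0"
proof (rule ccontr)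
  assume "a \<noteq> 0"
  \<comment> \<open>A step against the sign of \<open>a\<close>, short enough for the linear term to
    dominate the quadratic one whatever the sign of \<open>b\<close>.\<close>
  define t where "t = - a / (\<bar>b\<bar> + 1)"
  have t: "t * (\<bar>b\<bar> + 1) = - a" by (simp add: t_def)
  have "t \<noteq> 0" using \<open>a \<noteq> 0\<close> t by auto
  have "a = - t * (\<bar>b\<bar> + 1)" using t by simp
  then have "2 * t * a + t\<^sup>2 * b = - t\<^sup>2 * (2 * (\<bar>b\<bar> + 1) - b)"
    by (simp only: power2_eq_square) (simp add: algebra_simps)
  moreover have "t\<^sup>2 * (2 * (\<bar>b\<bar> + 1) - b) > 0"
    using \<open>t \<noteq> 0\<close> by (intro mult_pos_pos) auto
  ultimately show False using assms [of t] by simp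
qed

lemma hermitian_hip: "M\<^sup>H = M \<Longrightarrow> hip x (M *v y) = hip (M *v x) y"
  by (metis hip_matrix)

lemma hermitian_inner: "M\<^sup>H = M \<Longrightarrow> inner x (M *v y) = inner (M *v x) y"
  by (metis hermitian_hip Re_hip)

lemma continuous_on_hip: "continuous_on S (hip u)"
  unfolding hip_def by (intro continuous_intros)

text \<open>The next eigenvector minimizes the Rayleigh quotient on the orthogonal complement
  \<open>T\<close> of those already found. \<open>T\<close> is nonzero as long as some index
  \<open>a\<close> is still missing from \<open>I\<close>, which is why the induction runs over
  subsets of \<open>'n\<close>.\<close>

lemma hermitian_orthonormal_extension:
  fixes M :: "complex^'n^'n" and I :: "'n set"
  assumes herm: "M\<^sup>H = M" and "finite I"
  shows "\<exists>u l. \<forall>i\<in>I. M *v u i = complex_of_real (l i) *s u i \<and>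
    (\<forall>j\<in>I. hip (u i) (u j) = (if i = j then 1 else 0))"
  using \<open>finite I\<close>
proof (induction I rule: finite_induct)
  case empty
  then show ?case by simp
next
  case (insert a I)
  then obtain u l where u: "\<And>i. i \<in> I \<Longrightarrow> M *v u i = complex_of_real (l i) *s u i"
      "\<And>i j. i \<in> I \<Longrightarrow> j \<in> I \<Longrightarrow> hip (u i) (u j) = (if i = j then 1 else 0)"
    by blast
  define T where "T = {x. \<forall>i\<in>I. hip (u i) x = 0}"
  define f where "f x = inner x (M *v x)" for x
  have T_lin: "x + t *\<^sub>R y \<in> T" if "x \<in> T" "y \<in> T" for x y t
    using that by (simp add: T_def hip_add_right hip_scaleR_right)
  have T_scale: "t *\<^sub>R y \<in> T" if "y \<in> T" for y t
    using that by (simp add: T_def hip_scaleR_right)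
  have closedT: "closed T"
  proof -
    have "T = (\<Inter>i\<in>I. hip (u i) -` {0})" by (auto simp: T_def)
    moreover have "closed (hip (u i) -` {0})" for i
      by (rule closed_vimage [OF closed_singleton continuous_on_hip])
    ultimately show ?thesis by auto
  qed
  then have K: "compact (sphere 0 1 \<inter> T)"
    by (intro compact_Int_closed) auto
  obtain x where "x \<noteq> 0" "\<forall>i\<in>I. hip (u i) x = 0"
    using exists_orthogonal_to_fewer [OF insert.hyps(2)] by blast
  then have "x \<noteq> 0" "x \<in> T" by (auto simp: T_def)
  then have "(1 / norm x) *\<^sub>R x \<in> sphere 0 1 \<inter> T"
    using T_scale by (simp add: dist_norm)
  then have "sphere 0 1 \<inter> T \<noteq> {}" by blast
  moreover have "continuous_on (sphere 0 1 \<inter> T) f"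
    unfolding f_def
    by (intro continuous_intros linear_continuous_on_compose matrix_vector_mul_linear)
  ultimately obtain x0 where x0: "x0 \<in> sphere 0 1" "x0 \<in> T"
    and min: "\<And>y. y \<in> sphere 0 1 \<inter> T \<Longrightarrow> f x0 \<le> f y"
    using continuous_attains_inf [OF K] by blast
  have "inner x0 x0 = 1" using x0 by (simp flip: power2_norm_eq_inner)
  have fscale: "f (t *\<^sub>R y) = t\<^sup>2 * f y" for t y
    by (simp add: f_def matrix_vector_scaleR power2_eq_square)
  have min': "f x0 * inner y y \<le> f y" if "y \<in> T" for y
  proof (cases "y = 0")
    case False
    then have "(1 / norm y) *\<^sub>R y \<in> sphere 0 1 \<inter> T"
      using T_scale [OF that] by (simp add: dist_norm)
    then have "f x0 \<le> f ((1 / norm y) *\<^sub>R y)" by (rule min)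
    also have "\<dots> = f y / (norm y)\<^sup>2" by (simp add: fscale power_divide)
    finally show ?thesis
      using False by (simp add: power2_norm_eq_inner field_simps)
  qed (simp add: f_def)
  \<comment> \<open>The residual of the eigenvalue equation. As \<open>M\<close> is Hermitian,
    \<open>T\<close> is invariant, so \<open>r\<close> is an admissible direction. The expression
    \<open>f y - f x0 * inner y y\<close> is nonnegative on \<open>T\<close> and vanishes at
    \<open>x0\<close>; its first variation there along \<open>r\<close> is
    \<open>2 * inner r r\<close>, which must then be zero.\<close>
  define r where "r = M *v x0 - f x0 *\<^sub>R x0"
  have "M *v x0 \<in> T"
    using x0(2) by (simp add: T_def hermitian_hip [OF herm] u hip_smult_left)
  then have rT: "r \<in> T"
    using T_lin [OF _ x0(2), of _ "- f x0"] by (simp add: r_def)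
  have "2 * t * inner r r + t\<^sup>2 * (f r - f x0 * inner r r) \<ge> 0" for t
  proof -
    have e1: "f (x0 + t *\<^sub>R r) = f x0 + 2 * t * inner r (M *v x0) + t\<^sup>2 * f r"
      using hermitian_inner [OF herm, of x0 r]
      by (simp add: f_def matrix_vector_scaleR power2_eq_square inner_commute [of "M *v x0" r] algebra_simps)
    have e2: "inner (x0 + t *\<^sub>R r) (x0 + t *\<^sub>R r) = 1 + 2 * t * inner r x0 + t\<^sup>2 * inner r r"
      using \<open>inner x0 x0 = 1\<close>
      by (simp add: inner_commute [of x0 r] power2_eq_square algebra_simps)
    have e3: "inner r r = inner r (M *v x0) - f x0 * inner r x0"
      by (metis inner_diff_right inner_scaleR_right r_def)
    have "2 * t * inner r r = 2 * t * inner r (M *v x0) - 2 * t * (f x0 * inner r x0)"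
      by (subst e3) (simp only: right_diff_distrib mult.assoc)
    then show ?thesis
      using min' [OF T_lin [OF x0(2) rT, of t], unfolded e1 e2] by (simp add: algebra_simps)
  qed
  then have "inner r r = 0"
    by (rule quadratic_nonneg_imp_zero)
  then have eig: "M *v x0 = complex_of_real (f x0) *s x0"
    by (simp add: r_def scaleR_eq_smult)
  have self: "hip x0 x0 = 1"
    using x0(1) by (simp add: hip_self)
  have orth: "hip (u i) x0 = 0" "hip x0 (u i) = 0" if "i \<in> I" for i
    using x0(2) that hip_commute [of x0 "u i"] by (auto simp: T_def)
  show ?case
    by (rule exI [of _ "u(a := x0)"], rule exI [of _ "l(a := f x0)"])
      (use u eig self orth insert.hyps in auto)
qed

theorem hermitian_unitary_diagonalization:
  fixes M :: "complex^'n^'n"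
  assumes "M\<^sup>H = M"
  obtains U :: "complex^'n^'n" and l where "U \<in> stiefel" "M ** U = U ** rdiag l"
proof -
  obtain u :: "'n \<Rightarrow> complex^'n" and l where u: "\<And>i. M *v u i = complex_of_real (l i) *s u i"
      "\<And>i j. hip (u i) (u j) = (if i = j then 1 else 0)"
    using hermitian_orthonormal_extension [OF assms finite [of UNIV]] by (metis UNIV_I)
  show thesis
  proof
    show "(\<chi> i j. u j $ i) \<in> stiefel"
      using u(2) by (simp add: stiefel_columns)
    have "(M ** (\<chi> i j. u j $ i)) $ i $ j = ((\<chi> i j. u j $ i) ** rdiag l) $ i $ j" for i j
    proof -
      have "(M ** (\<chi> i j. u j $ i)) $ i $ j = (M *v u j) $ i"
        by (simp add: matrix_matrix_mult_def matrix_vector_mult_def)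
      then show ?thesis
        by (simp add: u(1) matrix_mult_rdiag_nth mult.commute)
    qed
    then show "M ** (\<chi> i j. u j $ i) = (\<chi> i j. u j $ i) ** rdiag l"
      by (simp add: Finite_Cartesian_Product.vec_eq_iff)
  qed
qed

lemma stiefel_square: "U \<in> stiefel \<Longrightarrow> U ** U\<^sup>H = idm" for U :: "complex^'n^'n"
  by (simp add: stiefel_def matrix_left_right_inverse)

lemma stiefel_D: "V \<in> stiefel \<Longrightarrow> V\<^sup>H ** V = idm"
  by (simp add: stiefel_def)

subsection \<open>Characteristic polynomials\<close>

text \<open>Identities between characteristic polynomials are checked pointwise, where they become
  identities of complex determinants.\<close>

lemma poly_charpoly: "poly (charpoly M) z = Determinants.det (Finite_Cartesian_Product.mat z - M)"
proof -
  have "(\<Prod>i\<in>UNIV. poly ((if i = p i then [:0, 1:] else 0) - [:M $ i $ p i:]) z) =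
    (\<Prod>i\<in>UNIV. (Finite_Cartesian_Product.mat z - M) $ i $ p i)" for p
    by (rule prod.cong) (auto simp: Finite_Cartesian_Product.mat_def)
  then show ?thesis
    by (simp add: charpoly_def Determinants.det_def poly_sum poly_prod)
qed

lemma proots_prod_linear:
  "proots (\<Prod>i\<in>A. [:- f i, 1:]) = image_mset f (mset_set A)" for f :: "'i \<Rightarrow> complex"
proof (cases "finite A")
  case True
  have "proots (\<Prod>i\<in>A. [:- f i, 1:]) = (\<Sum>i\<in>A. {#f i#})"
    by (subst proots_prod) auto
  also have "\<dots> = image_mset f (mset_set A)"
    using True by (induction A rule: finite_induct) auto
  finally show ?thesis .
qed simp

lemma det_rdiag: "Determinants.det (rdiag l) = (\<Prod>i\<in>UNIV. complex_of_real (l i))"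
  by (subst det_diagonal) (auto simp: rdiag_def)

lemma charpoly_rdiag: "charpoly (rdiag l) = (\<Prod>i\<in>UNIV. [:- complex_of_real (l i), 1:])"
proof -
  have "poly (charpoly (rdiag l)) z = poly (\<Prod>i\<in>UNIV. [:- complex_of_real (l i), 1:]) z" for z
    unfolding poly_charpoly poly_prod
    by (subst det_diagonal) (auto simp: rdiag_def Finite_Cartesian_Product.mat_def intro!: prod.cong)
  then show ?thesis by (simp add: poly_eq_poly_eq_iff [symmetric] fun_eq_iff)
qed

lemma mat_mult_commute: "Finite_Cartesian_Product.mat z ** U = U ** Finite_Cartesian_Product.mat z"
  for U :: "complex^'a^'a"
  by (rule matrix_eqI) (simp add: Finite_Cartesian_Product.mat_def matrix_matrix_mult_def
      if_distrib [of "\<lambda>x. x * _"] if_distrib [of "\<lambda>x. _ * x"] mult.commute cong: if_cong)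

lemma charpoly_similar:
  fixes U :: "complex^'n^'n"
  assumes "M ** U = U ** N" "invertible U"
  shows "charpoly M = charpoly N"
proof -
  have "Determinants.det U \<noteq> 0"
    using assms(2) by (simp add: invertible_det_nz)
  have "poly (charpoly M) z = poly (charpoly N) z" for z
  proof -
    have "(Finite_Cartesian_Product.mat z - M) ** U = U ** (Finite_Cartesian_Product.mat z - N)"
      by (simp add: matrix_diff_ldistrib matrix_diff_rdistrib assms mat_mult_commute)
    then have "Determinants.det (Finite_Cartesian_Product.mat z - M) * Determinants.det U =
      Determinants.det U * Determinants.det (Finite_Cartesian_Product.mat z - N)"
      by (metis Determinants.det_mul)
    then show ?thesis using \<open>Determinants.det U \<noteq> 0\<close> by (simp add: poly_charpoly)
  qed
  then show ?thesis by (simp add: poly_eq_poly_eq_iff [symmetric] fun_eq_iff)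
qed

lemma stiefel_invertible: "U \<in> stiefel \<Longrightarrow> invertible U" for U :: "complex^'n^'n"
  using invertible_left_inverse stiefel_D by blast

lemma proots_charpoly_unitary:
  fixes U :: "complex^'n^'n"
  assumes "U \<in> stiefel" "M ** U = U ** rdiag l"
  shows "proots (charpoly M) = image_mset (\<lambda>i. complex_of_real (l i)) (mset_set UNIV)"
  using charpoly_similar [OF assms(2) stiefel_invertible [OF assms(1)]]
  by (simp add: charpoly_rdiag proots_prod_linear)

lemma eigvals_asc_unitary:
  fixes U :: "complex^'n^'n"
  assumes "U \<in> stiefel" "M ** U = U ** rdiag l"
  shows "eigvals_asc M = sorted_list_of_multiset (image_mset l (mset_set UNIV))"
  unfolding eigvals_asc_def proots_charpoly_unitary [OF assms]
  by (simp add: image_mset.compositionality comp_def)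

section \<open>Positions in a finite index type\<close>

lemma bij_betw_ix: "bij_betw ix (UNIV :: 'a::finite set) {0..<CARD('a)}"
  using to_nat_on_finite [of "UNIV :: 'a set"]
  by (simp add: ix_def [abs_def] atLeast0LessThan eta_contract_eq)

lemma ix_less: "ix (j :: 'a::finite) < CARD('a)"
  using bij_betw_ix by (metis UNIV_I atLeastLessThan_iff bij_betwE)

text \<open>Sorted lists and functions on a finite type meet only through \<open>ix\<close>. As
  multisets they agree, so the enumeration chosen does not matter.\<close>

lemma mset_nth_ix:
  assumes "length xs = CARD('a::finite)"
  shows "image_mset (\<lambda>j :: 'a. xs ! ix j) (mset_set UNIV) = mset xs"
proof -
  have "image_mset ix (mset_set (UNIV :: 'a set)) = mset_set {0..<length xs}"
    using bij_betw_ix [where 'a = 'a] assms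
    by (metis bij_betw_def image_mset_mset_set)
  then have "image_mset ((!) xs) (image_mset ix (mset_set (UNIV :: 'a set))) = mset (map ((!) xs) [0..<length xs])"
    by simp
  then show ?thesis
    by (simp add: map_nth image_mset.compositionality comp_def)
qed

section \<open>Ordered eigenvalues and the eigenvalue gap\<close>

lemma ix_surj:
  assumes "i < CARD('a)"
  obtains j :: "'a::finite" where "ix j = i"
  using assms bij_betw_ix [where 'a = 'a] unfolding bij_betw_def
  by (metis (no_types, lifting) atLeastLessThan_iff imageE le0)

lemma sorted_eigvals_asc: "sorted (eigvals_asc M)"
  by (simp add: eigvals_asc_def)

text \<open>The index type carries no order, so the columns of \<open>U\<close> stay where they are
  and \<open>e\<close> lists them by increasing eigenvalue.\<close>

lemma hermitian_ordered_diagonalization: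
  fixes M :: "complex^'n^'n"
  assumes "M\<^sup>H = M"
  obtains U :: "complex^'n^'n" and l e where "U \<in> stiefel" "M ** U = U ** rdiag l"
    "bij_betw e {0..<CARD('n)} UNIV" "eigvals_asc M = map (\<lambda>i. l (e i)) [0..<CARD('n)]"
proof -
  obtain U :: "complex^'n^'n" and l where U: "U \<in> stiefel" "M ** U = U ** rdiag l"
    using hermitian_unitary_diagonalization [OF assms] by blast
  obtain es :: "'n list" where es: "set es = UNIV" "distinct es"
    using finite_distinct_list [OF finite [of UNIV]] by blast
  define ys where "ys = sort_key l es"
  have ys: "set ys = UNIV" "distinct ys" "sorted (map l ys)"
    using es by (auto simp: ys_def)
  have len: "length ys = CARD('n)"
    using distinct_card [OF ys(2)] ys(1) by simp
  have "image_mset l (mset_set UNIV) = mset (map l ys)"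
    using mset_set_set [OF ys(2)] ys(1) by simp
  then have "eigvals_asc M = sort (map l ys)"
    by (simp add: eigvals_asc_unitary [OF U] del: mset_map)
  also have "\<dots> = map l ys"
    using ys(3) by (simp add: sorted_sort_id)
  also have "\<dots> = map (\<lambda>i. l (ys ! i)) [0..<CARD('n)]"
    by (simp add: len list_eq_iff_nth_eq)
  finally have "eigvals_asc M = map (\<lambda>i. l (ys ! i)) [0..<CARD('n)]" .
  moreover have "bij_betw ((!) ys) {0..<CARD('n)} UNIV"
    using bij_betw_nth [OF ys(2), of "{0..<CARD('n)}" UNIV] len ys(1)
    by (simp add: atLeast0LessThan)
  ultimately show thesis using that U by blast
qed

lemma length_eigvals_asc: "M\<^sup>H = M \<Longrightarrow> length (eigvals_asc M) = CARD('n)" for M :: "complex^'n^'n"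
  by (metis hermitian_ordered_diagonalization length_map length_upt minus_nat.diff_0)

lemma eigval_mono:
  fixes M :: "complex^'n^'n"
  assumes "M\<^sup>H = M" "i \<le> j" "1 \<le> i" "j \<le> CARD('n)"
  shows "eigval i M \<le> eigval j M"
  unfolding eigval_def using assms
  by (intro sorted_nth_mono [OF sorted_eigvals_asc]) (auto simp: length_eigvals_asc)

lemma stiefel_submatrix:
  assumes "U \<in> stiefel" "inj g"
  shows "(\<chi> i j. U $ i $ g j) \<in> stiefel"
proof -
  have "(U\<^sup>H ** U) $ g a $ g b = (if a = b then 1 else 0)" for a b
    using stiefel_D [OF assms(1)] assms(2)
    by (auto simp: Finite_Cartesian_Product.mat_def inj_eq)
  then show ?thesis
    unfolding stiefel_def mem_Collect_eq
    by (intro matrix_eqI) (simp add: matrix_matrix_mult_def Finite_Cartesian_Product.mat_def)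
qed

text \<open>The eigenvectors at the lowest \<open>CARD('k)\<close> positions form a successor. This
  makes every point the start of some run, without which lower bounds on the contraction factors
  would be vacuous.\<close>

lemma scf_step_exists:
  fixes V :: "complex^'k^'n"
  assumes herm: "(H V)\<^sup>H = H V" and card: "CARD('k) \<le> CARD('n)"
  obtains W where "scf_step H V W"
proof -
  obtain U :: "complex^'n^'n" and l e where U: "U \<in> stiefel" "H V ** U = U ** rdiag l"
    and e: "bij_betw e {0..<CARD('n)} UNIV"
    and eig: "eigvals_asc (H V) = map (\<lambda>i. l (e i)) [0..<CARD('n)]"
    by (rule hermitian_ordered_diagonalization [OF herm])
  define g where "g j = e (ix j)" for j :: 'k
  define W where "W = (\<chi> i j. U $ i $ g j)"
  have "inj g"
  proof (rule injI)
    fix a b :: 'k assume "g a = g b"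
    moreover have "ix a \<in> {0..<CARD('n)}" "ix b \<in> {0..<CARD('n)}"
      using ix_less [of a] ix_less [of b] card by auto
    ultimately have "ix a = ix b"
      using e unfolding g_def bij_betw_def inj_on_def by blast
    then show "a = b"
      using bij_betw_ix [where 'a = 'k] by (auto simp: bij_betw_def inj_on_def)
  qed
  have "take CARD('k) (eigvals_asc (H V)) ! ix j = l (g j)" for j :: 'k
    using ix_less [of j] card by (simp add: eig g_def)
  then have "image_mset (\<lambda>j. l (g j)) (mset_set UNIV) = mset (take CARD('k) (eigvals_asc (H V)))"
    using mset_nth_ix [of "take CARD('k) (eigvals_asc (H V))", where 'a = 'k] card
    by (simp add: eig)
  moreover have "H V ** W = W ** rdiag (\<lambda>j. l (g j))"
  proof (rule matrix_eqI)
    fix i j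
    have "(H V ** W) $ i $ j = (H V ** U) $ i $ g j"
      by (simp add: W_def matrix_matrix_mult_def)
    then show "(H V ** W) $ i $ j = (W ** rdiag (\<lambda>j. l (g j))) $ i $ j"
      by (simp add: U matrix_mult_rdiag_nth W_def)
  qed
  moreover have "W \<in> stiefel"
    unfolding W_def by (rule stiefel_submatrix [OF U(1) \<open>inj g\<close>])
  ultimately have "scf_step H V W"
    unfolding scf_step_def by blast
  then show thesis by (rule that)
qed

section \<open>Rayleigh quotients and eigenvalue perturbation\<close>

lemma stiefel_hip:
  assumes "V \<in> stiefel" shows "hip (V *v a) (V *v b) = hip a b"
  by (metis assms hip_matrix ctranspose_ctranspose matrix_vector_mul_assoc matrix_vector_mul_lid stiefel_D)

lemma stiefel_norm: "V \<in> stiefel \<Longrightarrow> norm (V *v a) = norm a"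
  using stiefel_hip [of V a a] by (simp add: hip_self flip: of_real_power)

lemma rayleigh_diagonal:
  assumes V: "V \<in> stiefel" "M ** V = V ** rdiag l"
  shows "inner (V *v a) (M *v (V *v a)) = (\<Sum>j\<in>UNIV. l j * (cmod (a $ j))\<^sup>2)"
proof -
  have "M *v (V *v a) = V *v (rdiag l *v a)"
    by (simp add: matrix_vector_mul_assoc V)
  then have "inner (V *v a) (M *v (V *v a)) = Re (hip a (rdiag l *v a))"
    by (simp add: Re_hip [symmetric] stiefel_hip [OF V(1)])
  also have "hip a (rdiag l *v a) = (\<Sum>j\<in>UNIV. complex_of_real (l j * (cmod (a $ j))\<^sup>2))"
  proof -
    have "(rdiag l *v a) $ j = complex_of_real (l j) * a $ j" for j
      by (simp add: matrix_vector_mult_def rdiag_def if_distrib [of "\<lambda>x. x * _"] cong: if_cong)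
    then show ?thesis
      unfolding hip_def by (intro sum.cong) (simp_all add: complex_norm_square mult_ac del: of_real_power)
  qed
  finally show ?thesis by simp
qed

text \<open>Courant-Fischer: the range of \<open>V\<close> contains a vector orthogonal to all but one of the \<open>k\<close> lowest
  eigenvectors of \<open>M'\<close>.\<close>

lemma eigval_perturbation:
  fixes V :: "complex^'k^'n"
  assumes herm: "M'\<^sup>H = M'" and card: "CARD('k) \<le> CARD('n)"
    and V: "V \<in> stiefel" "M ** V = V ** rdiag l" and c: "\<And>j. l j \<le> c"
  shows "eigval CARD('k) M' \<le> c + norm (M' - M)"
proof -
  obtain U :: "complex^'n^'n" and m e where U: "U \<in> stiefel" "M' ** U = U ** rdiag m"
    and e: "bij_betw e {0..<CARD('n)} UNIV"
    and eig: "eigvals_asc M' = map (\<lambda>i. m (e i)) [0..<CARD('n)]"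
    by (rule hermitian_ordered_diagonalization [OF herm])
  define k where "k = CARD('k)"
  have k: "0 < k" "k \<le> CARD('n)" using card by (auto simp: k_def)
  define t where "t = m (e (k - 1))"
  have t: "eigval CARD('k) M' = t"
  proof -
    have "k - Suc 0 < CARD('n)" using k by linarith
    then show ?thesis by (simp add: eigval_def eig t_def flip: k_def)
  qed
  have t_le: "t \<le> m (e i)" if "k - 1 \<le> i" "i < CARD('n)" for i
    using sorted_nth_mono [OF sorted_eigvals_asc, of "k - 1" i M'] that k by (simp add: eig t_def)
  define u where "u i = (\<chi> r. U $ r $ i)" for i
  obtain j0 :: 'k where j0: "ix j0 = k - 1"
    using ix_surj [of "k - 1", where 'a = 'k] k by (auto simp: k_def)
  \<comment> \<open>Pulled back by \<open>V\<^sup>H\<close>, orthogonality to \<open>k - 1\<close>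
    eigenvectors is a system of \<open>k - 1\<close> equations in \<open>k\<close> unknowns. The
    index \<open>j0\<close> at position \<open>k - 1\<close> is the one left without an
    equation.\<close>
  have "\<exists>a. a \<noteq> 0 \<and> (\<forall>j\<in>- {j0}. hip (V\<^sup>H *v u (e (ix j))) a = 0)"
    by (rule exists_orthogonal_to_fewer [of j0]) simp
  then obtain a where a: "a \<noteq> 0" "\<And>j :: 'k. j \<noteq> j0 \<Longrightarrow> hip (V\<^sup>H *v u (e (ix j))) a = 0"
    by auto
  define x where "x = V *v a"
  have orth: "hip (u (e i)) x = 0" if i: "i < k - 1" for i
  proof -
    obtain j :: 'k where j: "ix j = i"
    proof (rule ix_surj)
      show "i < CARD('k)" using i by (simp add: k_def)
    qed
    have "j \<noteq> j0" using i j j0 by auto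
    then show ?thesis
      using a(2) [of j] j by (simp add: x_def hip_matrix)
  qed
  define y where "y = U\<^sup>H *v x"
  have "U *v y = x"
    by (simp add: y_def matrix_vector_mul_assoc stiefel_square [OF U(1)])
  have y_nth: "y $ i = hip (u i) x" for i
    by (simp add: y_def u_def hip_def matrix_vector_mult_def)
  have "t * (norm x)\<^sup>2 = (\<Sum>i\<in>UNIV. t * (cmod (y $ i))\<^sup>2)"
    using stiefel_norm [OF U(1), of y] \<open>U *v y = x\<close> by (simp add: norm_vec_sq sum_distrib_left)
  \<comment> \<open>The components of \<open>x\<close> below position \<open>k - 1\<close> vanish,
    and at all other positions the eigenvalue of \<open>M'\<close> is at least
    \<open>t\<close>.\<close>
  also have "\<dots> \<le> (\<Sum>i\<in>UNIV. m i * (cmod (y $ i))\<^sup>2)"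
  proof (rule sum_mono)
    fix i :: 'n
    obtain r where r: "r < CARD('n)" "e r = i"
      using e unfolding bij_betw_def by (metis UNIV_I atLeastLessThan_iff imageE)
    show "t * (cmod (y $ i))\<^sup>2 \<le> m i * (cmod (y $ i))\<^sup>2"
    proof (cases "r < k - 1")
      case True
      then show ?thesis using orth [of r] r by (simp add: y_nth)
    next
      case False
      then show ?thesis using t_le [of r] r by (intro mult_right_mono) auto
    qed
  qed
  also have "\<dots> = inner x (M' *v x)"
    using rayleigh_diagonal [OF U, of y] \<open>U *v y = x\<close> by simp
  also have "\<dots> = inner x (M *v x) + inner x ((M' - M) *v x)"
    by (simp add: matrix_vector_mult_diff_rdistrib inner_diff_right)
  also have "\<dots> \<le> c * (norm x)\<^sup>2 + norm (M' - M) * (norm x)\<^sup>2"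
  proof (rule add_mono)
    have "inner x (M *v x) = (\<Sum>j\<in>UNIV. l j * (cmod (a $ j))\<^sup>2)"
      unfolding x_def by (rule rayleigh_diagonal [OF V])
    also have "\<dots> \<le> (\<Sum>j\<in>UNIV. c * (cmod (a $ j))\<^sup>2)"
      by (intro sum_mono mult_right_mono c) auto
    also have "\<dots> = c * (norm x)\<^sup>2"
      by (simp add: x_def stiefel_norm [OF V(1)] norm_vec_sq sum_distrib_left)
    finally show "inner x (M *v x) \<le> c * (norm x)\<^sup>2" .
    have "inner x ((M' - M) *v x) \<le> norm x * norm ((M' - M) *v x)"
      by (rule norm_cauchy_schwarz)
    also have "\<dots> \<le> norm x * (norm (M' - M) * norm x)"
      by (intro mult_left_mono norm_matrix_vector_le) auto
    finally show "inner x ((M' - M) *v x) \<le> norm (M' - M) * (norm x)\<^sup>2"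
      by (simp add: power2_eq_square mult_ac)
  qed
  finally have "t * (norm x)\<^sup>2 \<le> (c + norm (M' - M)) * (norm x)\<^sup>2"
    by (simp add: distrib_right)
  moreover have "norm x > 0"
    using a(1) by (simp add: x_def stiefel_norm [OF V(1)])
  ultimately show ?thesis
    unfolding t by (simp add: power2_eq_square)
qed

lemma scf_step_eigenvalue_le:
  fixes V :: "complex^'k^'n" and l :: "'k \<Rightarrow> real"
  assumes herm: "M\<^sup>H = M" and card: "CARD('k) \<le> CARD('n)"
    and l: "image_mset l (mset_set UNIV) = mset (take CARD('k) (eigvals_asc (M :: complex^'n^'n)))"
  shows "l j \<le> eigval CARD('k) M"
proof -
  have "l j \<in># image_mset l (mset_set UNIV)" by simp
  then have "l j \<in> set (take CARD('k) (eigvals_asc M))" by (simp add: l)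
  then obtain i where i: "i < CARD('k)" "l j = eigvals_asc M ! i"
    by (auto simp: in_set_conv_nth)
  then show ?thesis
    unfolding eigval_def i(2) using card
    by (intro sorted_nth_mono [OF sorted_eigvals_asc]) (auto simp: length_eigvals_asc [OF herm])
qed

section \<open>Entrywise norm bounds\<close>

lemma norm_matrix_le_entrywise:
  fixes B C :: "complex^'c^'r"
  assumes "0 \<le> c" "\<And>i j. cmod (B $ i $ j) \<le> c * cmod (C $ i $ j)"
  shows "norm B \<le> c * norm C"
proof (rule power2_le_imp_le)
  have "(norm B)\<^sup>2 \<le> (\<Sum>i\<in>UNIV. \<Sum>j\<in>UNIV. (c * cmod (C $ i $ j))\<^sup>2)"
    unfolding norm_matrix_sq by (intro sum_mono power_mono assms) auto
  also have "\<dots> = (c * norm C)\<^sup>2"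
    by (simp add: power_mult_distrib norm_matrix_sq sum_distrib_left)
  finally show "(norm B)\<^sup>2 \<le> (c * norm C)\<^sup>2" .
qed (use assms in auto)

lemma norm_hadamard_le:
  assumes "\<And>i j. \<bar>D $ i $ j\<bar> \<le> c" "0 \<le> c"
  shows "norm (hadamard D A) \<le> c * norm A"
  by (rule norm_matrix_le_entrywise)
    (use assms in \<open>auto simp: hadamard_def norm_mult intro!: mult_right_mono\<close>)

lemma hadamard_diff: "hadamard D (A - B) = hadamard D A - hadamard D B"
  by (rule matrix_eqI) (simp add: hadamard_def algebra_simps)

lemma hadamard_add: "hadamard D (A + B) = hadamard D A + hadamard D B"
  by (rule matrix_eqI) (simp add: hadamard_def algebra_simps)

lemma hadamard_minus: "hadamard D (- A) = - (hadamard D A)"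
  by (rule matrix_eqI) (simp add: hadamard_def algebra_simps)

lemma hadamard_scaleR: "hadamard D (c *\<^sub>R A) = c *\<^sub>R (hadamard D A)"
  by (rule matrix_eqI) (simp add: hadamard_def algebra_simps)

subsection \<open>The problem at a solution\<close>

locale nepv =
  fixes H :: "complex^'k^'n \<Rightarrow> complex^'n^'n" and Vs :: "complex^'k^'n" and Vp :: "complex^'m^'n"
  assumes dims: "CARD('n) = CARD('k) + CARD('m)"
    and H_herm: "\<And>V. (H V)\<^sup>H = H V"
    and H_inv: "\<And>V Q. Q \<in> stiefel \<Longrightarrow> H (V ** Q) = H V"
    and decomp: "eigendecomposition (H Vs) Vs Vp"
    and gap: "eigval (CARD('k) + 1) (H Vs) - eigval CARD('k) (H Vs) > 0"
begin

definition lam :: "'k \<Rightarrow> real" where "lam j = eigval (ix j + 1) (H Vs)"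
definition mu :: "'m \<Rightarrow> real" where "mu i = eigval (CARD('k) + (ix i + 1)) (H Vs)"
abbreviation G :: "real^'k^'m" where "G \<equiv> gap_matrix (H Vs)"
definition gam :: real where "gam = eigval (CARD('k) + 1) (H Vs) - eigval CARD('k) (H Vs)"

lemma card_le: "CARD('k) \<le> CARD('n)" using dims by simp

lemma Lam_eq: "Lam (H Vs) = rdiag lam"
  by (simp add: Lam_def lam_def [abs_def])

lemma Lam_perp_eq: "Lam_perp TYPE('k) (H Vs) = rdiag mu"
  by (simp add: Lam_perp_def mu_def [abs_def])

lemma gam_pos: "gam > 0" using gap by (simp add: gam_def)

lemma lam_le: "lam j \<le> eigval CARD('k) (H Vs)"
  unfolding lam_def using ix_less [of j] card_le by (intro eigval_mono H_herm) auto

lemma mu_ge: "eigval CARD('k) (H Vs) + gam \<le> mu i"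
  unfolding mu_def gam_def using ix_less [of i] dims by (simp, intro eigval_mono H_herm) auto

lemma mu_lam: "gam \<le> mu i - lam j"
  using lam_le [of j] mu_ge [of i] by simp

lemma unitary_hcat:
  "Vs\<^sup>H ** Vs = idm" "Vp\<^sup>H ** Vp = idm" "Vs\<^sup>H ** Vp = 0" "Vp\<^sup>H ** Vs = 0"
  "Vs ** Vs\<^sup>H + Vp ** Vp\<^sup>H = idm"
proof -
  have d: "((hcat Vs Vp)\<^sup>H ** hcat Vs Vp) $ s $ t = (if s = t then 1 else 0)" for s t
    using decomp by (simp add: eigendecomposition_def Finite_Cartesian_Product.mat_def)
  have "(Vs\<^sup>H ** Vs) $ i $ j = (if i = j then 1 else 0)" for i j
    using d [of "Inl i" "Inl j"] by (simp add: hcat_def matrix_matrix_mult_def)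
  then show "Vs\<^sup>H ** Vs = idm"
    by (intro matrix_eqI) (simp add: Finite_Cartesian_Product.mat_def)
  have "(Vp\<^sup>H ** Vp) $ i $ j = (if i = j then 1 else 0)" for i j
    using d [of "Inr i" "Inr j"] by (simp add: hcat_def matrix_matrix_mult_def)
  then show "Vp\<^sup>H ** Vp = idm"
    by (intro matrix_eqI) (simp add: Finite_Cartesian_Product.mat_def)
  have "(Vs\<^sup>H ** Vp) $ i $ j = 0" for i j
    using d [of "Inl i" "Inr j"] by (simp add: hcat_def matrix_matrix_mult_def)
  then show "Vs\<^sup>H ** Vp = 0"
    by (intro matrix_eqI) simp
  have "(Vp\<^sup>H ** Vs) $ i $ j = 0" for i j
    using d [of "Inr i" "Inl j"] by (simp add: hcat_def matrix_matrix_mult_def)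
  then show "Vp\<^sup>H ** Vs = 0"
    by (intro matrix_eqI) simp
  show "Vs ** Vs\<^sup>H + Vp ** Vp\<^sup>H = idm"
  proof (rule matrix_eqI)
    fix i j
    have "(hcat Vs Vp ** (hcat Vs Vp)\<^sup>H) $ i $ j = (Vs ** Vs\<^sup>H + Vp ** Vp\<^sup>H) $ i $ j"
      by (simp add: matrix_matrix_mult_def hcat_def UNIV_Plus_UNIV [symmetric] sum.Plus
          del: UNIV_Plus_UNIV)
    then show "(Vs ** Vs\<^sup>H + Vp ** Vp\<^sup>H) $ i $ j = idm $ i $ j"
      using decomp by (simp add: eigendecomposition_def)
  qed
qed

lemma Vs_stiefel: "Vs \<in> stiefel" by (simp add: stiefel_def unitary_hcat)

lemma eigen_Vs: "H Vs ** Vs = Vs ** rdiag lam"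
proof (rule matrix_eqI)
  fix i j
  have "(H Vs ** hcat Vs Vp) $ i $ Inl j = (hcat Vs Vp) $ i $ Inl j * complex_of_real (lam j)"
    using decomp by (simp add: eigendecomposition_def matrix_mult_rdiag_nth lam_def)
  then show "(H Vs ** Vs) $ i $ j = (Vs ** rdiag lam) $ i $ j"
    by (simp add: matrix_mult_rdiag_nth hcat_def) (simp add: matrix_matrix_mult_def)
qed

lemma eigen_Vp: "H Vs ** Vp = Vp ** rdiag mu"
proof (rule matrix_eqI)
  fix i j
  have "(H Vs ** hcat Vs Vp) $ i $ Inr j = (hcat Vs Vp) $ i $ Inr j * complex_of_real (mu j)"
    using decomp by (simp add: eigendecomposition_def matrix_mult_rdiag_nth mu_def)
  then show "(H Vs ** Vp) $ i $ j = (Vp ** rdiag mu) $ i $ j"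
    by (simp add: matrix_mult_rdiag_nth hcat_def) (simp add: matrix_matrix_mult_def)
qed

lemma eigen_Vs': "Vs\<^sup>H ** H Vs = rdiag lam ** Vs\<^sup>H"
  by (metis H_herm ctranspose_mult ctranspose_rdiag eigen_Vs)

lemma eigen_Vp': "Vp\<^sup>H ** H Vs = rdiag mu ** Vp\<^sup>H"
  by (metis H_herm ctranspose_mult ctranspose_rdiag eigen_Vp)

lemma gap_matrix_nth: "G $ i $ j = inverse (mu i - lam j)"
  by (simp add: gap_matrix_def mu_def lam_def)

text \<open>Both coefficients are diagonal, so the Sylvester operator multiplies each entry by
  \<open>mu i - lam j\<close>. This is at least \<open>gam\<close>, hence nonzero, and
  \<open>G\<close> holds the reciprocals.\<close>

lemma sylvester_iff:
  "rdiag mu ** X - X ** rdiag lam = R \<longleftrightarrow> X = hadamard G R"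
proof -
  have nz: "complex_of_real (mu i) - complex_of_real (lam j) \<noteq> 0" for i j
    using mu_lam [of i j] gam_pos by (simp flip: of_real_diff)
  have e: "(rdiag mu ** X - X ** rdiag lam) $ i $ j = complex_of_real (mu i - lam j) * X $ i $ j" for i j
    by (simp add: matrix_mult_rdiag_nth rdiag_matrix_mult_nth algebra_simps)
  have r: "(hadamard G R) $ i $ j = inverse (complex_of_real (mu i - lam j)) * R $ i $ j" for i j
    by (simp add: hadamard_def gap_matrix_nth)
  show ?thesis
  proof
    assume R: "rdiag mu ** X - X ** rdiag lam = R"
    show "X = hadamard G R"
    proof (rule matrix_eqI)
      fix i j
      have "R $ i $ j = complex_of_real (mu i - lam j) * X $ i $ j"
        using e [of i j] R by simp
      then show "X $ i $ j = hadamard G R $ i $ j"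
        using nz [of i j] by (simp add: r)
    qed
  next
    assume X: "X = hadamard G R"
    show "rdiag mu ** X - X ** rdiag lam = R"
    proof (rule matrix_eqI)
      fix i j
      show "(rdiag mu ** X - X ** rdiag lam) $ i $ j = R $ i $ j"
        unfolding e unfolding X r using nz [of i j] by simp
    qed
  qed
qed

lemma gap_matrix_le: "\<bar>G $ i $ j\<bar> \<le> 1 / gam"
  using mu_lam [of i j] gam_pos by (simp add: gap_matrix_nth divide_simps)

lemma norm_gap_hadamard_le: "norm (hadamard G A) \<le> norm A / gam"
  using norm_hadamard_le [of G "1 / gam" A] gap_matrix_le gam_pos by simp

end

section \<open>Graph coordinates around the solution\<close>

lemma matrix_inv_mult:
  assumes "invertible A"
  shows "A ** matrix_inv A = Finite_Cartesian_Product.mat 1"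
    "matrix_inv A ** A = Finite_Cartesian_Product.mat 1"
  using assms someI_ex [of "\<lambda>B. A ** B = Finite_Cartesian_Product.mat 1 \<and> B ** A = Finite_Cartesian_Product.mat 1"]
  unfolding invertible_def matrix_inv_def by auto

lemma matrix_add_rdistrib: "(B + C) ** A = B ** A + (C :: complex^'a^'b) ** A"
  by (rule matrix_eqI) (simp add: matrix_matrix_mult_def distrib_right sum.distrib)

lemma matrix_mult_right_cancel:
  assumes "invertible A" "X ** A = Y ** A"
  shows "X = Y"
proof -
  have "X ** (A ** matrix_inv A) = Y ** (A ** matrix_inv A)"
    by (simp add: matrix_mul_assoc assms(2))
  then show ?thesis by (simp add: matrix_inv_mult [OF assms(1)])
qed

lemma norm_matrix_mult3_le:
  fixes A :: "complex^'a^'b"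
  shows "norm (A ** B ** C) \<le> norm A * norm B * norm C"
  by (meson mult_right_mono norm_ge_zero norm_matrix_mult_le order_trans)

lemma norm_stiefel_sq: "V \<in> stiefel \<Longrightarrow> (norm V)\<^sup>2 = real CARD('k)" for V :: "complex^'k^'n"
proof -
  assume V: "V \<in> stiefel"
  have "(\<Sum>i\<in>UNIV. (cmod (V $ i $ j))\<^sup>2) = 1" for j
  proof -
    have "(V\<^sup>H ** V) $ j $ j = 1"
      using stiefel_D [OF V] by (simp add: Finite_Cartesian_Product.mat_def)
    then have "complex_of_real (\<Sum>i\<in>UNIV. (cmod (V $ i $ j))\<^sup>2) = 1"
      by (simp add: matrix_matrix_mult_def complex_norm_square mult.commute del: of_real_power)
    then show ?thesis using of_real_eq_1_iff by blast
  qed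
  then show ?thesis
    unfolding norm_matrix_sq by (subst sum.swap) simp
qed

lemma gram_diagonal: "Re ((C\<^sup>H ** C) $ j $ j) \<ge> 0"
  by (simp add: matrix_matrix_mult_def sum_nonneg)

lemma ctranspose_gram: "(C\<^sup>H ** C)\<^sup>H = C\<^sup>H ** C"
  by (simp add: ctranspose_mult)

lemma unitary_conjugate:
  fixes X :: "complex^'k^'k"
  assumes "X \<in> stiefel" "M ** X = X ** N"
  shows "X\<^sup>H ** M ** X = N"
proof -
  have "X\<^sup>H ** M ** X = (X\<^sup>H ** X) ** N"
    by (simp add: assms(2) flip: matrix_mul_assoc)
  then show ?thesis by (simp add: stiefel_D [OF assms(1)])
qed

text \<open>\<open>P\<close> is the inverse square root of \<open>idm + Z\<^sup>H ** Z\<close>,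
  built by diagonalization; it turns the basis \<open>Vs + Vp ** Z\<close> of a graph into an
  orthonormal one. That \<open>P\<close> deviates from \<open>idm\<close> only to second order makes
  normalization harmless in first-order estimates.\<close>

lemma inverse_square_root:
  fixes Z :: "complex^'k^'m"
  obtains P :: "complex^'k^'k" where "P\<^sup>H ** (idm + Z\<^sup>H ** Z) ** P = idm"
    "norm (P - idm) \<le> (real CARD('k))\<^sup>2 * (norm Z)\<^sup>2"
proof -
  obtain X :: "complex^'k^'k" and \<tau> where X: "X \<in> stiefel" "(Z\<^sup>H ** Z) ** X = X ** rdiag \<tau>"
    using hermitian_unitary_diagonalization [OF ctranspose_gram] by blast
  have \<tau>: "rdiag \<tau> = (Z ** X)\<^sup>H ** (Z ** X)"
    using unitary_conjugate [OF X] by (simp add: ctranspose_mult matrix_mul_assoc)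
  have \<tau>_nonneg: "0 \<le> \<tau> j" for j
    using gram_diagonal [of "Z ** X" j] unfolding \<tau> [symmetric] by (simp add: rdiag_def)
  define p where "p j = 1 / sqrt (1 + \<tau> j)" for j
  define P where "P = X ** rdiag p ** X\<^sup>H"
  have "X\<^sup>H ** (idm + Z\<^sup>H ** Z) ** X = idm + rdiag \<tau>"
    using unitary_conjugate [OF X] stiefel_D [OF X(1)]
    by (simp add: matrix_add_ldistrib matrix_add_rdistrib)
  also have "\<dots> = rdiag (\<lambda>j. 1 + \<tau> j)"
    by (simp flip: rdiag_add rdiag_one)
  finally have X1: "X\<^sup>H ** (idm + Z\<^sup>H ** Z) ** X = rdiag (\<lambda>j. 1 + \<tau> j)" .
  have "P\<^sup>H ** (idm + Z\<^sup>H ** Z) ** P =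
      X ** (rdiag p ** (X\<^sup>H ** (idm + Z\<^sup>H ** Z) ** X) ** rdiag p) ** X\<^sup>H"
    by (simp add: P_def ctranspose_mult matrix_mul_assoc)
  then have "P\<^sup>H ** (idm + Z\<^sup>H ** Z) ** P = X ** (rdiag p ** rdiag (\<lambda>j. 1 + \<tau> j) ** rdiag p) ** X\<^sup>H"
    by (simp only: X1)
  also have "rdiag p ** rdiag (\<lambda>j. 1 + \<tau> j) ** rdiag p = rdiag (\<lambda>_. 1)"
  proof -
    have "p j * (1 + \<tau> j) * p j = 1" for j
    proof -
      have "sqrt (1 + \<tau> j) * sqrt (1 + \<tau> j) = 1 + \<tau> j" "sqrt (1 + \<tau> j) \<noteq> 0"
        using \<tau>_nonneg [of j] by auto
      then show ?thesis by (simp add: p_def field_simps)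
    qed
    then show ?thesis by (simp add: rdiag_mult)
  qed
  finally have 1: "P\<^sup>H ** (idm + Z\<^sup>H ** Z) ** P = idm"
    by (simp add: rdiag_one stiefel_square [OF X(1)])
  have "norm (rdiag (\<lambda>j. p j - 1)) \<le> 1 * norm (rdiag \<tau>)"
  proof (rule norm_matrix_le_entrywise)
    \<comment> \<open>From the chain
      \<open>1 - \<tau> j \<le> 1 / (1 + \<tau> j) \<le> p j \<le> 1\<close>.\<close>
    have "\<bar>p j - 1\<bar> \<le> \<tau> j" for j
    proof -
      have "1 \<le> sqrt (1 + \<tau> j)" using \<tau>_nonneg [of j] by simp
      then have "p j \<le> 1" by (simp add: p_def)
      have "sqrt (1 + \<tau> j) \<le> sqrt ((1 + \<tau> j)\<^sup>2)"
        using \<tau>_nonneg [of j] by (intro real_sqrt_le_mono) (simp add: power2_eq_square algebra_simps)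
      then have "1 / (1 + \<tau> j) \<le> p j"
        using \<tau>_nonneg [of j] by (auto simp: p_def intro!: divide_left_mono)
      moreover have "1 - \<tau> j \<le> 1 / (1 + \<tau> j)"
        using \<tau>_nonneg [of j] by (subst pos_le_divide_eq) (auto simp: algebra_simps)
      ultimately have "1 - \<tau> j \<le> p j" by simp
      with \<open>p j \<le> 1\<close> show ?thesis by simp
    qed
    then show "cmod (rdiag (\<lambda>j. p j - 1) $ i $ j) \<le> 1 * cmod (rdiag \<tau> $ i $ j)" for i j
      using \<tau>_nonneg by (auto simp: rdiag_def simp del: of_real_diff)
  qed simp
  then have "norm (rdiag (\<lambda>j. p j - 1)) \<le> norm (rdiag \<tau>)" by simp
  also have "\<dots> \<le> norm (Z ** X) * norm (Z ** X)"
    unfolding \<tau> by (rule order_trans [OF norm_matrix_mult_le]) simp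
  also have "\<dots> \<le> (norm Z * norm X) * (norm Z * norm X)"
    by (intro mult_mono norm_matrix_mult_le) auto
  finally have "norm (rdiag (\<lambda>j. p j - 1)) \<le> (norm Z * norm X) * (norm Z * norm X)" .
  then have d: "norm (rdiag (\<lambda>j. p j - 1)) \<le> real CARD('k) * (norm Z)\<^sup>2"
  proof -
    have "(norm Z * norm X) * (norm Z * norm X) = (norm X)\<^sup>2 * (norm Z)\<^sup>2"
      by (simp add: power2_eq_square mult_ac)
    with \<open>norm _ \<le> (norm Z * norm X) * _\<close> show ?thesis by (simp add: norm_stiefel_sq [OF X(1)])
  qed
  \<comment> \<open>\<open>X\<close> has squared Frobenius norm \<open>CARD('k)\<close>. It enters
    once through \<open>Z ** X\<close> above and once through this conjugation, which accounts for
    the square in the bound.\<close>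
  have "P - idm = X ** rdiag (\<lambda>j. p j - 1) ** X\<^sup>H"
    by (simp add: P_def matrix_diff_ldistrib matrix_diff_rdistrib rdiag_one stiefel_square [OF X(1)]
        flip: rdiag_diff)
  then have "norm (P - idm) \<le> norm X * norm (rdiag (\<lambda>j. p j - 1)) * norm X"
    using norm_matrix_mult3_le [of X "rdiag (\<lambda>j. p j - 1)" "X\<^sup>H"] by simp
  also have "\<dots> = (norm X)\<^sup>2 * norm (rdiag (\<lambda>j. p j - 1))"
    by (simp add: power2_eq_square mult_ac)
  also have "\<dots> = real CARD('k) * norm (rdiag (\<lambda>j. p j - 1))"
    by (simp add: norm_stiefel_sq [OF X(1)])
  also have "\<dots> \<le> real CARD('k) * (real CARD('k) * (norm Z)\<^sup>2)"
    by (intro mult_left_mono d) auto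
  finally have "norm (P - idm) \<le> (real CARD('k))\<^sup>2 * (norm Z)\<^sup>2"
    by (simp add: power2_eq_square mult_ac)
  with 1 show thesis by (rule that)
qed

context nepv
begin

text \<open>\<open>Vs\<^sup>H ** V\<close> is the cosine block. For orthonormal \<open>V\<close> it
  is invertible exactly when no canonical angle is a right angle, by
  \<open>chartable_iff\<close>.\<close>

definition chartable :: "complex^'k^'n \<Rightarrow> bool" where
  "chartable V \<longleftrightarrow> invertible (Vs\<^sup>H ** V)"

text \<open>The range of \<open>V\<close> is that of \<open>Vs + Vp ** Zc V\<close>; only meaningful for chartable \<open>V\<close>.\<close>

definition Zc :: "complex^'k^'n \<Rightarrow> complex^'k^'m" where
  "Zc V = (Vp\<^sup>H ** V) ** matrix_inv (Vs\<^sup>H ** V)"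

lemma split_components: "V = Vs ** (Vs\<^sup>H ** V) + Vp ** (Vp\<^sup>H ** V)" for V :: "complex^'k^'n"
proof -
  have "(Vs ** Vs\<^sup>H + Vp ** Vp\<^sup>H) ** V = V" by (simp add: unitary_hcat)
  then show ?thesis by (simp add: matrix_add_rdistrib matrix_mul_assoc)
qed

lemma gram_components:
  assumes "V \<in> stiefel"
  shows "(Vs\<^sup>H ** V)\<^sup>H ** (Vs\<^sup>H ** V) + (Vp\<^sup>H ** V)\<^sup>H ** (Vp\<^sup>H ** V) = idm"
proof -
  have "V\<^sup>H ** (Vs ** Vs\<^sup>H + Vp ** Vp\<^sup>H) ** V = idm"
    by (simp add: unitary_hcat stiefel_D [OF assms])
  then show ?thesis
    by (simp add: ctranspose_mult matrix_add_ldistrib matrix_add_rdistrib matrix_mul_assoc)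
qed

lemma Zc_mult: "chartable V \<Longrightarrow> Zc V ** (Vs\<^sup>H ** V) = Vp\<^sup>H ** V"
  by (simp add: chartable_def Zc_def matrix_inv_mult flip: matrix_mul_assoc)

lemma Zc_unique: "chartable V \<Longrightarrow> Vp\<^sup>H ** V = Z ** (Vs\<^sup>H ** V) \<Longrightarrow> Zc V = Z"
  by (rule matrix_mult_right_cancel [of "Vs\<^sup>H ** V"]) (simp_all add: Zc_mult chartable_def)

lemma chart_split: "chartable V \<Longrightarrow> V = (Vs + Vp ** Zc V) ** (Vs\<^sup>H ** V)"
proof -
  assume "chartable V"
  have "(Vs + Vp ** Zc V) ** (Vs\<^sup>H ** V) = Vs ** (Vs\<^sup>H ** V) + Vp ** (Zc V ** (Vs\<^sup>H ** V))"
    by (simp add: matrix_add_rdistrib matrix_mul_assoc)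
  then show ?thesis
    by (simp only: Zc_mult [OF \<open>chartable V\<close>] split_components [symmetric])
qed

text \<open>The cosine block is the factor that orthonormalizes the graph basis, so it solves the
  same equation as \<open>P\<close> in \<open>inverse_square_root\<close>.\<close>

lemma chart_gram:
  assumes "V \<in> stiefel" "chartable V"
  shows "(Vs\<^sup>H ** V)\<^sup>H ** (idm + (Zc V)\<^sup>H ** Zc V) ** (Vs\<^sup>H ** V) = idm"
proof -
  define A where "A = Vs\<^sup>H ** V"
  have "A\<^sup>H ** (idm + (Zc V)\<^sup>H ** Zc V) ** A = A\<^sup>H ** A + (Zc V ** A)\<^sup>H ** (Zc V ** A)"
    by (simp add: matrix_add_ldistrib matrix_add_rdistrib ctranspose_mult matrix_mul_assoc)
  then show ?thesis
    using gram_components [OF assms(1)] Zc_mult [OF assms(2)] by (simp add: A_def)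
qed

text \<open>Supplies starting points with a prescribed coordinate, for the lower bounds on
  contraction factors and for divergence.\<close>

lemma chart_surj:
  fixes Z :: "complex^'k^'m"
  obtains V where "V \<in> stiefel" "chartable V" "Zc V = Z"
proof -
  obtain P :: "complex^'k^'k" where P: "P\<^sup>H ** (idm + Z\<^sup>H ** Z) ** P = idm"
    by (rule inverse_square_root)
  define V where "V = (Vs + Vp ** Z) ** P"
  have VP: "Vs\<^sup>H ** V = P" "Vp\<^sup>H ** V = Z ** P"
    by (simp_all add: V_def matrix_mul_assoc matrix_add_ldistrib matrix_add_rdistrib unitary_hcat)
  have "(Vs + Vp ** Z)\<^sup>H ** (Vs + Vp ** Z) = idm + Z\<^sup>H ** Z"
  proof -
    have "(Vs + Vp ** Z)\<^sup>H ** (Vs + Vp ** Z) =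
      Vs\<^sup>H ** Vs + (Vs\<^sup>H ** Vp) ** Z + Z\<^sup>H ** (Vp\<^sup>H ** Vs) + Z\<^sup>H ** (Vp\<^sup>H ** Vp) ** Z"
      by (simp add: matrix_add_ldistrib matrix_add_rdistrib ctranspose_add ctranspose_mult
          matrix_mul_assoc)
    then show ?thesis by (simp add: unitary_hcat)
  qed
  moreover have "V\<^sup>H ** V = P\<^sup>H ** ((Vs + Vp ** Z)\<^sup>H ** (Vs + Vp ** Z)) ** P"
    by (simp add: V_def ctranspose_mult matrix_mul_assoc)
  ultimately have "V\<^sup>H ** V = idm"
    using P by simp
  moreover have "chartable V"
    using P unfolding chartable_def VP(1) invertible_left_inverse by blast
  ultimately show thesis
    using that [of V] Zc_unique [of V Z] VP by (simp add: stiefel_def)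
qed

text \<open>The hypothesis on \<open>H\<close> is local at \<open>Vs\<close> itself, so a point of the Grassmannian near the range of
  \<open>Vs\<close> needs a representative near \<open>Vs\<close>; it comes from the polar decomposition.\<close>

lemma chart_representative:
  assumes V: "V \<in> stiefel" "chartable V"
  obtains Q where "Q \<in> stiefel"
    "norm (V ** Q - (Vs + Vp ** Zc V)) \<le> (norm Vs + norm Vp * norm (Zc V)) * ((real CARD('k))\<^sup>2 * (norm (Zc V))\<^sup>2)"
proof -
  define Z where "Z = Zc V"
  define A where "A = Vs\<^sup>H ** V"
  have A: "invertible A" using V(2) by (simp add: A_def chartable_def)
  obtain P :: "complex^'k^'k" where P: "P\<^sup>H ** (idm + Z\<^sup>H ** Z) ** P = idm"
    "norm (P - idm) \<le> (real CARD('k))\<^sup>2 * (norm Z)\<^sup>2"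
    by (rule inverse_square_root)
  \<comment> \<open>\<open>A\<close> and \<open>P\<close> normalize the same graph basis, so they
    differ by a unitary factor.\<close>
  define Q where "Q = matrix_inv A ** P"
  have AQ: "A ** Q = P" by (simp add: Q_def matrix_mul_assoc matrix_inv_mult [OF A])
  have "A\<^sup>H ** (idm + Z\<^sup>H ** Z) ** A = idm"
    using chart_gram [OF V] by (simp add: A_def Z_def)
  then have "Q\<^sup>H ** Q = Q\<^sup>H ** (A\<^sup>H ** (idm + Z\<^sup>H ** Z) ** A) ** Q"
    by simp
  also have "\<dots> = (A ** Q)\<^sup>H ** (idm + Z\<^sup>H ** Z) ** (A ** Q)"
    by (simp add: ctranspose_mult matrix_mul_assoc)
  finally have "Q \<in> stiefel" using P by (simp add: AQ stiefel_def)
  have "V ** Q = (Vs + Vp ** Z) ** P"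
  proof -
    have "V ** Q = (Vs + Vp ** Z) ** A ** Q"
      using chart_split [OF V(2)] by (simp add: A_def Z_def)
    then show ?thesis by (simp add: AQ flip: matrix_mul_assoc)
  qed
  then have "V ** Q - (Vs + Vp ** Z) = (Vs + Vp ** Z) ** (P - idm)"
    by (simp add: matrix_diff_ldistrib)
  then have "norm (V ** Q - (Vs + Vp ** Z)) \<le> norm (Vs + Vp ** Z) * norm (P - idm)"
    by (simp add: norm_matrix_mult_le)
  also have "\<dots> \<le> (norm Vs + norm Vp * norm Z) * ((real CARD('k))\<^sup>2 * (norm Z)\<^sup>2)"
    by (intro mult_mono P(2) order_trans [OF norm_triangle_ineq] add_left_mono norm_matrix_mult_le) auto
  finally show thesis using that \<open>Q \<in> stiefel\<close> by (simp add: Z_def)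
qed

subsection \<open>Canonical angles in graph coordinates\<close>

text \<open>In an eigenbasis \<open>X\<close> of the Gram matrix of the cosine block,
  \<open>s j\<close> is a squared cosine. It is at most 1 because \<open>1 - s j\<close> is a
  diagonal entry of the Gram matrix of the sine block. The angles are ordered and \<open>s\<close>
  is not, so only the multisets can be equated.\<close>

lemma singular_chart:
  assumes V: "V \<in> stiefel"
  shows "\<exists>(X :: complex^'k^'k) s. X \<in> stiefel \<and> (Vs\<^sup>H ** V)\<^sup>H ** (Vs\<^sup>H ** V) ** X = X ** rdiag s \<and>
    (\<forall>j. 0 \<le> s j \<and> s j \<le> 1) \<and>
    image_mset (angle V Vs) (mset_set UNIV) = image_mset (\<lambda>j. arccos (sqrt (s j))) (mset_set UNIV)"
proof -
  define A where "A = Vs\<^sup>H ** V"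
  define B where "B = Vp\<^sup>H ** V"
  obtain X :: "complex^'k^'k" and s where X: "X \<in> stiefel" "(A\<^sup>H ** A) ** X = X ** rdiag s"
    using hermitian_unitary_diagonalization [OF ctranspose_gram] by blast
  have s: "rdiag s = (A ** X)\<^sup>H ** (A ** X)"
    using unitary_conjugate [OF X] by (simp add: ctranspose_mult matrix_mul_assoc)
  have s0: "0 \<le> s j" for j
    using gram_diagonal [of "A ** X" j] unfolding s [symmetric] by (simp add: rdiag_def)
  have "rdiag (\<lambda>j. 1 - s j) = (B ** X)\<^sup>H ** (B ** X)"
  proof -
    have "B\<^sup>H ** B = idm - A\<^sup>H ** A"
      using gram_components [OF V] by (simp add: A_def B_def eq_diff_eq add.commute)
    then have "(B ** X)\<^sup>H ** (B ** X) = X\<^sup>H ** (idm - A\<^sup>H ** A) ** X"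
      by (simp add: ctranspose_mult matrix_mul_assoc flip: \<open>B\<^sup>H ** B = idm - A\<^sup>H ** A\<close>)
    also have "\<dots> = idm - X\<^sup>H ** (A\<^sup>H ** A) ** X"
      by (simp add: matrix_diff_ldistrib matrix_diff_rdistrib stiefel_D [OF X(1)])
    finally show ?thesis
      by (simp add: unitary_conjugate [OF X] flip: rdiag_diff rdiag_one)
  qed
  then have s1: "s j \<le> 1" for j
    using gram_diagonal [of "B ** X" j] by (simp add: rdiag_def flip: \<open>_ = (B ** X)\<^sup>H ** (B ** X)\<close>)
  have ms: "mset (singular_values A) = image_mset (\<lambda>j. sqrt (s j)) (mset_set UNIV)"
    by (simp add: singular_values_def eigvals_asc_unitary [OF X] image_mset.compositionality comp_def)
  then have len: "length (singular_values A) = CARD('k)"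
    by (metis size_image_mset size_mset size_mset_set)
  have ang: "image_mset (angle V Vs) (mset_set UNIV) = image_mset (\<lambda>j. arccos (sqrt (s j))) (mset_set UNIV)"
  proof -
    have "image_mset (angle V Vs) (mset_set UNIV) =
      image_mset arccos (image_mset (\<lambda>j::'k. singular_values A ! ix j) (mset_set UNIV))"
      by (simp add: angle_def [abs_def] A_def image_mset.compositionality comp_def)
    then show ?thesis
      by (simp add: mset_nth_ix len ms image_mset.compositionality comp_def)
  qed
  show ?thesis
    using X s0 s1 ang unfolding A_def by blast
qed

text \<open>Translates invertibility of the cosine block into the nonvanishing of every
  \<open>s j\<close>.\<close>

lemma det_gram_chart:
  fixes X :: "complex^'k^'k"
  assumes "(Vs\<^sup>H ** V)\<^sup>H ** (Vs\<^sup>H ** V) ** X = X ** rdiag s" "X \<in> stiefel"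
  shows "cnj (Determinants.det (Vs\<^sup>H ** V)) * Determinants.det (Vs\<^sup>H ** V) = (\<Prod>j\<in>UNIV. complex_of_real (s j))"
proof -
  have "Determinants.det (A\<^sup>H) = cnj (Determinants.det A)" for A :: "complex^'k^'k"
  proof -
    have "Determinants.det (A\<^sup>H) = Determinants.det (\<chi> i j. cnj (A $ i $ j))"
    proof -
      have "Finite_Cartesian_Product.transpose (A\<^sup>H) = (\<chi> i j. cnj (A $ i $ j))"
        by (rule matrix_eqI) (simp add: Finite_Cartesian_Product.transpose_def)
      then show ?thesis by (metis Determinants.det_transpose)
    qed
    then show ?thesis by (simp add: Determinants.det_def)
  qed
  then have "cnj (Determinants.det (Vs\<^sup>H ** V)) * Determinants.det (Vs\<^sup>H ** V) * Determinants.det X =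
      Determinants.det ((Vs\<^sup>H ** V)\<^sup>H ** (Vs\<^sup>H ** V) ** X)"
    by (simp add: Determinants.det_mul)
  also have "\<dots> = Determinants.det X * (\<Prod>j\<in>UNIV. complex_of_real (s j))"
    unfolding assms by (simp add: Determinants.det_mul det_rdiag)
  finally show ?thesis
    using stiefel_invertible [OF assms(2)] by (simp add: invertible_det_nz)
qed

lemma angle_nonneg: assumes "V \<in> stiefel" shows "0 \<le> angle V Vs j" "angle V Vs j \<le> pi / 2"
proof -
  obtain X :: "complex^'k^'k" and s where "X \<in> stiefel"
    "(Vs\<^sup>H ** V)\<^sup>H ** (Vs\<^sup>H ** V) ** X = X ** rdiag s"
    and s: "\<And>j. 0 \<le> s j" "\<And>j. s j \<le> 1"
    "image_mset (angle V Vs) (mset_set UNIV) = image_mset (\<lambda>j. arccos (sqrt (s j))) (mset_set UNIV)"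
    using singular_chart [OF assms] by auto
  have "range (angle V Vs) = range (\<lambda>j. arccos (sqrt (s j)))"
    using arg_cong [OF s(3), of set_mset] by simp
  obtain i where i: "angle V Vs j = arccos (sqrt (s i))"
    using \<open>range _ = _\<close> by blast
  have "0 \<le> sqrt (s i)" "- 1 \<le> sqrt (s i)" "sqrt (s i) \<le> 1"
    using s(1,2) [of i] by (auto intro: order_trans [of _ 0])
  then show "0 \<le> angle V Vs j" "angle V Vs j \<le> pi / 2"
    unfolding i by (simp_all only: arccos_lbound arccos_le_pi2)
qed

lemma chartable_iff:
  assumes "V \<in> stiefel"
  shows "chartable V \<longleftrightarrow> (\<forall>j. angle V Vs j < pi / 2)"
proof -
  obtain X :: "complex^'k^'k" and s where X: "X \<in> stiefel" "(Vs\<^sup>H ** V)\<^sup>H ** (Vs\<^sup>H ** V) ** X = X ** rdiag s"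
    and s: "\<And>j. 0 \<le> s j" "\<And>j. s j \<le> 1"
      "image_mset (angle V Vs) (mset_set UNIV) = image_mset (\<lambda>j. arccos (sqrt (s j))) (mset_set UNIV)"
    using singular_chart [OF assms] by auto
  have r: "range (angle V Vs) = range (\<lambda>j. arccos (sqrt (s j)))"
    using arg_cong [OF s(3), of set_mset] by simp
  have a: "arccos (sqrt (s j)) < pi / 2 \<longleftrightarrow> s j \<noteq> 0" for j
  proof -
    have "0 \<le> sqrt (s j)" "sqrt (s j) \<le> 1" using s by auto
    then have "arccos (sqrt (s j)) < arccos 0 \<longleftrightarrow> 0 < sqrt (s j)"
      by (intro arccos_less_mono) auto
    then show ?thesis using s(1) [of j] by (auto simp: less_le)
  qed
  then have "(\<forall>j. angle V Vs j < pi / 2) \<longleftrightarrow> (\<forall>j. s j \<noteq> 0)"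
  proof -
    have "(\<forall>j. angle V Vs j < pi / 2) \<longleftrightarrow> (\<forall>x\<in>range (angle V Vs). x < pi / 2)" by blast
    then show ?thesis unfolding r by (simp only: ball_simps a)
  qed
  also have "\<dots> \<longleftrightarrow> Determinants.det (Vs\<^sup>H ** V) \<noteq> 0"
  proof -
    have "Determinants.det (Vs\<^sup>H ** V) = 0 \<longleftrightarrow> (\<Prod>j\<in>UNIV. complex_of_real (s j)) = 0"
      unfolding det_gram_chart [OF X(2,1), symmetric] by simp
    then show ?thesis by simp
  qed
  finally show ?thesis by (simp add: chartable_def invertible_det_nz)
qed

text \<open>If \<open>X\<close> diagonalizes \<open>A\<^sup>H A\<close>, where \<open>A\<close> is the cosine block, then \<open>A X\<close> diagonalizes \<open>Z\<^sup>H Z\<close>,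
  with eigenvalues \<open>1 / cos\<^sup>2 - 1\<close>.\<close>

lemma singular_values_Zc:
  assumes V: "V \<in> stiefel" "chartable V"
  shows "singular_values (Zc V) = singular_values (tan_Theta V Vs)"
proof -
  define A where "A = Vs\<^sup>H ** V"
  define Z where "Z = Zc V"
  obtain X :: "complex^'k^'k" and s where X: "X \<in> stiefel" "A\<^sup>H ** A ** X = X ** rdiag s"
    and s: "\<And>j. 0 \<le> s j" "\<And>j. s j \<le> 1"
    and ang: "image_mset (angle V Vs) (mset_set UNIV) = image_mset (\<lambda>j. arccos (sqrt (s j))) (mset_set UNIV)"
    unfolding A_def using singular_chart [OF V(1)] by auto
  have ms: "image_mset (\<lambda>j. g (angle V Vs j)) (mset_set UNIV) =
       image_mset (\<lambda>j. g (arccos (sqrt (s j)))) (mset_set UNIV)" for g :: "real \<Rightarrow> complex"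
    using arg_cong [OF ang, of "image_mset g"] by (simp add: image_mset.compositionality comp_def)
  have detA: "cnj (Determinants.det A) * Determinants.det A = (\<Prod>j\<in>UNIV. complex_of_real (s j))"
    using det_gram_chart X unfolding A_def by blast
  moreover have "Determinants.det A \<noteq> 0"
    using V(2) by (simp add: chartable_def A_def invertible_det_nz)
  ultimately have P0: "(\<Prod>j\<in>UNIV. complex_of_real (s j)) \<noteq> 0"
    by (metis complex_cnj_zero_iff mult_eq_0_iff)
  then have s_pos: "0 < s j" for j
    using s(1) [of j] by (auto simp: less_le)
  have "(tan (arccos (sqrt (s j))))\<^sup>2 = 1 / s j - 1" for j
  proof -
    have "cos (arccos (sqrt (s j))) = sqrt (s j)" "sin (arccos (sqrt (s j))) = sqrt (1 - s j)"
      using cos_arccos_abs [of "sqrt (s j)"] sin_arccos_abs [of "sqrt (s j)"] s [of j] by simp_all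
    then show ?thesis
      using s [of j] s_pos [of j] by (simp add: tan_def power_divide diff_divide_distrib)
  qed
  \<comment> \<open>Equality of the root multisets is enough, since \<open>singular_values\<close>
    sees a matrix only through the characteristic polynomial of its Gram matrix.\<close>
  then have tans: "proots (charpoly ((tan_Theta V Vs)\<^sup>H ** tan_Theta V Vs)) =
      proots (charpoly (rdiag (\<lambda>j. 1 / s j - 1)))"
    unfolding tan_Theta_def ctranspose_rdiag rdiag_mult charpoly_rdiag proots_prod_linear
    using ms [of "\<lambda>x. complex_of_real ((tan x)\<^sup>2)"] by (simp add: power2_eq_square)
  have A: "invertible A" "invertible (A\<^sup>H)"
  proof -
    show "invertible A" using V(2) by (simp add: chartable_def A_def)
    then have "A ** matrix_inv A = idm" by (rule matrix_inv_mult)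
    then have "(matrix_inv A)\<^sup>H ** A\<^sup>H = idm" by (simp flip: ctranspose_mult)
    then show "invertible (A\<^sup>H)" unfolding invertible_left_inverse by blast
  qed
  have "A\<^sup>H ** (idm + Z\<^sup>H ** Z) ** A = idm"
    using chart_gram [OF V] by (simp add: A_def Z_def)
  then have "A\<^sup>H ** (Z\<^sup>H ** Z ** A) = idm - A\<^sup>H ** A"
    by (simp add: matrix_add_ldistrib matrix_add_rdistrib eq_diff_eq add.commute matrix_mul_assoc)
  then have "A\<^sup>H ** (Z\<^sup>H ** Z ** A ** X) = (idm - A\<^sup>H ** A) ** X"
    by (simp add: matrix_mul_assoc)
  also have "\<dots> = X ** (idm - rdiag s)"
    by (simp add: matrix_diff_ldistrib matrix_diff_rdistrib X(2))
  also have "idm - rdiag s = rdiag s ** rdiag (\<lambda>j. 1 / s j - 1)"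
  proof -
    have "s j * (1 / s j - 1) = 1 - s j" for j using s_pos [of j] by (simp add: right_diff_distrib)
    then show ?thesis unfolding rdiag_mult rdiag_one [symmetric] rdiag_diff by (simp only:)
  qed
  also have "X ** \<dots> = A\<^sup>H ** (A ** X ** rdiag (\<lambda>j. 1 / s j - 1))"
    by (simp add: matrix_mul_assoc X(2))
  finally have "matrix_inv (A\<^sup>H) ** A\<^sup>H ** (Z\<^sup>H ** Z ** A ** X) =
      matrix_inv (A\<^sup>H) ** A\<^sup>H ** (A ** X ** rdiag (\<lambda>j. 1 / s j - 1))"
    by (simp flip: matrix_mul_assoc)
  then have "Z\<^sup>H ** Z ** (A ** X) = A ** X ** rdiag (\<lambda>j. 1 / s j - 1)"
    by (simp add: matrix_inv_mult [OF A(2)] matrix_mul_assoc)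
  then have "charpoly (Z\<^sup>H ** Z) = charpoly (rdiag (\<lambda>j. 1 / s j - 1))"
    by (rule charpoly_similar) (intro invertible_mult A stiefel_invertible X)
  then show ?thesis
    unfolding singular_values_def eigvals_asc_def tans Z_def [symmetric] by simp
qed

end

section \<open>One step of the iteration\<close>

locale real_norm =
  fixes N :: "'a::euclidean_space \<Rightarrow> real"
  assumes N_zero: "\<And>x. N x = 0 \<longleftrightarrow> x = 0" and N_tri: "\<And>x y. N (x + y) \<le> N x + N y"
    and N_hom: "\<And>c x. N (c *\<^sub>R x) = \<bar>c\<bar> * N x"
begin

lemma N_minus: "N (- x) = N x" using N_hom [of "-1" x] by simp

lemma N_nonneg: "0 \<le> N x"
  using N_tri [of x "- x"] N_zero [of 0] N_minus [of x] by simp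

lemma N_pos: "x \<noteq> 0 \<Longrightarrow> 0 < N x"
  using N_nonneg [of x] N_zero [of x] by (auto simp: less_le)

lemma N_diff: "\<bar>N x - N y\<bar> \<le> N (x - y)"
  using N_tri [of "x - y" y] N_tri [of "y - x" x] N_minus [of "x - y"] by simp

text \<open>With \<open>hi\<close>, the best constants in the equivalence with the Euclidean
  norm.\<close>

definition lo where "lo = Inf (N ` sphere 0 1)"
definition hi where "hi = Sup (N ` sphere 0 1)"

text \<open>A norm is convex and hence continuous in finite dimension. The extreme values on the
  sphere are therefore attained, which makes \<open>lo\<close> positive.\<close>

lemma compact_N_sphere: "compact (N ` sphere 0 1)"
proof -
  have "convex_on UNIV N"
  proof (rule convex_onI)
    show "N ((1 - t) *\<^sub>R x + t *\<^sub>R y) \<le> (1 - t) * N x + t * N y" if "0 < t" "t < 1" for t x y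
      using N_tri [of "(1 - t) *\<^sub>R x" "t *\<^sub>R y"] that by (simp add: N_hom)
  qed simp
  then have "continuous_on UNIV N" by (rule convex_on_continuous [OF open_UNIV])
  then show ?thesis
    by (intro compact_continuous_image) (auto intro: continuous_on_subset)
qed

lemma N_sphere: "x \<noteq> 0 \<Longrightarrow> N x / norm x \<in> N ` sphere 0 1"
  by (rule image_eqI [of _ _ "(1 / norm x) *\<^sub>R x"]) (simp_all add: N_hom)

lemma lo: "0 < lo" "lo * norm x \<le> N x" and hi: "0 < hi" "N x \<le> hi * norm x"
proof -
  have bdd: "bdd_below (N ` sphere 0 1)" "bdd_above (N ` sphere 0 1)"
    using compact_N_sphere by (auto intro: bounded_imp_bdd_below bounded_imp_bdd_above compact_imp_bounded)
  have ne: "N ` sphere 0 1 \<noteq> {}" by simp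
  have "lo \<in> N ` sphere 0 1" "hi \<in> N ` sphere 0 1"
    unfolding lo_def hi_def using bdd ne compact_N_sphere
    by (auto intro!: closed_contains_Inf closed_contains_Sup compact_imp_closed)
  then show "0 < lo" "0 < hi" by (auto intro!: N_pos)
  show "lo * norm x \<le> N x" "N x \<le> hi * norm x"
  proof (atomize(full), cases "x = 0")
    case False
    then have "lo \<le> N x / norm x" "N x / norm x \<le> hi"
      unfolding lo_def hi_def by (auto intro: cInf_lower cSup_upper bdd N_sphere)
    then show "lo * norm x \<le> N x \<and> N x \<le> hi * norm x"
      using False by (simp add: field_simps)
  qed (use N_zero [of 0] in simp)
qed

text \<open>A Euclidean inequality survives the change of norm up to the condition number
  \<open>hi / lo\<close>.\<close>

lemma N_le:
  assumes "norm x \<le> c * norm y" "0 \<le> c"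
  shows "N x \<le> hi / lo * c * N y"
proof -
  have "N x \<le> hi * (c * norm y)"
    using hi(2) [of x] mult_left_mono [OF assms(1), of hi] hi(1) by linarith
  also have "\<dots> = hi / lo * c * (lo * norm y)" using lo(1) by simp
  also have "\<dots> \<le> hi / lo * c * N y"
    using lo hi(1) assms(2) by (intro mult_left_mono) auto
  finally show ?thesis .
qed

lemma N_perturb: "norm (x - y) \<le> e * norm y \<Longrightarrow> 0 \<le> e \<Longrightarrow> \<bar>N x - N y\<bar> \<le> hi / lo * e * N y"
  using N_diff [of x y] N_le [of "x - y" e y] by linarith

end

lemma ui_norm_real_norm:
  assumes "ui_norm N"
  shows "real_norm N"
proof
  show "N x = 0 \<longleftrightarrow> x = 0" "N (x + y) \<le> N x + N y" for x y
    using assms by (auto simp: ui_norm_def)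
  have "N (\<chi> i j. complex_of_real c * x $ i $ j) = \<bar>c\<bar> * N x" for c x
    using assms unfolding ui_norm_def by (simp del: of_real_mult)
  moreover have "(\<chi> i j. complex_of_real c * x $ i $ j) = c *\<^sub>R x" for c and x :: "complex^'a^'b"
    by (rule matrix_eqI) (simp add: scaleR_conv_of_real [where 'a = complex])
  ultimately show "N (c *\<^sub>R x) = \<bar>c\<bar> * N x" for c x by simp
qed

section \<open>Angles against tangents\<close>

lemma le_tan:
  assumes "0 \<le> x" "x < pi / 2"
  shows "x \<le> tan x"
proof -
  have "(\<lambda>t. tan t - t) 0 \<le> (\<lambda>t. tan t - t) x"
  proof (rule DERIV_nonneg_imp_nondecreasing [OF assms(1)])
    fix t assume "0 \<le> t" "t \<le> x"
    then have c: "0 < cos t" using assms by (intro cos_gt_zero_pi) auto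
    then have "((\<lambda>t. tan t - t) has_real_derivative inverse ((cos t)\<^sup>2) - 1) (at t)"
      by (auto intro!: derivative_eq_intros DERIV_tan)
    moreover have "1 \<le> inverse ((cos t)\<^sup>2)"
      using c by (intro one_le_inverse) (auto intro: power_le_one)
    ultimately show "\<exists>y. ((\<lambda>t. tan t - t) has_real_derivative y) (at t) \<and> 0 \<le> y"
      by (intro exI [of _ "inverse ((cos t)\<^sup>2) - 1"]) simp
  qed
  then show ?thesis by simp
qed

text \<open>The error is relative, as a limit of ratios demands; it comes from the derivative 1 of
  \<open>tan\<close> at 0.\<close>

lemma tan_near_zero:
  assumes "0 < (e::real)"
  obtains d where "0 < d" "d < pi / 2" "\<And>x. 0 \<le> x \<Longrightarrow> x \<le> d \<Longrightarrow> \<bar>x - tan x\<bar> \<le> e * tan x"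
proof -
  define e' where "e' = min e (1 / 2)"
  have e': "0 < e'" "e' \<le> e" "e' < 1" using assms by (auto simp: e'_def)
  have "((\<lambda>x::real. tan x / x) \<longlongrightarrow> 1) (at_right 0)"
  proof -
    have "(tan has_real_derivative inverse ((cos 0)\<^sup>2)) (at 0)" by (rule DERIV_tan) simp
    then have "((\<lambda>x::real. tan x / x) \<longlongrightarrow> 1) (at 0)"
      by (simp add: DERIV_def)
    then show ?thesis by (rule filterlim_at_split [THEN iffD1, THEN conjunct2])
  qed
  then have "eventually (\<lambda>x::real. \<bar>tan x / x - 1\<bar> < e') (at_right 0)"
    using e' by (simp add: tendsto_iff dist_real_def)
  then obtain b where b: "0 < b" "\<And>x. 0 < x \<Longrightarrow> x < b \<Longrightarrow> \<bar>tan x / x - 1\<bar> < e'"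
    unfolding eventually_at_right_field by auto
  define d where "d = min (b / 2) 1"
  have "1 < pi / 2" using pi_gt3 by simp
  show thesis
  proof
    show "0 < d" "d < pi / 2" using b \<open>1 < pi / 2\<close> by (auto simp: d_def)
    fix x :: real assume x: "0 \<le> x" "x \<le> d"
    show "\<bar>x - tan x\<bar> \<le> e * tan x"
    proof (cases "x = 0")
      case False
      then have "0 < x" "x < b" "x < pi / 2" using x b \<open>1 < pi / 2\<close> by (auto simp: d_def)
      have "\<bar>tan x / x - 1\<bar> * x \<le> e' * x"
        using b(2) [OF \<open>0 < x\<close> \<open>x < b\<close>] \<open>0 < x\<close> by (intro mult_right_mono) auto
      moreover have "\<bar>tan x / x - 1\<bar> * x = \<bar>(tan x / x - 1) * x\<bar>"
        using \<open>0 < x\<close> by (simp add: abs_mult)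
      moreover have "(tan x / x - 1) * x = tan x - x"
        using \<open>0 < x\<close> by (simp add: left_diff_distrib)
      moreover have "x \<le> tan x"
        using \<open>0 < x\<close> \<open>x < pi / 2\<close> by (intro le_tan) auto
      then have "e' * x \<le> e * tan x"
        using e' \<open>0 < x\<close> by (intro mult_mono) auto
      ultimately show ?thesis by (simp add: abs_minus_commute)
    qed simp
  qed
qed

section \<open>Estimates for a single step\<close>

context nepv
begin

abbreviation S :: "complex^'k^'n \<Rightarrow> complex^'k^'m" where
  "S \<equiv> scf_S H Vs Vp"

lemma norm_stiefel_eq: "W \<in> stiefel \<Longrightarrow> norm W = norm Vs" for W :: "complex^'k^'n"
  by (rule power2_eq_imp_eq) (simp_all add: norm_stiefel_sq Vs_stiefel)

lemma S_le: "norm (S V) \<le> norm Vp * norm Vs / gam * norm (H V - H Vs)"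
proof -
  have "norm (S V) \<le> norm (Vp\<^sup>H ** (H Vs - H V) ** Vs) / gam"
    unfolding scf_S_def by (rule norm_gap_hadamard_le)
  also have "\<dots> \<le> (norm Vp * norm (H V - H Vs) * norm Vs) / gam"
    using norm_matrix_mult3_le [of "Vp\<^sup>H" "H Vs - H V" Vs] gam_pos
    by (intro divide_right_mono) (auto simp: norm_minus_commute)
  finally show ?thesis by (simp add: field_simps)
qed

text \<open>A sine-theta bound in the manner of Davis and Kahan. The sine block solves a Sylvester
  equation with coefficients \<open>mu\<close> and the new eigenvalues \<open>l\<close>, and
  eigenvalue perturbation keeps these two families apart.\<close>

lemma scf_step_complement:
  assumes step: "scf_step H V W" and small: "norm (H V - H Vs) \<le> gam / 2"
  shows "norm (Vp\<^sup>H ** W) \<le> 2 / gam * norm Vp * norm Vs * norm (H V - H Vs)"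
proof -
  define E where "E = H V - H Vs"
  obtain l where W: "W \<in> stiefel" "H V ** W = W ** rdiag l"
    and l: "image_mset l (mset_set UNIV) = mset (take CARD('k) (eigvals_asc (H V)))"
    using step unfolding scf_step_def by blast
  have le: "l j \<le> eigval CARD('k) (H Vs) + norm E" for j
    using scf_step_eigenvalue_le [OF H_herm card_le l, of j]
      eigval_perturbation [OF H_herm [of V] card_le Vs_stiefel eigen_Vs lam_le] by (simp add: E_def)
  have eq: "rdiag mu ** (Vp\<^sup>H ** W) - (Vp\<^sup>H ** W) ** rdiag l = - (Vp\<^sup>H ** E ** W)"
  proof -
    have "(Vp\<^sup>H ** W) ** rdiag l = Vp\<^sup>H ** (H V ** W)"
      by (simp add: W(2) matrix_mul_assoc)
    moreover have "rdiag mu ** (Vp\<^sup>H ** W) = Vp\<^sup>H ** (H Vs ** W)"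
      by (simp add: eigen_Vp' [symmetric] matrix_mul_assoc)
    ultimately show ?thesis
      by (simp add: E_def matrix_diff_ldistrib matrix_diff_rdistrib matrix_mul_assoc)
  qed
  have "norm (Vp\<^sup>H ** W) \<le> 2 / gam * norm (Vp\<^sup>H ** E ** W)"
  proof (rule norm_matrix_le_entrywise)
    fix i j
    \<comment> \<open>The new eigenvalues exceed the old level by at most \<open>norm E\<close>,
      which uses up no more than half of the gap.\<close>
    have g: "gam / 2 \<le> mu i - l j"
      using mu_ge [of i] le [of j] small by (simp add: E_def)
    have "(rdiag mu ** (Vp\<^sup>H ** W) - (Vp\<^sup>H ** W) ** rdiag l) $ i $ j =
      complex_of_real (mu i - l j) * (Vp\<^sup>H ** W) $ i $ j"
      by (simp add: matrix_mult_rdiag_nth rdiag_matrix_mult_nth algebra_simps)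
    then have "complex_of_real (mu i - l j) * (Vp\<^sup>H ** W) $ i $ j = - ((Vp\<^sup>H ** E ** W) $ i $ j)"
      unfolding eq by simp
    then have "cmod (complex_of_real (mu i - l j) * (Vp\<^sup>H ** W) $ i $ j) = cmod ((Vp\<^sup>H ** E ** W) $ i $ j)"
      by (simp only: norm_minus_cancel)
    then have "(mu i - l j) * cmod ((Vp\<^sup>H ** W) $ i $ j) = cmod ((Vp\<^sup>H ** E ** W) $ i $ j)"
      using g gam_pos by (simp only: norm_mult norm_of_real)
    moreover have "gam / 2 * cmod ((Vp\<^sup>H ** W) $ i $ j) \<le> (mu i - l j) * cmod ((Vp\<^sup>H ** W) $ i $ j)"
      by (intro mult_right_mono g) simp
    ultimately have "gam / 2 * cmod ((Vp\<^sup>H ** W) $ i $ j) \<le> cmod ((Vp\<^sup>H ** E ** W) $ i $ j)"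
      by simp
    then show "cmod ((Vp\<^sup>H ** W) $ i $ j) \<le> 2 / gam * cmod ((Vp\<^sup>H ** E ** W) $ i $ j)"
      using gam_pos by (simp add: field_simps)
  qed (use gam_pos in auto)
  also have "\<dots> \<le> 2 / gam * (norm Vp * norm E * norm Vs)"
    using norm_matrix_mult3_le [of "Vp\<^sup>H" E W] gam_pos
    by (intro mult_left_mono) (auto simp: norm_stiefel_eq [OF W(1)])
  finally show ?thesis by (simp add: E_def mult_ac)
qed

text \<open>The Gram matrices of the cosine and sine blocks add up to \<open>idm\<close>. A vector
  killed by the cosine block would be reproduced by \<open>B\<^sup>H ** B\<close>, which shrinks
  every vector to at most a quarter of its length.\<close>

lemma chartable_of_small_complement:
  assumes W: "W \<in> stiefel" and B: "norm (Vp\<^sup>H ** W) \<le> 1 / 2"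
  shows "chartable W" "norm (Zc W) \<le> 2 * (norm Vs)\<^sup>2 * norm (Vp\<^sup>H ** W)"
proof -
  define A where "A = Vs\<^sup>H ** W"
  define B where "B = Vp\<^sup>H ** W"
  have gram: "A\<^sup>H ** A + B\<^sup>H ** B = idm"
    using gram_components [OF W] by (simp add: A_def B_def)
  have "x = 0" if "A *v x = 0" for x
  proof -
    have "x = (A\<^sup>H ** A + B\<^sup>H ** B) *v x" by (simp add: gram)
    also have "\<dots> = B\<^sup>H *v (B *v x)"
      by (simp add: matrix_vector_mult_add_rdistrib that flip: matrix_vector_mul_assoc)
    finally have "norm x = norm (B\<^sup>H *v (B *v x))" by (rule arg_cong)
    also have "\<dots> \<le> norm B * norm (B *v x)"
      using norm_matrix_vector_le [of "B\<^sup>H" "B *v x"] by simp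
    also have "\<dots> \<le> norm B * (norm B * norm x)"
      by (intro mult_left_mono norm_matrix_vector_le) auto
    also have "\<dots> \<le> (1/2) * ((1/2) * norm x)"
      using assms(2) by (intro mult_mono) (auto simp: B_def)
    finally show ?thesis by simp
  qed
  then have inv: "invertible A"
    unfolding invertible_left_inverse matrix_left_invertible_ker by blast
  then show c: "chartable W" by (simp add: chartable_def A_def)
  define J where "J = matrix_inv A"
  have AJ: "A ** J = idm" using matrix_inv_mult(1) [OF inv] by (simp add: J_def)
  \<comment> \<open>Expressing the inverse through itself gives
    \<open>norm J \<le> norm A + norm J / 4\<close>, and the last term is absorbed on the
    left.\<close>
  have "J = (A\<^sup>H ** A + B\<^sup>H ** B) ** J" by (simp add: gram)
  also have "\<dots> = A\<^sup>H + B\<^sup>H ** B ** J"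
    by (simp add: matrix_add_rdistrib) (simp add: AJ flip: matrix_mul_assoc)
  finally have "norm J = norm (A\<^sup>H + B\<^sup>H ** B ** J)" by (rule arg_cong)
  also have "\<dots> \<le> norm (A\<^sup>H) + norm (B\<^sup>H ** B ** J)" by (rule norm_triangle_ineq)
  also have "\<dots> \<le> norm A + norm B * norm B * norm J"
    using norm_matrix_mult3_le [of "B\<^sup>H" B J] by simp
  finally have "norm J \<le> norm A + norm B * norm B * norm J" .
  moreover have "norm B * norm B * norm J \<le> (1/2) * (1/2) * norm J"
    using assms(2) by (intro mult_right_mono mult_mono) (auto simp: B_def)
  ultimately have J: "norm J \<le> 2 * norm A" using norm_ge_zero [of A] by linarith
  have A: "norm A \<le> (norm Vs)\<^sup>2"
    using norm_matrix_mult_le [of "Vs\<^sup>H" W] by (simp add: A_def norm_stiefel_eq [OF W] power2_eq_square)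
  have "norm (Zc W) \<le> norm B * norm J"
    unfolding Zc_def B_def J_def A_def by (rule norm_matrix_mult_le)
  also have "\<dots> \<le> norm B * (2 * (norm Vs)\<^sup>2)"
    using J A by (intro mult_left_mono) auto
  finally show "norm (Zc W) \<le> 2 * (norm Vs)\<^sup>2 * norm (Vp\<^sup>H ** W)"
    by (simp add: B_def mult_ac)
qed

text \<open>Both block rows contain the unknown \<open>rdiag l\<close>. As \<open>Zc W\<close> maps
  the cosine block to the sine block, subtracting \<open>Zc W\<close> times the cosine row from the
  sine row cancels it. Each term that remains beside \<open>S V\<close> contains both
  \<open>E\<close> and \<open>Zc W\<close>.\<close>

lemma scf_step_equation:
  fixes V W
  defines "E \<equiv> H V - H Vs"
  assumes step: "scf_step H V W" and c: "chartable W"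
  shows "Zc W - S V = hadamard G (Zc W ** (Vs\<^sup>H ** E ** (Vs + Vp ** Zc W)) - Vp\<^sup>H ** E ** (Vp ** Zc W))"
proof -
  define Z where "Z = Zc W"
  define A where "A = Vs\<^sup>H ** W"
  define B where "B = Vp\<^sup>H ** W"
  obtain l where W: "W \<in> stiefel" "H V ** W = W ** rdiag l"
    using step unfolding scf_step_def by blast
  have HV: "H V = H Vs + E" by (simp add: E_def)
  have B: "Z ** A = B" using Zc_mult [OF c] by (simp add: Z_def A_def B_def)
  have Weq: "W = (Vs + Vp ** Z) ** A" using chart_split [OF c] by (simp add: Z_def A_def)
  have 1: "rdiag mu ** B = B ** rdiag l - Vp\<^sup>H ** E ** W"
  proof -
    have "B ** rdiag l = Vp\<^sup>H ** (H V ** W)" by (simp add: W(2) B_def matrix_mul_assoc)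
    also have "\<dots> = Vp\<^sup>H ** H Vs ** W + Vp\<^sup>H ** E ** W"
      by (simp add: HV matrix_add_ldistrib matrix_add_rdistrib matrix_mul_assoc)
    also have "Vp\<^sup>H ** H Vs ** W = rdiag mu ** B" by (simp add: eigen_Vp' B_def matrix_mul_assoc)
    finally show ?thesis by simp
  qed
  have 2: "rdiag lam ** A = A ** rdiag l - Vs\<^sup>H ** E ** W"
  proof -
    have "A ** rdiag l = Vs\<^sup>H ** (H V ** W)" by (simp add: W(2) A_def matrix_mul_assoc)
    also have "\<dots> = Vs\<^sup>H ** H Vs ** W + Vs\<^sup>H ** E ** W"
      by (simp add: HV matrix_add_ldistrib matrix_add_rdistrib matrix_mul_assoc)
    also have "Vs\<^sup>H ** H Vs ** W = rdiag lam ** A" by (simp add: eigen_Vs' A_def matrix_mul_assoc)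
    finally show ?thesis by simp
  qed
  define R where "R = Z ** (Vs\<^sup>H ** E ** (Vs + Vp ** Z)) - Vp\<^sup>H ** E ** (Vp ** Z)"
  have "(rdiag mu ** Z - Z ** rdiag lam) ** A = rdiag mu ** B - Z ** (rdiag lam ** A)"
    by (simp add: matrix_diff_rdistrib B flip: matrix_mul_assoc)
  also have "\<dots> = (B ** rdiag l - Vp\<^sup>H ** E ** W) - Z ** (A ** rdiag l - Vs\<^sup>H ** E ** W)"
    by (simp only: 1 2)
  also have "\<dots> = Z ** (Vs\<^sup>H ** E ** W) - Vp\<^sup>H ** E ** W"
    by (simp add: matrix_diff_ldistrib matrix_mul_assoc B)
  also have "\<dots> = (Z ** (Vs\<^sup>H ** E ** (Vs + Vp ** Z)) - Vp\<^sup>H ** E ** (Vs + Vp ** Z)) ** A"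
    by (subst (1 2) Weq) (simp add: matrix_diff_rdistrib matrix_mul_assoc)
  finally have m: "(rdiag mu ** Z - Z ** rdiag lam) ** A =
    (Z ** (Vs\<^sup>H ** E ** (Vs + Vp ** Z)) - Vp\<^sup>H ** E ** (Vs + Vp ** Z)) ** A" .
  have "invertible A" using c by (simp add: chartable_def A_def)
  then have "rdiag mu ** Z - Z ** rdiag lam = Z ** (Vs\<^sup>H ** E ** (Vs + Vp ** Z)) - Vp\<^sup>H ** E ** (Vs + Vp ** Z)"
    using m by (rule matrix_mult_right_cancel)
  also have "\<dots> = R + - (Vp\<^sup>H ** E ** Vs)"
    by (simp add: R_def matrix_add_ldistrib)
  finally have "Z = hadamard G (R + - (Vp\<^sup>H ** E ** Vs))"
    by (simp only: sylvester_iff)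
  moreover have "S V = hadamard G (- (Vp\<^sup>H ** E ** Vs))"
    by (simp add: scf_S_def E_def matrix_diff_ldistrib matrix_diff_rdistrib)
  ultimately have "Z - S V = hadamard G (R + - (Vp\<^sup>H ** E ** Vs)) - hadamard G (- (Vp\<^sup>H ** E ** Vs))"
    by (simp only:)
  then have "Z - S V = hadamard G R"
    by (simp only: hadamard_add add_diff_cancel_right')
  then show ?thesis by (simp add: Z_def R_def)
qed

text \<open>The sine-theta bound first yields a coordinate of size at most 1, and only then can the
  exact equation be used. The product in the last bound makes the error relative to the new
  coordinate.\<close>

lemma scf_step_estimate:
  obtains e C where "0 < e" "0 < C"
    "\<And>V W. scf_step H V W \<Longrightarrow> norm (H V - H Vs) \<le> e \<Longrightarrow> chartable W \<and>
       norm (Zc W) \<le> C * norm (H V - H Vs) \<and>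
       norm (Zc W - S V) \<le> C * norm (H V - H Vs) * norm (Zc W)"
proof -
  \<comment> \<open>\<open>a\<close> bounds the sine block, \<open>b\<close> the coordinate and
    \<open>c\<close> the error of the equation, each per unit of \<open>norm E\<close>; the added
    ones ensure positivity. In \<open>e\<close> the three clauses preserve half of the gap, keep the
    sine block below 1/2 and keep the coordinate below 1.\<close>
  define a where "a = 2 / gam * norm Vp * norm Vs + 1"
  define b where "b = a * (2 * (norm Vs)\<^sup>2 + 1)"
  define c where "c = (norm Vs * (norm Vs + norm Vp) + norm Vp * norm Vp) / gam"
  have a: "0 < a" unfolding a_def using gam_pos by (intro add_nonneg_pos) auto
  then have b: "0 < b" unfolding b_def by (intro mult_pos_pos add_nonneg_pos) auto
  have c: "0 \<le> c" unfolding c_def using gam_pos by auto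
  define e where "e = min (gam / 2) (min (1 / (2 * a)) (1 / b))"
  have "0 < e" using a b gam_pos by (simp add: e_def)
  moreover have "0 < b + c" using b c by simp
  moreover have "chartable W \<and> norm (Zc W) \<le> (b + c) * norm (H V - H Vs) \<and>
       norm (Zc W - S V) \<le> (b + c) * norm (H V - H Vs) * norm (Zc W)"
    if step: "scf_step H V W" and small: "norm (H V - H Vs) \<le> e" for V W
  proof -
    define E where "E = H V - H Vs"
    have E: "norm E \<le> gam / 2" "norm E * a \<le> 1 / 2" "norm E * b \<le> 1"
      using small a b by (auto simp: E_def e_def field_simps)
    have W: "W \<in> stiefel" using step by (simp add: scf_step_def)
    have "norm (Vp\<^sup>H ** W) \<le> 2 / gam * norm Vp * norm Vs * norm E"
      using scf_step_complement [OF step] E(1) by (simp add: E_def)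
    also have "\<dots> \<le> a * norm E" by (simp add: a_def distrib_right)
    finally have B: "norm (Vp\<^sup>H ** W) \<le> a * norm E" .
    then have "norm (Vp\<^sup>H ** W) \<le> 1 / 2" using E(2) by (simp add: mult.commute)
    note chart = chartable_of_small_complement [OF W this]
    have "norm (Zc W) \<le> 2 * (norm Vs)\<^sup>2 * norm (Vp\<^sup>H ** W)" by (rule chart)
    also have "\<dots> \<le> (2 * (norm Vs)\<^sup>2 + 1) * (a * norm E)"
      using B by (intro mult_mono) auto
    finally have Zb: "norm (Zc W) \<le> b * norm E" by (simp add: b_def mult_ac)
    then have Z1: "norm (Zc W) \<le> 1" using E(3) by (simp add: mult.commute)
    define X where "X = Zc W ** (Vs\<^sup>H ** E ** (Vs + Vp ** Zc W))"
    define Y where "Y = Vp\<^sup>H ** E ** (Vp ** Zc W)"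
    have "norm (Vp ** Zc W) \<le> norm Vp * norm (Zc W)" by (rule norm_matrix_mult_le)
    also have "\<dots> \<le> norm Vp * 1" using Z1 by (intro mult_left_mono) auto
    finally have n: "norm (Vs + Vp ** Zc W) \<le> norm Vs + norm Vp"
      using norm_triangle_ineq [of Vs "Vp ** Zc W"] by simp
    have "norm X \<le> norm (Zc W) * norm (Vs\<^sup>H ** E ** (Vs + Vp ** Zc W))"
      unfolding X_def by (rule norm_matrix_mult_le)
    also have "\<dots> \<le> norm (Zc W) * (norm (Vs\<^sup>H) * norm E * norm (Vs + Vp ** Zc W))"
      by (rule mult_left_mono [OF norm_matrix_mult3_le]) simp
    also have "\<dots> \<le> norm (Zc W) * (norm (Vs\<^sup>H) * norm E * (norm Vs + norm Vp))"
      by (intro mult_left_mono n) auto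
    finally have r1: "norm X \<le> norm (Zc W) * (norm Vs * norm E * (norm Vs + norm Vp))"
      by simp
    have "norm Y \<le> norm (Vp\<^sup>H) * norm E * norm (Vp ** Zc W)"
      unfolding Y_def by (rule norm_matrix_mult3_le)
    also have "\<dots> \<le> norm (Vp\<^sup>H) * norm E * (norm Vp * norm (Zc W))"
      by (intro mult_left_mono norm_matrix_mult_le) auto
    finally have r2: "norm Y \<le> norm Vp * norm E * (norm Vp * norm (Zc W))"
      by simp
    have "norm (Zc W - S V) \<le> norm (X - Y) / gam"
      unfolding scf_step_equation [OF step chart(1)] E_def X_def Y_def by (rule norm_gap_hadamard_le)
    also have "\<dots> \<le> (norm (Zc W) * (norm Vs * norm E * (norm Vs + norm Vp)) + norm Vp * norm E * (norm Vp * norm (Zc W))) / gam"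
      using gam_pos r1 r2 norm_triangle_ineq4 [of X Y] by (intro divide_right_mono) auto
    also have "\<dots> = c * norm E * norm (Zc W)"
      by (simp add: c_def field_simps)
    also have "\<dots> \<le> (b + c) * norm E * norm (Zc W)"
      using b by (intro mult_right_mono) auto
    finally have "norm (Zc W - S V) \<le> (b + c) * norm E * norm (Zc W)" .
    moreover have "norm (Zc W) \<le> (b + c) * norm E"
      using Zb c by (simp add: distrib_right add_increasing2)
    ultimately show ?thesis using chart(1) by (simp add: E_def)
  qed
  ultimately show thesis by (rule that)
qed

end

subsection \<open>The distance in graph coordinates\<close>

locale nepv_norm = nepv H Vs Vp + Nk: real_norm Nk + Nm: real_norm Nm
  for H :: "complex^'k^'n \<Rightarrow> complex^'n^'n" and Vs :: "complex^'k^'n" and Vp :: "complex^'m^'n"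
    and Nk :: "complex^'k^'k \<Rightarrow> real" and Nm :: "complex^'k^'m \<Rightarrow> real" +
  assumes ui_km: "ui_compatible Nk Nm"
begin

abbreviation d :: "complex^'k^'n \<Rightarrow> real" where "d V \<equiv> gr_dist Nk V Vs"

lemma Nk_tan_Theta: "V \<in> stiefel \<Longrightarrow> chartable V \<Longrightarrow> Nk (tan_Theta V Vs) = Nm (Zc V)"
  using ui_km singular_values_Zc [of V] unfolding ui_compatible_def by simp

lemma d_nonneg: "0 \<le> d V" by (simp add: gr_dist_def Nk.N_nonneg)

lemma angle_le_d: assumes "V \<in> stiefel" shows "angle V Vs j \<le> d V / Nk.lo"
proof -
  have "angle V Vs j \<le> cmod (Theta V Vs $ j $ j)"
    by (simp add: Theta_def rdiag_def)
  also have "\<dots> \<le> norm (Theta V Vs)" by (rule norm_matrix_nth_le)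
  finally have "Nk.lo * angle V Vs j \<le> Nk.lo * norm (Theta V Vs)"
    using Nk.lo(1) by (intro mult_left_mono) auto
  also have "\<dots> \<le> d V" by (simp add: gr_dist_def Nk.lo)
  finally show ?thesis using Nk.lo(1) by (simp add: field_simps)
qed

text \<open>Angles and tangents form two diagonal matrices, so they can be compared entry by entry.
  The radius forces every angle below \<open>t\<close>, hence away from a right angle.\<close>

lemma chart_distance:
  assumes "0 < e"
  obtains \<delta> where "0 < \<delta>" "\<And>V. V \<in> stiefel \<Longrightarrow> d V \<le> \<delta> \<Longrightarrow> chartable V \<and> \<bar>d V - Nm (Zc V)\<bar> \<le> e * Nm (Zc V)"
proof -
  \<comment> \<open>The factor cancels the condition number that \<open>Nk.N_perturb\<close>
    introduces.\<close>
  define e' where "e' = e * Nk.lo / Nk.hi"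
  have e': "0 < e'" using assms Nk.lo(1) Nk.hi(1) by (simp add: e'_def)
  obtain t where t: "0 < t" "t < pi / 2" "\<And>x. 0 \<le> x \<Longrightarrow> x \<le> t \<Longrightarrow> \<bar>x - tan x\<bar> \<le> e' * tan x"
    by (rule tan_near_zero [OF e']) blast
  show thesis
  proof (rule that)
    show "0 < t * Nk.lo" using t Nk.lo(1) by simp
    fix V :: "complex^'k^'n" assume V: "V \<in> stiefel" "d V \<le> t * Nk.lo"
    have "d V / Nk.lo \<le> t" using V(2) Nk.lo(1) by (simp add: field_simps)
    then have ang: "0 \<le> angle V Vs j" "angle V Vs j \<le> t" for j
      using angle_le_d [OF V(1), of j] angle_nonneg [OF V(1)] by auto
    then have c: "chartable V"
        unfolding chartable_iff [OF V(1)] using t(2) by (blast intro: order_le_less_trans)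
    have tn: "0 \<le> tan (angle V Vs j)" for j
      using ang [of j] t(2) by (cases "angle V Vs j = 0") (auto intro!: less_imp_le [OF tan_gt_zero])
    have "norm (Theta V Vs - tan_Theta V Vs) \<le> e' * norm (tan_Theta V Vs)"
    proof (rule norm_matrix_le_entrywise)
      show "cmod ((Theta V Vs - tan_Theta V Vs) $ i $ j) \<le> e' * cmod (tan_Theta V Vs $ i $ j)" for i j
        using t(3) [OF ang, of i] tn [of i]
        by (auto simp: Theta_def tan_Theta_def rdiag_def simp flip: of_real_diff)
    qed (use e' in auto)
    then have D: "\<bar>d V - Nk (tan_Theta V Vs)\<bar> \<le> Nk.hi / Nk.lo * e' * Nk (tan_Theta V Vs)"
      unfolding gr_dist_def using e' by (intro Nk.N_perturb) auto
    have e: "Nk.hi / Nk.lo * e' = e" using Nk.lo(1) Nk.hi(1) by (simp add: e'_def)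
    show "chartable V \<and> \<bar>d V - Nm (Zc V)\<bar> \<le> e * Nm (Zc V)"
      using c D unfolding e Nk_tan_Theta [OF V(1) c] by blast
  qed
qed

text \<open>The reverse control: a small coordinate forces a small distance. Smallness of the
  distance cannot be presupposed here, so only \<open>x \<le> tan x\<close> is available.\<close>

lemma d_le_chart:
  assumes V: "V \<in> stiefel" "chartable V"
  shows "d V \<le> Nk.hi / Nk.lo * Nm (Zc V)"
proof -
  have ang: "0 \<le> angle V Vs j" "angle V Vs j < pi / 2" for j
    using angle_nonneg [OF V(1)] V(2) chartable_iff [OF V(1)] by auto
  have le: "angle V Vs j \<le> tan (angle V Vs j)" for j
    using ang [of j] by (rule le_tan)
  have "norm (Theta V Vs) \<le> 1 * norm (tan_Theta V Vs)"
  proof (rule norm_matrix_le_entrywise)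
    show "cmod (Theta V Vs $ i $ j) \<le> 1 * cmod (tan_Theta V Vs $ i $ j)" for i j
      using ang [of i] le [of i] by (auto simp: Theta_def tan_Theta_def rdiag_def)
  qed simp
  then have "Nk.hi * norm (Theta V Vs) \<le> Nk.hi * norm (tan_Theta V Vs)"
    using Nk.hi(1) by (intro mult_left_mono) auto
  moreover have "d V \<le> Nk.hi * norm (Theta V Vs)" by (simp add: gr_dist_def Nk.hi)
  moreover have "norm (tan_Theta V Vs) \<le> Nm (Zc V) / Nk.lo"
    using Nk.lo(2) [of "tan_Theta V Vs"] Nk.lo(1) Nk_tan_Theta [OF V] by (simp add: field_simps)
  then have "Nk.hi * norm (tan_Theta V Vs) \<le> Nk.hi * (Nm (Zc V) / Nk.lo)"
    using Nk.hi(1) by (intro mult_left_mono) auto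
  ultimately show ?thesis by simp
qed

end

section \<open>Spectral radius of a real-linear map\<close>

abbreviation bs :: "nat \<Rightarrow> 'a::euclidean_space" where "bs \<equiv> from_nat_into Basis"

lemma bij_bs: "bij_betw bs {..<DIM('a)} (Basis :: 'a::euclidean_space set)"
  by (rule bij_betw_from_nat_into_finite) simp

lemma bs_Basis: "i < DIM('a::euclidean_space) \<Longrightarrow> (bs i :: 'a) \<in> Basis"
  using bij_bs [where 'a = 'a] by (auto simp: bij_betw_def)

lemma sum_bs: "(\<Sum>i\<in>Basis. f i) = (\<Sum>i<DIM('a::euclidean_space). f (bs i :: 'a))"
  by (rule sum.reindex_bij_betw [OF bij_bs, symmetric])

lemma bs_representation: "(\<Sum>i<DIM('a). inner x (bs i) *\<^sub>R bs i) = (x :: 'a::euclidean_space)"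
  using euclidean_representation [of x] by (simp add: sum_bs)

lemma bs_eqI:
  fixes x y :: "'a::euclidean_space"
  assumes "\<And>i. i < DIM('a) \<Longrightarrow> inner x (bs i) = inner y (bs i)"
  shows "x = y"
proof -
  have "x = (\<Sum>i<DIM('a). inner x (bs i) *\<^sub>R bs i)"
    by (rule bs_representation [symmetric])
  also have "\<dots> = (\<Sum>i<DIM('a). inner y (bs i) *\<^sub>R bs i)"
    using assms by (intro sum.cong) auto
  also have "\<dots> = y" by (rule bs_representation)
  finally show ?thesis .
qed

lemma inner_bs:
  "i < DIM('a::euclidean_space) \<Longrightarrow> j < DIM('a) \<Longrightarrow> inner (bs i :: 'a) (bs j) = (if i = j then 1 else 0)"
  using bij_bs [where 'a = 'a] bs_Basis [of i, where 'a = 'a] bs_Basis [of j, where 'a = 'a]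
  by (auto simp: inner_Basis bij_betw_def inj_on_def)

lemma inner_sum_bs:
  "j < DIM('a::euclidean_space) \<Longrightarrow> inner (\<Sum>i<DIM('a). c i *\<^sub>R (bs i :: 'a)) (bs j) = c j"
  by (simp add: inner_sum_left inner_bs if_distrib [of "\<lambda>x. _ * x"] cong: if_cong)

lemma real_rep_carrier: "real_rep L \<in> carrier_mat DIM('a) DIM('a)" for L :: "'a::euclidean_space \<Rightarrow> 'a"
  by (simp add: real_rep_def)

lemma linear_funpow:
  fixes L :: "'a::real_vector \<Rightarrow> 'a"
  assumes "linear L"
  shows "linear (L ^^ k)"
proof (induction k)
  case 0
  show ?case by (rule linearI) simp_all
next
  case (Suc k)
  then show ?case using linear_compose [OF Suc assms] by (simp add: comp_def)
qed

lemma real_rep_pow: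
  fixes L :: "'a::euclidean_space \<Rightarrow> 'a"
  assumes L: "linear L" and ij: "i < DIM('a)" "j < DIM('a)"
  shows "(real_rep L ^\<^sub>m k) $$ (i, j) = complex_of_real (inner ((L ^^ k) (bs j)) (bs i))"
  using ij
proof (induction k arbitrary: i j)
  case 0
  then show ?case
    by (simp add: real_rep_def inner_bs)
next
  case (Suc k)
  have linear: "linear (L ^^ k)" by (rule linear_funpow [OF L])
  have "(real_rep L ^\<^sub>m Suc k) $$ (i, j) =
      (\<Sum>l<DIM('a). (real_rep L ^\<^sub>m k) $$ (i, l) * real_rep L $$ (l, j))"
    using Suc.prems real_rep_carrier [of L]
    by (simp add: scalar_prod_def atLeast0LessThan)
  also have "\<dots> = (\<Sum>l<DIM('a). complex_of_real (inner ((L ^^ k) (bs l)) (bs i) * inner (L (bs j)) (bs l)))"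
    using Suc by (intro sum.cong) (auto simp: real_rep_def)
  also have "\<dots> = complex_of_real (inner ((L ^^ k) (\<Sum>l<DIM('a). inner (L (bs j)) (bs l) *\<^sub>R bs l)) (bs i))"
    by (simp add: linear_sum [OF linear] linear_scale [OF linear] inner_sum_left mult.commute)
  also have "\<dots> = complex_of_real (inner ((L ^^ Suc k) (bs j)) (bs i))"
    by (simp add: bs_representation funpow_swap1)
  finally show ?case .
qed

text \<open>\<open>x\<close> and \<open>y\<close> are the real and imaginary parts of a complex
  eigenvector. The two equations are the parts of L(x + i y) = z (x + i y).\<close>

lemma eigenvalue_real_rep:
  fixes L :: "'a::euclidean_space \<Rightarrow> 'a"
  assumes L: "linear L" and ev: "eigenvalue (real_rep L) z"
  obtains x y where "x \<noteq> 0 \<or> y \<noteq> 0" "L x = Re z *\<^sub>R x - Im z *\<^sub>R y" "L y = Im z *\<^sub>R x + Re z *\<^sub>R y"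
proof -
  obtain v where v: "v \<in> carrier_vec DIM('a)" "v \<noteq> 0\<^sub>v DIM('a)" "real_rep L *\<^sub>v v = z \<cdot>\<^sub>v v"
    using ev real_rep_carrier [of L] unfolding eigenvalue_def eigenvector_def by auto
  define w where "w = Matrix.vec_index v"
  define x :: 'a where "x = (\<Sum>i<DIM('a). Re (w i) *\<^sub>R bs i)"
  define y :: 'a where "y = (\<Sum>i<DIM('a). Im (w i) *\<^sub>R bs i)"
  have eq: "(\<Sum>j<DIM('a). complex_of_real (inner (L (bs j)) (bs i)) * w j) = z * w i" if "i < DIM('a)" for i
  proof -
    have "Matrix.vec_index (real_rep L *\<^sub>v v) i = Matrix.vec_index (z \<cdot>\<^sub>v v) i" using v by simp
    then show ?thesis
      using that v(1) real_rep_carrier [of L]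
      by (simp add: w_def real_rep_def scalar_prod_def atLeast0LessThan)
  qed
  have Lx: "inner (L x) (bs i) = (\<Sum>j<DIM('a). inner (L (bs j)) (bs i) * Re (w j))" for i
    by (simp add: x_def linear_sum [OF L] linear_scale [OF L] inner_sum_left mult.commute)
  have Ly: "inner (L y) (bs i) = (\<Sum>j<DIM('a). inner (L (bs j)) (bs i) * Im (w j))" for i
    by (simp add: y_def linear_sum [OF L] linear_scale [OF L] inner_sum_left mult.commute)
  show thesis
  proof
    show "x \<noteq> 0 \<or> y \<noteq> 0"
    proof (rule ccontr)
      assume "\<not> (x \<noteq> 0 \<or> y \<noteq> 0)"
      then have "Re (w j) = 0 \<and> Im (w j) = 0" if "j < DIM('a)" for j
        using inner_sum_bs [OF that, of "\<lambda>i. Re (w i)"] inner_sum_bs [OF that, of "\<lambda>i. Im (w i)"]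
        unfolding x_def [symmetric] y_def [symmetric] by simp
      then have "w j = 0" if "j < DIM('a)" for j using that by (simp add: complex_eq_iff)
      then have "v = 0\<^sub>v DIM('a)" using v(1) by (intro eq_vecI) (auto simp: w_def)
      with v(2) show False by simp
    qed
    show "L x = Re z *\<^sub>R x - Im z *\<^sub>R y"
    proof (rule bs_eqI)
      fix i assume i: "i < DIM('a)"
      have "inner (L x) (bs i) = Re (\<Sum>j<DIM('a). complex_of_real (inner (L (bs j)) (bs i)) * w j)"
        by (simp add: Lx)
      then show "inner (L x) (bs i) = inner (Re z *\<^sub>R x - Im z *\<^sub>R y) (bs i)"
        using i by (simp add: eq inner_diff_left x_def y_def inner_sum_bs)
    qed
    show "L y = Im z *\<^sub>R x + Re z *\<^sub>R y"
    proof (rule bs_eqI)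
      fix i assume i: "i < DIM('a)"
      have "inner (L y) (bs i) = Im (\<Sum>j<DIM('a). complex_of_real (inner (L (bs j)) (bs i)) * w j)"
        by (simp add: Ly)
      then show "inner (L y) (bs i) = inner (Im z *\<^sub>R x + Re z *\<^sub>R y) (bs i)"
        using i by (simp add: eq inner_add_left x_def y_def inner_sum_bs)
    qed
  qed
qed

text \<open>Serves to bound the number of real eigenvalues of a linear map by that of the
  eigenvalues of its matrix, in \<open>expanding_form\<close>.\<close>

lemma real_eigenvalue_real_rep:
  fixes L :: "'a::euclidean_space \<Rightarrow> 'a"
  assumes L: "linear L" and x: "x \<noteq> 0" "L x = c *\<^sub>R x"
  shows "eigenvalue (real_rep L) (complex_of_real c)"
proof -
  define v where "v = Matrix.vec DIM('a) (\<lambda>i. complex_of_real (inner x (bs i)))"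
  have "real_rep L *\<^sub>v v = complex_of_real c \<cdot>\<^sub>v v"
  proof (rule eq_vecI)
    fix i assume "i < dim_vec (complex_of_real c \<cdot>\<^sub>v v)"
    then have i: "i < DIM('a)" by (simp add: v_def)
    have "Matrix.vec_index (real_rep L *\<^sub>v v) i =
        complex_of_real (\<Sum>j<DIM('a). inner (L (bs j)) (bs i) * inner x (bs j))"
      using i by (simp add: v_def real_rep_def scalar_prod_def atLeast0LessThan)
    also have "(\<Sum>j<DIM('a). inner (L (bs j)) (bs i) * inner x (bs j)) =
      inner (L (\<Sum>j<DIM('a). inner x (bs j) *\<^sub>R bs j)) (bs i)"
      by (simp add: linear_sum [OF L] linear_scale [OF L] inner_sum_left mult.commute)
    also have "\<dots> = c * inner x (bs i)" by (simp add: bs_representation x)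
    finally show "Matrix.vec_index (real_rep L *\<^sub>v v) i = Matrix.vec_index (complex_of_real c \<cdot>\<^sub>v v) i"
      using i by (simp add: v_def)
  qed (simp add: v_def real_rep_def)
  moreover have "v \<noteq> 0\<^sub>v DIM('a)"
  proof
    assume "v = 0\<^sub>v DIM('a)"
    then have z: "inner x (bs i) = 0" if "i < DIM('a)" for i
    proof -
      have "Matrix.vec_index v i = 0" using \<open>v = 0\<^sub>v DIM('a)\<close> that by simp
      then show ?thesis using that by (simp add: v_def)
    qed
    have "x = 0" by (rule bs_eqI) (simp add: z)
    with x show False by simp
  qed
  ultimately show ?thesis
    unfolding eigenvalue_def eigenvector_def using real_rep_carrier [of L]
    by (intro exI [of _ v]) (auto simp: v_def)
qed

lemma spectral_radius_eigenvalue: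
  fixes L :: "'a::euclidean_space \<Rightarrow> 'a"
  obtains z where "eigenvalue (real_rep L) z" "cmod z = real_spectral_radius L"
  using spectral_radius_mem_max(1) [OF real_rep_carrier [of L]]
  unfolding real_spectral_radius_def spectrum_def by (auto simp: DIM_positive)

lemma cmod_eigenvalue_le:
  fixes L :: "'a::euclidean_space \<Rightarrow> 'a"
  assumes "eigenvalue (real_rep L) z"
  shows "cmod z \<le> real_spectral_radius L"
  unfolding real_spectral_radius_def
  by (rule spectral_radius_mem_max(2) [OF real_rep_carrier [of L]])
    (use assms in \<open>auto simp: spectrum_def DIM_positive\<close>)

lemma real_spectral_radius_nonneg: "0 \<le> real_spectral_radius L" for L :: "'a::euclidean_space \<Rightarrow> 'a"
  by (rule spectral_radius_eigenvalue [of L]) (metis norm_ge_zero)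

section \<open>Growth of the powers of a linear map\<close>

lemma eigenvalue_scale:
  fixes L :: "'a::euclidean_space \<Rightarrow> 'a"
  assumes ev: "eigenvalue (real_rep (\<lambda>x. c *\<^sub>R L x)) z" and c: "c \<noteq> 0"
  shows "eigenvalue (real_rep L) (z / complex_of_real c)"
proof -
  have R: "real_rep (\<lambda>x. c *\<^sub>R L x) = complex_of_real c \<cdot>\<^sub>m real_rep L"
    by (rule eq_matI) (auto simp: real_rep_def)
  obtain v where v: "v \<in> carrier_vec DIM('a)" "v \<noteq> 0\<^sub>v DIM('a)"
      "(complex_of_real c \<cdot>\<^sub>m real_rep L) *\<^sub>v v = z \<cdot>\<^sub>v v"
    using ev real_rep_carrier [of L] unfolding R eigenvalue_def eigenvector_def by auto
  have "complex_of_real c * Matrix.vec_index (real_rep L *\<^sub>v v) i = z * Matrix.vec_index v i"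
    if i: "i < DIM('a)" for i
  proof -
    have "complex_of_real c * Matrix.vec_index (real_rep L *\<^sub>v v) i =
        Matrix.vec_index ((complex_of_real c \<cdot>\<^sub>m real_rep L) *\<^sub>v v) i"
      using i v(1) real_rep_carrier [of L] by (simp add: scalar_prod_def sum_distrib_left mult_ac)
    then show ?thesis using i v(1) by (simp add: v(3))
  qed
  then have "real_rep L *\<^sub>v v = (z / complex_of_real c) \<cdot>\<^sub>v v"
    using v(1) real_rep_carrier [of L] c
    by (intro eq_vecI) (auto simp: field_simps)
  then show ?thesis
    unfolding eigenvalue_def eigenvector_def using v real_rep_carrier [of L] by auto
qed

text \<open>Dividing by \<open>q\<close> brings the spectral radius below 1, where the Jordan normal
  form bounds the entries of all powers at once.\<close>

theorem power_bound_above_spectral_radius: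
  fixes L :: "'a::euclidean_space \<Rightarrow> 'a"
  assumes L: "linear L" and q: "real_spectral_radius L < q"
  obtains C where "0 < C" "\<And>k x. norm ((L ^^ k) x) \<le> C * q ^ k * norm x"
proof -
  have "0 < q" using real_spectral_radius_nonneg [of L] q by linarith
  define M where "M = (\<lambda>x. (1 / q) *\<^sub>R L x)"
  have M: "linear M" unfolding M_def by (rule linear_compose_scale_right [OF L])
  obtain z where z: "eigenvalue (real_rep M) z" "cmod z = real_spectral_radius M"
    by (rule spectral_radius_eigenvalue)
  have "eigenvalue (real_rep L) (z / complex_of_real (1 / q))"
    using z(1) \<open>0 < q\<close> unfolding M_def by (intro eigenvalue_scale) auto
  then have "cmod (z / complex_of_real (1 / q)) \<le> real_spectral_radius L"
    by (rule cmod_eigenvalue_le)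
  then have "cmod z * q \<le> real_spectral_radius L"
    using \<open>0 < q\<close> by (simp add: norm_mult)
  then have "cmod z * q < q" using q by (rule order.strict_trans1)
  then have "cmod z < 1"
    using \<open>0 < q\<close> by (metis mult.left_neutral mult_less_cancel_right_pos)
  then have "spectral_radius (real_rep M) < 1"
    using z \<open>0 < q\<close> by (simp add: real_spectral_radius_def)
  then obtain c where c: "\<And>k. norm_bound (real_rep M ^\<^sub>m k) c"
    using spectral_radius_jnf_norm_bound_less_1_upper_triangular [OF real_rep_carrier [of M]] by blast
  have entry: "\<bar>inner ((M ^^ k) (bs j)) (bs i)\<bar> \<le> c" if "i < DIM('a)" "j < DIM('a)" for i j k
    using c [of k] that real_rep_pow [OF M that, of k] real_rep_carrier [of M]
    unfolding norm_bound_def by (metis norm_of_real carrier_matD pow_carrier_mat)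
  \<comment> \<open>The dimension enters twice, for the coordinates of the image and for those of
    the argument. The added one makes \<open>C\<close> positive.\<close>
  define C where "C = real DIM('a) * (real DIM('a) * c) + 1"
  have "0 \<le> c" by (rule order_trans [OF abs_ge_zero entry]) (rule DIM_positive)+
  then have "0 < C" by (simp add: C_def add_nonneg_pos)
  have M_le: "norm ((M ^^ k) x) \<le> C * norm x" for k x
  proof -
    have lk: "linear (M ^^ k)" by (rule linear_funpow [OF M])
    have b: "norm ((M ^^ k) (bs j)) \<le> real DIM('a) * c" if "j < DIM('a)" for j
    proof -
      have "norm ((M ^^ k) (bs j)) \<le> (\<Sum>i\<in>Basis. \<bar>inner ((M ^^ k) (bs j)) i\<bar>)"
        by (rule norm_le_l1)
      also have "\<dots> \<le> (\<Sum>i<DIM('a). c)"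
        unfolding sum_bs using entry that by (intro sum_mono) auto
      finally show ?thesis by simp
    qed
    have "(M ^^ k) x = (\<Sum>j<DIM('a). inner x (bs j) *\<^sub>R (M ^^ k) (bs j))"
      using bs_representation [of x] linear_sum [OF lk] linear_scale [OF lk]
      by (metis (no_types, lifting) sum.cong)
    then have "norm ((M ^^ k) x) \<le> (\<Sum>j<DIM('a). \<bar>inner x (bs j)\<bar> * norm ((M ^^ k) (bs j)))"
      by (simp add: sum_norm_le)
    also have "\<dots> \<le> (\<Sum>j<DIM('a). norm x * (real DIM('a) * c))"
      using b by (intro sum_mono mult_mono) (auto intro: Basis_le_norm bs_Basis)
    also have "\<dots> \<le> C * norm x" by (simp add: C_def algebra_simps)
    finally show ?thesis .
  qed
  have pow: "(L ^^ k) x = q ^ k *\<^sub>R (M ^^ k) x" for k x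
  proof (induction k)
    case (Suc k)
    then show ?case using \<open>0 < q\<close> by (simp add: M_def linear_scale [OF L])
  qed simp
  have "norm ((L ^^ k) x) \<le> C * q ^ k * norm x" for k x
    unfolding pow using mult_left_mono [OF M_le [of k x], of "q ^ k"] \<open>0 < q\<close> by (simp add: mult_ac)
  then show thesis using that \<open>0 < C\<close> by blast
qed

lemma eigenpair_power:
  fixes L :: "'a::euclidean_space \<Rightarrow> 'a"
  assumes L: "linear L" and x: "L x = Re z *\<^sub>R x - Im z *\<^sub>R y" and y: "L y = Im z *\<^sub>R x + Re z *\<^sub>R y"
  shows "(L ^^ k) x = Re (z ^ k) *\<^sub>R x - Im (z ^ k) *\<^sub>R y \<and> (L ^^ k) y = Im (z ^ k) *\<^sub>R x + Re (z ^ k) *\<^sub>R y"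
proof (induction k)
  case (Suc k)
  have "(L ^^ Suc k) x = L (Re (z ^ k) *\<^sub>R x - Im (z ^ k) *\<^sub>R y)"
    "(L ^^ Suc k) y = L (Im (z ^ k) *\<^sub>R x + Re (z ^ k) *\<^sub>R y)"
    using Suc by simp_all
  then show ?case
    by (simp add: linear_diff [OF L] linear_add [OF L] linear_scale [OF L] x y algebra_simps)
qed simp

text \<open>For the two parts of a dominant complex eigenvector the cross terms cancel, so the sum
  of their squared norms grows exactly by the squared power of the modulus. At least one part grows
  that much, but which one may depend on \<open>k\<close>.\<close>

theorem power_bound_below_spectral_radius:
  fixes L :: "'a::euclidean_space \<Rightarrow> 'a"
  assumes L: "linear L"
  obtains x where "x \<noteq> 0" "real_spectral_radius L ^ k * norm x \<le> norm ((L ^^ k) x)"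
proof -
  obtain z where z: "eigenvalue (real_rep L) z" "cmod z = real_spectral_radius L"
    by (rule spectral_radius_eigenvalue)
  obtain x y where xy: "x \<noteq> 0 \<or> y \<noteq> 0" and eig: "L x = Re z *\<^sub>R x - Im z *\<^sub>R y" "L y = Im z *\<^sub>R x + Re z *\<^sub>R y"
    by (rule eigenvalue_real_rep [OF L z(1)])
  define a where "a = Re (z ^ k)"
  define b where "b = Im (z ^ k)"
  have Lx: "(L ^^ k) x = a *\<^sub>R x - b *\<^sub>R y" and Ly: "(L ^^ k) y = b *\<^sub>R x + a *\<^sub>R y"
    using eigenpair_power [OF L eig] by (simp_all add: a_def b_def)
  have "(norm ((L ^^ k) x))\<^sup>2 + (norm ((L ^^ k) y))\<^sup>2 = (a\<^sup>2 + b\<^sup>2) * ((norm x)\<^sup>2 + (norm y)\<^sup>2)"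
    unfolding Lx Ly power2_norm_eq_inner
    by (simp add: inner_diff_left inner_diff_right inner_add_left inner_add_right inner_commute [of y x]
        power2_eq_square algebra_simps)
  also have "a\<^sup>2 + b\<^sup>2 = (real_spectral_radius L ^ k)\<^sup>2"
    using cmod_power2 [of "z ^ k"] by (simp add: a_def b_def norm_power z(2))
  finally have e: "(norm ((L ^^ k) x))\<^sup>2 + (norm ((L ^^ k) y))\<^sup>2 =
     (real_spectral_radius L ^ k * norm x)\<^sup>2 + (real_spectral_radius L ^ k * norm y)\<^sup>2"
    by (simp add: power_mult_distrib distrib_left)
  have r: "0 \<le> real_spectral_radius L ^ k" by (simp add: real_spectral_radius_nonneg)
  have zero: "(L ^^ k) 0 = 0" using linear_funpow [OF L] linear_0 by blast
  show thesis
  proof (rule ccontr)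
    assume "\<not> thesis"
    then have n: "u \<noteq> 0 \<Longrightarrow> norm ((L ^^ k) u) < real_spectral_radius L ^ k * norm u" for u
      using that by (meson not_le)
    have n': "(norm ((L ^^ k) u))\<^sup>2 < (real_spectral_radius L ^ k * norm u)\<^sup>2" if "u \<noteq> 0" for u
      using n [OF that] by (intro power_strict_mono) auto
    have n'': "(norm ((L ^^ k) u))\<^sup>2 \<le> (real_spectral_radius L ^ k * norm u)\<^sup>2" for u
      using n' [of u] by (cases "u = 0") (auto simp: zero)
    show False using xy e n' [of x] n' [of y] n'' [of x] n'' [of y] by (auto simp: less_le)
  qed
qed

text \<open>A bilinear form on a Euclidean space is stored as the family of its representing vectors along
  a basis \<open>b\<close>, so that forms make up a Euclidean space themselves. For all but finitely many \<open>c\<close>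
  the Stein equation \<open>L\<^sup>T P L - c P = I\<close> is therefore solvable.\<close>

theorem expanding_form:
  fixes L :: "'a::euclidean_space \<Rightarrow> 'a" and b :: "'i::finite \<Rightarrow> 'a"
  assumes L: "linear L" and b: "bij_betw b UNIV Basis" and \<rho>: "real_spectral_radius L > 1"
  obtains B :: "'a \<Rightarrow> 'a \<Rightarrow> real" and c where "bounded_bilinear B" "c > 1"
    "\<And>x. B (L x) (L x) = c * B x x + (norm x)\<^sup>2" "\<exists>x. B x x > 0"
proof -
  define B :: "'a^'i \<Rightarrow> 'a \<Rightarrow> 'a \<Rightarrow> real" where
    "B P x y = (\<Sum>i\<in>UNIV. inner x (b i) * inner (P $ i) y)" for P x y
  \<comment> \<open>\<open>T\<close> sends the form of P to that of L^T P L, as \<open>BT\<close>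
    confirms, and \<open>J\<close> represents the inner product.\<close>
  define T :: "'a^'i \<Rightarrow> 'a^'i" where
    "T P = (\<chi> i. adjoint L (\<Sum>j\<in>UNIV. inner (L (b i)) (b j) *\<^sub>R P $ j))" for P
  define J :: "'a^'i" where "J = (\<chi> i. b i)"
  have rep: "(\<Sum>i\<in>UNIV. inner x (b i) *\<^sub>R b i) = x" for x
    using euclidean_representation [of x] sum.reindex_bij_betw [OF b, of "\<lambda>i. inner x i *\<^sub>R i"] by simp
  have B_add: "B (P + Q) x y = B P x y + B Q x y" for P Q x y
    by (simp add: B_def inner_add_left distrib_left sum.distrib)
  have B_scale: "B (r *\<^sub>R P) x y = r * B P x y" for P r x y
    by (simp add: B_def sum_distrib_left mult_ac)
  have BJ: "B J x y = inner x y" for x y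
  proof -
    have "B J x y = inner (\<Sum>i\<in>UNIV. inner x (b i) *\<^sub>R b i) y"
      by (simp add: B_def J_def inner_sum_left)
    then show ?thesis by (simp add: rep)
  qed
  have BT: "B (T P) x y = B P (L x) (L y)" for P x y
  proof -
    have "B (T P) x y = (\<Sum>i\<in>UNIV. \<Sum>j\<in>UNIV. inner x (b i) * (inner (L (b i)) (b j) * inner (P $ j) (L y)))"
      by (simp add: B_def T_def adjoint_works [OF L] adjoint_clauses [OF L] inner_sum_left sum_distrib_left)
    also have "\<dots> = (\<Sum>j\<in>UNIV. \<Sum>i\<in>UNIV. inner x (b i) * (inner (L (b i)) (b j) * inner (P $ j) (L y)))"
      by (rule sum.swap)
    also have "\<dots> = (\<Sum>j\<in>UNIV. inner (L (\<Sum>i\<in>UNIV. inner x (b i) *\<^sub>R b i)) (b j) * inner (P $ j) (L y))"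
      by (simp add: linear_sum [OF L] linear_scale [OF L] inner_sum_left sum_distrib_left sum_distrib_right mult_ac)
    finally show ?thesis by (simp add: rep B_def)
  qed
  have T: "linear T"
  proof
    show "T (P + Q) = T P + T Q" for P Q
      by (simp add: T_def Finite_Cartesian_Product.vec_eq_iff scaleR_add_right sum.distrib
          linear_add [OF adjoint_linear [OF L]])
    show "T (r *\<^sub>R P) = r *\<^sub>R T P" for r P
      by (simp add: T_def Finite_Cartesian_Product.vec_eq_iff scaleR_sum_right mult.commute
          flip: linear_scale [OF adjoint_linear [OF L]])
  qed
  \<comment> \<open>\<open>E\<close> is the set of values at which the Stein equation could fail to
    be solvable. It is finite, while the interval from 1 to the squared spectral radius is
    not.\<close>
  define E where "E = {c. \<exists>P. P \<noteq> 0 \<and> T P = c *\<^sub>R P}"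
  have "finite E"
  proof -
    have "complex_of_real ` E \<subseteq> spectrum (real_rep T)"
      using real_eigenvalue_real_rep [OF T] by (auto simp: E_def spectrum_def)
    then have "finite (complex_of_real ` E)"
      using card_finite_spectrum(1) [OF real_rep_carrier [of T]] finite_subset by blast
    then show ?thesis by (rule finite_imageD) (simp add: inj_on_def)
  qed
  moreover have "infinite {1<..<(real_spectral_radius L)\<^sup>2}"
    using \<rho> by (simp add: infinite_Ioo one_less_power)
  ultimately obtain c where c: "1 < c" "c < (real_spectral_radius L)\<^sup>2" "c \<notin> E"
    by (metis finite_subset greaterThanLessThan_iff subsetI)
  define K where "K P = T P - c *\<^sub>R P" for P
  have K: "linear K"
    unfolding K_def by (intro linear_compose_sub T linear_compose_scale_right linear_ident)
  have "P = 0" if "K P = 0" for P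
    using that c(3) by (auto simp: K_def E_def)
  then have "inj K" using linear_injective_0 [OF K] by blast
  then have "surj K" by (rule linear_inj_imp_surj [OF K])
  then obtain P where P: "T P - c *\<^sub>R P = J" unfolding K_def surj_def by metis
  then have TP: "T P = c *\<^sub>R P + J" by (simp add: diff_eq_eq add.commute)
  have Stein: "B P (L x) (L y) = c * B P x y + inner x y" for x y
    by (simp add: BT [symmetric] TP B_add B_scale BJ)
  have bl: "bilinear (B P)"
    unfolding bilinear_def B_def
    by (auto intro!: linear_compose_sum linearI simp: inner_add_left inner_add_right
        distrib_left distrib_right sum.distrib sum_distrib_left mult_ac)
  obtain z where z: "eigenvalue (real_rep L) z" "cmod z = real_spectral_radius L"
    by (rule spectral_radius_eigenvalue)
  obtain x y where xy: "x \<noteq> 0 \<or> y \<noteq> 0" and eig: "L x = Re z *\<^sub>R x - Im z *\<^sub>R y" "L y = Im z *\<^sub>R x + Re z *\<^sub>R y"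
    by (rule eigenvalue_real_rep [OF L z(1)])
  \<comment> \<open>On the parts of a dominant eigenvector the cross terms cancel, so
    \<open>L\<close> multiplies \<open>s\<close> by the squared spectral radius. Compared with the
    Stein equation, \<open>c\<close> below that square forces \<open>s\<close> to be positive, and
    then so is one of its summands.\<close>
  define s where "s = B P x x + B P y y"
  have "B P (L x) (L x) + B P (L y) (L y) = ((Re z)\<^sup>2 + (Im z)\<^sup>2) * s"
    unfolding eig s_def
    by (simp add: bilinear_lsub [OF bl] bilinear_rsub [OF bl] bilinear_ladd [OF bl] bilinear_radd [OF bl]
        bilinear_lmul [OF bl] bilinear_rmul [OF bl] power2_eq_square algebra_simps)
  then have "(real_spectral_radius L)\<^sup>2 * s = c * s + (inner x x + inner y y)"
    unfolding z(2) [symmetric] cmod_power2 Stein by (simp add: s_def algebra_simps)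
  then have "((real_spectral_radius L)\<^sup>2 - c) * s = inner x x + inner y y"
    by (simp add: algebra_simps)
  moreover have "0 < inner x x + inner y y"
    using xy by (auto intro: add_pos_nonneg add_nonneg_pos)
  ultimately have "0 < s"
    using c(2) by (metis diff_gt_0_iff_gt zero_less_mult_pos)
  then have "\<exists>x. B P x x > 0" unfolding s_def by (metis add_nonpos_nonpos not_le)
  moreover have "bounded_bilinear (B P)"
    using bl by (simp add: bilinear_conv_bounded_bilinear)
  moreover have "B P (L x) (L x) = c * B P x x + (norm x)\<^sup>2" for x
    by (simp add: Stein power2_norm_eq_inner)
  ultimately show thesis using that c(1) by blast
qed

text \<open>\<open>expanding_form\<close> takes a basis indexed by a type. The Boolean component
  doubles the number of entries to the real dimension.\<close>

lemma complex_matrix_basis: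
  obtains b :: "'m \<times> 'k \<times> bool \<Rightarrow> complex^'k^'m" where "bij_betw b UNIV Basis"
proof -
  have "card (UNIV :: ('m \<times> 'k \<times> bool) set) = card (Basis :: (complex^'k^'m) set)"
    by (simp add: card_cartesian_product flip: UNIV_Times_UNIV)
  then show thesis
    using that finite_same_card_bij [of "UNIV :: ('m \<times> 'k \<times> bool) set" "Basis :: (complex^'k^'m) set"]
    by auto
qed

section \<open>Limits superior near the solution\<close>

lemma eventually_inf_at_right:
  "eventually P (inf (principal S) (filtercomap g (at_right (0::real)))) \<longleftrightarrow>
    (\<exists>\<delta>>0. \<forall>x\<in>S. 0 < g x \<and> g x < \<delta> \<longrightarrow> P x)"
proof -
  have "eventually P (inf (principal S) (filtercomap g (at_right (0::real)))) \<longleftrightarrow>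
    eventually (\<lambda>x. x \<in> S \<longrightarrow> P x) (filtercomap g (at_right (0::real)))"
    by (subst inf.commute) (rule eventually_inf_principal)
  also have "\<dots> \<longleftrightarrow> (\<exists>\<delta>>0. \<forall>x\<in>S. 0 < g x \<and> g x < \<delta> \<longrightarrow> P x)"
    unfolding eventually_filtercomap eventually_at_right_field by (blast intro: exI [of _ "\<lambda>y. 0 < y \<and> y < _"])
  finally show ?thesis .
qed

text \<open>Compares limits superior over different kinds of objects, here runs and points. The
  partner of \<open>x\<close> must itself approach the limit, so one tolerance governs both
  closeness and value.\<close>

lemma Limsup_dominated:
  fixes f :: "'a \<Rightarrow> real" and f' :: "'b \<Rightarrow> real"
  assumes dom: "\<And>e. e > 0 \<Longrightarrow> \<exists>\<delta>>0. \<forall>x\<in>S. 0 < g x \<and> g x < \<delta> \<longrightarrow> (\<exists>y\<in>T. 0 < h y \<and> h y < e \<and> f x \<le> f' y + e)"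
  shows "Limsup (inf (principal S) (filtercomap g (at_right (0::real)))) (\<lambda>x. ereal (f x)) \<le>
    Limsup (inf (principal T) (filtercomap h (at_right (0::real)))) (\<lambda>y. ereal (f' y))"
    (is "?L \<le> ?R")
proof (rule dense_ge)
  fix z assume z: "?R < z"
  show "?L \<le> z"
  proof (cases z)
    case (real z')
    obtain w where w: "?R < w" "w < z" using z dense by blast
    then obtain w' where w': "w = ereal w'" using real by (cases w) auto
    have "eventually (\<lambda>y. ereal (f' y) < w) (inf (principal T) (filtercomap h (at_right (0::real))))"
      using w(1) by (rule Limsup_lessD)
    then obtain \<delta>1 where \<delta>1: "\<delta>1 > 0" "\<And>y. y \<in> T \<Longrightarrow> 0 < h y \<Longrightarrow> h y < \<delta>1 \<Longrightarrow> f' y < w'"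
      unfolding eventually_inf_at_right w' by auto
    \<comment> \<open>Serves at once as a radius within which \<open>f' y < w'\<close> and as the
      slack between \<open>w'\<close> and \<open>z'\<close>.\<close>
    define e where "e = min \<delta>1 (z' - w')"
    have "e > 0" using \<delta>1(1) w(2) w' real by (simp add: e_def)
    then obtain \<delta> where \<delta>: "\<delta> > 0"
      "\<forall>x\<in>S. 0 < g x \<and> g x < \<delta> \<longrightarrow> (\<exists>y\<in>T. 0 < h y \<and> h y < e \<and> f x \<le> f' y + e)"
      using dom [OF \<open>e > 0\<close>] by blast
    have "f x \<le> z'" if x: "x \<in> S" "0 < g x" "g x < \<delta>" for x
    proof -
      obtain y where "y \<in> T" "0 < h y" "h y < e" "f x \<le> f' y + e" using \<delta>(2) x by blast
      then show ?thesis using \<delta>1(2) [of y] by (simp add: e_def)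
    qed
    then have "eventually (\<lambda>x. ereal (f x) \<le> z) (inf (principal S) (filtercomap g (at_right (0::real))))"
      unfolding eventually_inf_at_right real using \<delta>(1) by auto
    then show ?thesis by (rule Limsup_bounded)
  qed (use z in auto)
qed

text \<open>Made for ratios whose leading part is homogeneous of degree 0. Such a part takes all of
  its values arbitrarily close to 0, which is what \<open>low\<close> asks, so the limit superior
  becomes a plain supremum.\<close>

lemma Limsup_eq_SUP:
  fixes f :: "'a \<Rightarrow> real" and F :: "'b \<Rightarrow> real"
  assumes up: "\<And>e. e > 0 \<Longrightarrow> \<exists>\<delta>>0. \<forall>x\<in>S. 0 < g x \<and> g x < \<delta> \<longrightarrow> (\<exists>z\<in>Z. f x \<le> F z + e)"
    and low: "\<And>z e \<delta>. z \<in> Z \<Longrightarrow> e > 0 \<Longrightarrow> \<delta> > 0 \<Longrightarrow> \<exists>x\<in>S. 0 < g x \<and> g x < \<delta> \<and> F z \<le> f x + e"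
  shows "Limsup (inf (principal S) (filtercomap g (at_right (0::real)))) (\<lambda>x. ereal (f x)) =
    (SUP z\<in>Z. ereal (F z))" (is "?L = ?R")
proof (rule antisym)
  show "?L \<le> ?R"
  proof (rule ereal_le_epsilon2)
    fix e :: real assume "e > 0"
    then obtain \<delta> where \<delta>: "\<delta> > 0" "\<forall>x\<in>S. 0 < g x \<and> g x < \<delta> \<longrightarrow> (\<exists>z\<in>Z. f x \<le> F z + e)"
      using up [OF \<open>e > 0\<close>] by blast
    have "ereal (f x) \<le> ?R + ereal e" if "x \<in> S" "0 < g x" "g x < \<delta>" for x
    proof -
      obtain z where z: "z \<in> Z" "f x \<le> F z + e" using \<delta>(2) \<open>x \<in> S\<close> \<open>0 < g x\<close> \<open>g x < \<delta>\<close> by blast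
      have "ereal (f x) \<le> ereal (F z) + ereal e" using z(2) by simp
      also have "\<dots> \<le> ?R + ereal e" using z(1) by (intro add_right_mono SUP_upper)
      finally show ?thesis .
    qed
    then show "?L \<le> ?R + ereal e"
      using \<delta>(1) by (intro Limsup_bounded) (auto simp: eventually_inf_at_right)
  qed
  show "?R \<le> ?L"
  proof (rule SUP_least)
    fix z assume z: "z \<in> Z"
    show "ereal (F z) \<le> ?L"
    proof (rule ccontr)
      assume "\<not> ereal (F z) \<le> ?L"
      then obtain w where w: "?L < w" "w < ereal (F z)" using dense by (auto simp: not_le)
      then obtain w' where w': "w = ereal w'" by (cases w) auto
      have "eventually (\<lambda>x. ereal (f x) < w) (inf (principal S) (filtercomap g (at_right (0::real))))"
        using w(1) by (rule Limsup_lessD)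
      then obtain \<delta> where \<delta>: "\<delta> > 0" "\<And>x. x \<in> S \<Longrightarrow> 0 < g x \<Longrightarrow> g x < \<delta> \<Longrightarrow> f x < w'"
        unfolding eventually_inf_at_right w' by auto
      have "F z - w' > 0" using w w' by simp
      then obtain x where "x \<in> S" "0 < g x" "g x < \<delta>" "F z \<le> f x + (F z - w')"
        using low [OF z _ \<delta>(1)] by blast
      then show False using \<delta>(2) [of x] by simp
    qed
  qed
qed

text \<open>Both errors are measured against the denominator \<open>z\<close>. The factor 2 stems
  from \<open>b \<ge> z / 2\<close>, and \<open>K\<close> bounds the ratio \<open>s / z\<close> by
  which the error of the denominator is multiplied.\<close>

lemma ratio_perturb:
  fixes a b s z :: real
  assumes "\<bar>a - s\<bar> \<le> e1 * z" "\<bar>b - z\<bar> \<le> e2 * z" "e2 \<le> 1 / 2" "0 < z" "0 \<le> s" "s \<le> K * z" "0 \<le> e2"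
  shows "0 < b" "\<bar>a / b - s / z\<bar> \<le> 2 * (e1 + K * e2)"
proof -
  have "e2 * z \<le> 1 / 2 * z" using assms by (intro mult_right_mono) auto
  then have b: "z / 2 \<le> b" using assms(2) by linarith
  then show "0 < b" using assms(4) by linarith
  have "a / b - s / z = ((a - s) * z - s * (b - z)) / (b * z)"
    using assms(4) \<open>0 < b\<close> by (simp add: field_simps)
  then have "\<bar>a / b - s / z\<bar> = \<bar>(a - s) * z - s * (b - z)\<bar> / (b * z)"
    using assms(4) \<open>0 < b\<close> by simp
  also have "\<bar>(a - s) * z - s * (b - z)\<bar> \<le> \<bar>(a - s) * z\<bar> + \<bar>s * (b - z)\<bar>"
    by (rule abs_triangle_ineq4)
  also have "\<dots> = \<bar>a - s\<bar> * z + s * \<bar>b - z\<bar>"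
    using assms(4,5) by (simp add: abs_mult)
  also have "\<dots> \<le> (e1 * z) * z + (K * z) * (e2 * z)"
    using assms by (intro add_mono mult_mono) auto
  also have "\<dots> = (e1 + K * e2) * z\<^sup>2" by (simp add: power2_eq_square algebra_simps)
  finally have 1: "\<bar>a / b - s / z\<bar> \<le> (e1 + K * e2) * z\<^sup>2 / (b * z)"
    using assms(4) \<open>0 < b\<close> by (simp add: divide_right_mono)
  have "0 \<le> e1 * z" "0 \<le> K * z" using assms(1,5,6) by linarith+
  then have "0 \<le> e1" "0 \<le> K" using assms(4) by (simp_all add: zero_le_mult_iff)
  have "(e1 + K * e2) * z\<^sup>2 / (b * z) \<le> (e1 + K * e2) * z\<^sup>2 / (z / 2 * z)"
    using b assms(4,7) \<open>0 < b\<close> \<open>0 \<le> e1\<close> \<open>0 \<le> K\<close> by (intro divide_left_mono mult_right_mono) auto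
  also have "\<dots> = 2 * (e1 + K * e2)" using assms(4) by (simp add: power2_eq_square)
  finally show "\<bar>a / b - s / z\<bar> \<le> 2 * (e1 + K * e2)" using 1 by simp
qed

subsection \<open>Lipschitz continuous problems\<close>

context nepv
begin

lemma scf_run_exists:
  assumes "V \<in> stiefel"
  obtains R where "scf_run H R" "R 0 = V"
proof -
  define R where "R = rec_nat V (\<lambda>_ W. SOME W'. scf_step H W W')"
  have "scf_step H W (SOME W'. scf_step H W W')" for W
    by (rule scf_step_exists [OF H_herm card_le]) (rule someI)
  then have "scf_run H R" using assms by (simp add: scf_run_def R_def)
  then show thesis by (rule that) (simp add: R_def)
qed

lemma scf_run_stiefel: "scf_run H R \<Longrightarrow> R i \<in> stiefel"
  by (cases i) (auto simp: scf_run_def scf_step_def)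

lemma scf_run_tail: "scf_run H R \<Longrightarrow> scf_run H (\<lambda>i. R (j + i))"
  using scf_run_stiefel [of R j] by (simp add: scf_run_def)

lemma chart_representative_close:
  obtains K where "0 < K"
    "\<And>V. V \<in> stiefel \<Longrightarrow> chartable V \<Longrightarrow> norm (Zc V) \<le> 1 \<Longrightarrow>
      \<exists>Q\<in>stiefel. norm (V ** Q - (Vs + Vp ** Zc V)) \<le> K * (norm (Zc V))\<^sup>2"
proof -
  define K where "K = (norm Vs + norm Vp) * (real CARD('k))\<^sup>2 + 1"
  have "0 < K" by (simp add: K_def add_nonneg_pos)
  moreover have "\<exists>Q\<in>stiefel. norm (V ** Q - (Vs + Vp ** Zc V)) \<le> K * (norm (Zc V))\<^sup>2"
    if V: "V \<in> stiefel" "chartable V" "norm (Zc V) \<le> 1" for V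
  proof -
    obtain Q where Q: "Q \<in> stiefel"
      "norm (V ** Q - (Vs + Vp ** Zc V)) \<le> (norm Vs + norm Vp * norm (Zc V)) * ((real CARD('k))\<^sup>2 * (norm (Zc V))\<^sup>2)"
      by (rule chart_representative [OF V(1,2)])
    have "(norm Vs + norm Vp * norm (Zc V)) * ((real CARD('k))\<^sup>2 * (norm (Zc V))\<^sup>2) \<le>
      (norm Vs + norm Vp) * ((real CARD('k))\<^sup>2 * (norm (Zc V))\<^sup>2)"
      using V(3) by (intro mult_right_mono add_left_mono mult_left_le) auto
    also have "\<dots> \<le> K * (norm (Zc V))\<^sup>2" by (simp add: K_def algebra_simps)
    finally show ?thesis using Q by (intro bexI [of _ Q]) auto
  qed
  ultimately show thesis by (rule that)
qed

abbreviation at_chart :: "real \<Rightarrow> complex^'k^'n \<Rightarrow> bool" where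
  "at_chart r V \<equiv> V \<in> stiefel \<and> chartable V \<and> norm (Zc V) \<le> r"

text \<open>\<open>V\<close> itself may be far from \<open>Vs\<close> even when their ranges are
  close. Invariance replaces it by the rotated \<open>V ** Q\<close>, which lies within a multiple
  of \<open>norm (Zc V)\<close> of \<open>Vs\<close>.\<close>

lemma lipschitz_chart:
  assumes "lipschitz_at H Vs"
  obtains K \<delta> where "0 < K" "0 < \<delta>"
    "\<And>V. at_chart \<delta> V \<Longrightarrow> norm (H V - H Vs) \<le> K * norm (Zc V)"
proof -
  obtain a r where "0 < r" and ar: "\<And>V. dist V Vs < r \<Longrightarrow> norm (H V - H Vs) \<le> a * norm (V - Vs)"
    using assms unfolding lipschitz_at_def eventually_nhds_metric by blast
  obtain K where K: "0 < K" "\<And>V. V \<in> stiefel \<Longrightarrow> chartable V \<Longrightarrow> norm (Zc V) \<le> 1 \<Longrightarrow>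
      \<exists>Q\<in>stiefel. norm (V ** Q - (Vs + Vp ** Zc V)) \<le> K * (norm (Zc V))\<^sup>2"
    by (rule chart_representative_close) blast
  define b where "b = K + norm Vp"
  have "0 < b" using K(1) by (simp add: b_def add_pos_nonneg)
  define \<delta> where "\<delta> = min 1 (r / (2 * b))"
  have "0 < \<delta>" using \<open>0 < r\<close> \<open>0 < b\<close> by (simp add: \<delta>_def)
  moreover have "norm (H V - H Vs) \<le> (\<bar>a\<bar> * b + 1) * norm (Zc V)"
    if "at_chart \<delta> V" for V
  proof -
    have V: "V \<in> stiefel" "chartable V" "norm (Zc V) \<le> \<delta>" using that by auto
    have z: "norm (Zc V) \<le> 1" "norm (Zc V) * b \<le> r / 2"
      using V(3) \<open>0 < b\<close> by (auto simp: \<delta>_def field_simps)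
    obtain Q where Q: "Q \<in> stiefel" "norm (V ** Q - (Vs + Vp ** Zc V)) \<le> K * (norm (Zc V))\<^sup>2"
      using K(2) [OF V(1,2) z(1)] by blast
    have "V ** Q - Vs = (V ** Q - (Vs + Vp ** Zc V)) + Vp ** Zc V" by simp
    then have "norm (V ** Q - Vs) \<le> norm (V ** Q - (Vs + Vp ** Zc V)) + norm (Vp ** Zc V)"
      by (metis norm_triangle_ineq)
    also have "\<dots> \<le> K * (norm (Zc V))\<^sup>2 + norm Vp * norm (Zc V)"
      by (intro add_mono Q(2) norm_matrix_mult_le)
    also have "K * (norm (Zc V))\<^sup>2 \<le> K * norm (Zc V)"
      using K(1) z(1) by (intro mult_left_mono) (auto simp: power2_eq_square mult_left_le)
    finally have n: "norm (V ** Q - Vs) \<le> b * norm (Zc V)" by (simp add: b_def distrib_right)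
    then have "dist (V ** Q) Vs < r" using z(2) \<open>0 < r\<close> by (simp add: dist_norm mult.commute)
    then have "norm (H (V ** Q) - H Vs) \<le> a * norm (V ** Q - Vs)" by (rule ar)
    also have "\<dots> \<le> \<bar>a\<bar> * (b * norm (Zc V))" using n by (intro mult_mono) auto
    also have "\<dots> \<le> (\<bar>a\<bar> * b + 1) * norm (Zc V)" by (simp add: distrib_right)
    finally show ?thesis by (simp add: H_inv [OF Q(1)])
  qed
  moreover have "0 < \<bar>a\<bar> * b + 1" using \<open>0 < b\<close> by (simp add: add_nonneg_pos)
  ultimately show thesis using that by blast
qed

text \<open>Trades the error relative to \<open>Zc W\<close> for one relative to \<open>S V\<close>,
  which does not involve the successor.\<close>

lemma scf_step_near:
  assumes "lipschitz_at H Vs"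
  obtains K where "0 < K" "\<And>e. 0 < e \<Longrightarrow> \<exists>\<delta>>0. \<forall>V W. at_chart \<delta> V \<and> scf_step H V W \<longrightarrow>
     chartable W \<and> norm (Zc W - S V) \<le> e * norm (S V) \<and> norm (S V) \<le> K * norm (Zc V)"
proof -
  obtain K \<delta>0 where K: "0 < K" "0 < \<delta>0"
    "\<And>V. at_chart \<delta>0 V \<Longrightarrow> norm (H V - H Vs) \<le> K * norm (Zc V)"
    by (rule lipschitz_chart [OF assms]) blast
  obtain e0 C where C: "0 < e0" "0 < C"
    "\<And>V W. scf_step H V W \<Longrightarrow> norm (H V - H Vs) \<le> e0 \<Longrightarrow> chartable W \<and>
       norm (Zc W) \<le> C * norm (H V - H Vs) \<and>
       norm (Zc W - S V) \<le> C * norm (H V - H Vs) * norm (Zc W)"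
    by (rule scf_step_estimate) blast
  define K' where "K' = norm Vp * norm Vs / gam * K + 1"
  have "0 < K'" using K(1) gam_pos by (simp add: K'_def add_nonneg_pos)
  moreover have "\<exists>\<delta>>0. \<forall>V W. at_chart \<delta> V \<and> scf_step H V W \<longrightarrow>
     chartable W \<and> norm (Zc W - S V) \<le> e * norm (S V) \<and> norm (S V) \<le> K' * norm (Zc V)"
    if "0 < e" for e
  proof -
    \<comment> \<open>The bound 1/2 yields \<open>norm (Zc W) \<le> 2 * norm (S V)\<close>, and
      \<open>e / 2\<close> compensates that factor 2.\<close>
    define \<eta> where "\<eta> = min (e / 2) (1 / 2)"
    have "0 < \<eta>" using \<open>0 < e\<close> by (simp add: \<eta>_def)
    \<comment> \<open>The clauses ensure in turn the Lipschitz bound, the range of the step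
      estimate, and a relative error of at most \<open>\<eta>\<close>.\<close>
    define \<delta> where "\<delta> = min \<delta>0 (min (e0 / K) (\<eta> / (C * K)))"
    have "0 < \<delta>" using K C \<open>0 < \<eta>\<close> by (simp add: \<delta>_def)
    moreover have "chartable W \<and> norm (Zc W - S V) \<le> e * norm (S V) \<and> norm (S V) \<le> K' * norm (Zc V)"
      if V: "at_chart \<delta> V" and step: "scf_step H V W" for V W
    proof -
      define E where "E = norm (H V - H Vs)"
      have E: "E \<le> K * norm (Zc V)" using K(3) V by (simp add: E_def \<delta>_def)
      have "K * norm (Zc V) \<le> e0" "K * norm (Zc V) * C \<le> \<eta>"
        using V K(1) C(2) by (auto simp: \<delta>_def field_simps)
      moreover have "E * C \<le> K * norm (Zc V) * C" using E C(2) by (intro mult_right_mono) auto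
      ultimately have E': "E \<le> e0" "C * E \<le> \<eta>" using E by (simp_all add: mult.commute)
      have step': "chartable W" "norm (Zc W - S V) \<le> C * E * norm (Zc W)"
        using C(3) [OF step] E' by (auto simp: E_def)
      have "C * E * norm (Zc W) \<le> \<eta> * norm (Zc W)"
        using E'(2) by (intro mult_right_mono) auto
      then have n: "norm (Zc W - S V) \<le> \<eta> * norm (Zc W)" using step'(2) by linarith
      have "\<eta> * norm (Zc W) \<le> 1 / 2 * norm (Zc W)" by (intro mult_right_mono) (auto simp: \<eta>_def)
      then have "norm (Zc W) \<le> 2 * norm (S V)"
        using n norm_triangle_ineq2 [of "Zc W" "S V"] by linarith
      then have "\<eta> * norm (Zc W) \<le> e / 2 * (2 * norm (S V))"
        using \<open>0 < e\<close> by (intro mult_mono) (auto simp: \<eta>_def)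
      then have "norm (Zc W - S V) \<le> e * norm (S V)" using n by simp
      moreover have "norm (S V) \<le> norm Vp * norm Vs / gam * E" unfolding E_def by (rule S_le)
      then have "norm (S V) \<le> norm Vp * norm Vs / gam * (K * norm (Zc V))"
        using E gam_pos by (elim order_trans) (intro mult_left_mono, auto)
      then have "norm (S V) \<le> K' * norm (Zc V)" by (simp add: K'_def distrib_right add_increasing2)
      ultimately show ?thesis using step'(1) by blast
    qed
    ultimately show ?thesis by blast
  qed
  ultimately show thesis by (rule that)
qed

end

section \<open>Distance ratios and graph coordinates\<close>

context nepv_norm
begin

definition dist_bound :: real where "dist_bound = Nk.hi / Nk.lo * Nm.hi"

lemma dist_bound_pos: "0 < dist_bound"
  using Nk.hi(1) Nk.lo(1) Nm.hi(1) by (simp add: dist_bound_def)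

lemma d_le_norm:
  assumes "V \<in> stiefel" "chartable V"
  shows "d V \<le> dist_bound * norm (Zc V)"
proof -
  have "Nk.hi / Nk.lo * Nm (Zc V) \<le> Nk.hi / Nk.lo * (Nm.hi * norm (Zc V))"
    using Nk.hi(1) Nk.lo(1) Nm.hi(2) by (intro mult_left_mono) auto
  then show ?thesis using d_le_chart [OF assms] by (simp add: dist_bound_def)
qed

lemma Zc_nonzero: "V \<in> stiefel \<Longrightarrow> chartable V \<Longrightarrow> 0 < d V \<Longrightarrow> Zc V \<noteq> 0"
  using d_le_norm [of V] by force

lemma norm_le_of_Nm: "Nm Z \<le> r * Nm.lo \<Longrightarrow> norm Z \<le> r"
  using Nm.lo(2) [of Z] Nm.lo(1) by (metis mult.commute mult_le_cancel_left_pos order_trans)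

lemma chart_small:
  assumes "0 < e"
  shows "\<exists>\<delta>>0. \<forall>V\<in>stiefel. d V \<le> \<delta> \<longrightarrow> at_chart e V \<and> Nm (Zc V) \<le> 2 * d V"
proof -
  obtain \<delta> where \<delta>: "0 < \<delta>" "\<And>V. V \<in> stiefel \<Longrightarrow> d V \<le> \<delta> \<Longrightarrow> chartable V \<and> \<bar>d V - Nm (Zc V)\<bar> \<le> 1 / 2 * Nm (Zc V)"
    by (rule chart_distance [of "1 / 2"]) auto
  have "at_chart e V \<and> Nm (Zc V) \<le> 2 * d V"
    if V: "V \<in> stiefel" "d V \<le> min \<delta> (e * Nm.lo / 2)" for V
  proof -
    have c: "chartable V" "\<bar>d V - Nm (Zc V)\<bar> \<le> 1 / 2 * Nm (Zc V)" using \<delta>(2) V by auto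
    then have n: "Nm (Zc V) \<le> 2 * d V" by linarith
    then show ?thesis using V c(1) norm_le_of_Nm [of "Zc V" e] by simp
  qed
  then show ?thesis
    using \<delta>(1) assms Nm.lo(1) by (intro exI [of _ "min \<delta> (e * Nm.lo / 2)"]) auto
qed

lemma d_approx:
  assumes "0 < e"
  shows "\<exists>\<delta>>0. \<forall>V. at_chart \<delta> V \<longrightarrow> \<bar>d V - Nm (Zc V)\<bar> \<le> e * Nm (Zc V)"
proof -
  obtain \<delta> where \<delta>: "0 < \<delta>" "\<And>V. V \<in> stiefel \<Longrightarrow> d V \<le> \<delta> \<Longrightarrow> chartable V \<and> \<bar>d V - Nm (Zc V)\<bar> \<le> e * Nm (Zc V)"
    by (rule chart_distance [OF assms]) auto
  have "\<bar>d V - Nm (Zc V)\<bar> \<le> e * Nm (Zc V)" if V: "at_chart (\<delta> / dist_bound) V" for V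
  proof -
    have "d V \<le> dist_bound * norm (Zc V)" using V by (intro d_le_norm) auto
    also have "\<dots> \<le> \<delta>" using V dist_bound_pos by (simp add: field_simps)
    finally show ?thesis using \<delta>(2) V by blast
  qed
  then show ?thesis using \<delta>(1) dist_bound_pos by (intro exI [of _ "\<delta> / dist_bound"]) auto
qed

text \<open>\<open>Y\<close> is a model for the new coordinate: \<open>S V\<close> for one step of a
  Lipschitz problem, and a power of the linear part for several steps of a differentiable
  one.\<close>

lemma ratio_near:
  assumes "0 < e" "0 < B"
  shows "\<exists>\<eta>>0. \<exists>\<delta>>0. \<forall>V W Y. at_chart \<delta> V \<and> Zc V \<noteq> 0 \<and> W \<in> stiefel \<and> chartable W \<and>
      norm Y \<le> B * norm (Zc V) \<and> norm (Zc W - Y) \<le> \<eta> * norm (Zc V) \<longrightarrow>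
    0 < d V \<and> \<bar>d W / d V - Nm Y / Nm (Zc V)\<bar> \<le> e"
proof -
  define q where "q = Nm.hi / Nm.lo"
  have q: "0 < q" using Nm.hi(1) Nm.lo(1) by (simp add: q_def)
  define K where "K = q * B"
  have K: "0 < K" using q assms by (simp add: K_def)
  \<comment> \<open>\<open>M * \<eta>\<close> is the bound of \<open>ratio_perturb\<close> with
    errors \<open>\<eta> * (q + K + q)\<close> and \<open>\<eta>\<close>. In the former,
    \<open>q + K\<close> bounds \<open>Nm (Zc W)\<close> per unit of \<open>Nm (Zc V)\<close>, and
    the last \<open>q\<close> comes from replacing \<open>Zc W\<close> by \<open>Y\<close>.\<close>
  define M where "M = 2 * (q + K + q) + 2 * K"
  have "0 < M" using q K by (simp add: M_def)
  define \<eta> where "\<eta> = min (1 / 2) (e / M)"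
  have "\<eta> \<le> 1 / 2" "\<eta> \<le> e / M" unfolding \<eta>_def by (rule min.cobounded1, rule min.cobounded2)
  moreover have "0 < \<eta>" using \<open>0 < M\<close> \<open>0 < e\<close> by (simp add: \<eta>_def)
  moreover have "M * \<eta> \<le> e" using \<open>\<eta> \<le> e / M\<close> \<open>0 < M\<close> by (simp add: field_simps)
  ultimately have \<eta>: "0 < \<eta>" "\<eta> \<le> 1 / 2" "M * \<eta> \<le> e" by auto
  obtain \<delta>0 where \<delta>0: "0 < \<delta>0" "\<And>V. at_chart \<delta>0 V \<Longrightarrow> \<bar>d V - Nm (Zc V)\<bar> \<le> \<eta> * Nm (Zc V)"
    using d_approx [OF \<eta>(1)] by blast
  \<comment> \<open>The new coordinate is at most \<open>B + 1\<close> times the old one, and it has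
    to lie in the range of \<open>d_approx\<close> too.\<close>
  define \<delta> where "\<delta> = min \<delta>0 (\<delta>0 / (B + 1))"
  have "0 < \<delta>" using \<delta>0 assms by (simp add: \<delta>_def)
  moreover have "0 < d V \<and> \<bar>d W / d V - Nm Y / Nm (Zc V)\<bar> \<le> e"
    if V: "at_chart \<delta> V" "Zc V \<noteq> 0" and W: "W \<in> stiefel" "chartable W"
      and Y: "norm Y \<le> B * norm (Zc V)" "norm (Zc W - Y) \<le> \<eta> * norm (Zc V)" for V W Y
  proof -
    define Z where "Z = Zc V"
    have "\<eta> * norm Z \<le> 1 * norm Z" using \<eta> by (intro mult_right_mono) auto
    then have "norm (Zc W) \<le> (B + 1) * norm Z"
      using Y norm_triangle_ineq2 [of "Zc W" Y] by (simp add: Z_def algebra_simps)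
    also have "\<dots> \<le> \<delta>0" using V assms(2) by (simp add: \<delta>_def Z_def field_simps)
    finally have dW: "\<bar>d W - Nm (Zc W)\<bar> \<le> \<eta> * Nm (Zc W)" using \<delta>0(2) W by blast
    have dV: "\<bar>d V - Nm Z\<bar> \<le> \<eta> * Nm Z" using \<delta>0(2) [of V] V by (simp add: \<delta>_def Z_def)
    have a1: "\<bar>Nm (Zc W) - Nm Y\<bar> \<le> \<eta> * q * Nm Z"
      using Nm.N_diff [of "Zc W" Y] Nm.N_le [of "Zc W - Y" \<eta> Z] Y(2) \<eta>(1)
      by (simp add: Z_def q_def mult_ac)
    have YK: "Nm Y \<le> K * Nm Z" using Nm.N_le [of Y B Z] Y(1) assms(2) by (simp add: Z_def K_def q_def mult_ac)
    have "\<eta> * q * Nm Z \<le> 1 * q * Nm Z" using \<eta> q Nm.N_nonneg by (intro mult_right_mono) auto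
    then have "Nm (Zc W) \<le> (q + K) * Nm Z" using a1 YK by (simp add: distrib_right)
    then have "\<eta> * Nm (Zc W) \<le> \<eta> * ((q + K) * Nm Z)" using \<eta>(1) by (intro mult_left_mono) auto
    then have a: "\<bar>d W - Nm Y\<bar> \<le> (\<eta> * (q + K + q)) * Nm Z" using dW a1 by (simp add: algebra_simps)
    have pos: "0 < Nm Z" using V(2) by (simp add: Z_def Nm.N_pos)
    note r = ratio_perturb [OF a dV \<eta>(2) pos Nm.N_nonneg YK less_imp_le [OF \<eta>(1)]]
    have "\<bar>d W / d V - Nm Y / Nm Z\<bar> \<le> M * \<eta>" using r(2) by (simp add: M_def algebra_simps)
    then show ?thesis using r(1) \<eta>(3) by (simp add: Z_def)
  qed
  ultimately show ?thesis using \<eta>(1) by (intro exI [of _ \<eta>] exI [of _ \<delta>] conjI allI impI) blast+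
qed

lemma step_ratio:
  assumes lip: "lipschitz_at H Vs" and "0 < e"
  shows "\<exists>\<delta>>0. \<forall>V W. at_chart \<delta> V \<and> Zc V \<noteq> 0 \<and> scf_step H V W \<longrightarrow>
    0 < d V \<and> \<bar>d W / d V - Nm (S V) / Nm (Zc V)\<bar> \<le> e"
proof -
  obtain K where K: "0 < K" and near: "\<And>e. 0 < e \<Longrightarrow> \<exists>\<delta>>0. \<forall>V W. at_chart \<delta> V \<and> scf_step H V W \<longrightarrow>
     chartable W \<and> norm (Zc W - S V) \<le> e * norm (S V) \<and> norm (S V) \<le> K * norm (Zc V)"
    by (rule scf_step_near [OF lip]) blast
  obtain \<eta> \<delta>1 where \<eta>: "0 < \<eta>" "0 < \<delta>1"
    "\<And>V W Y. at_chart \<delta>1 V \<and> Zc V \<noteq> 0 \<and> W \<in> stiefel \<and> chartable W \<and>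
      norm Y \<le> K * norm (Zc V) \<and> norm (Zc W - Y) \<le> \<eta> * norm (Zc V) \<Longrightarrow>
    0 < d V \<and> \<bar>d W / d V - Nm Y / Nm (Zc V)\<bar> \<le> e"
    using ratio_near [OF \<open>0 < e\<close> K] by blast
  have "0 < \<eta> / K" using \<eta>(1) K by simp
  then obtain \<delta>2 where \<delta>2: "0 < \<delta>2" "\<And>V W. at_chart \<delta>2 V \<and> scf_step H V W \<Longrightarrow>
     chartable W \<and> norm (Zc W - S V) \<le> \<eta> / K * norm (S V) \<and> norm (S V) \<le> K * norm (Zc V)"
    using near [of "\<eta> / K"] by blast
  have "0 < d V \<and> \<bar>d W / d V - Nm (S V) / Nm (Zc V)\<bar> \<le> e"
    if V: "at_chart (min \<delta>1 \<delta>2) V" "Zc V \<noteq> 0" and step: "scf_step H V W" for V W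
  proof -
    have s: "chartable W" "norm (Zc W - S V) \<le> \<eta> / K * norm (S V)" "norm (S V) \<le> K * norm (Zc V)"
      using \<delta>2(2) [of V W] V step by auto
    have "\<eta> / K * norm (S V) \<le> \<eta> / K * (K * norm (Zc V))" using s(3) \<eta>(1) K by (intro mult_left_mono) auto
    also have "\<dots> = \<eta> * norm (Zc V)" using K by simp
    finally show ?thesis using \<eta>(3) [of V W "S V"] V s step by (auto simp: scf_step_def)
  qed
  then show ?thesis using \<eta>(2) \<delta>2(1) by (intro exI [of _ "min \<delta>1 \<delta>2"]) auto
qed

text \<open>A run is matched with its starting point, and a point with any run that starts there.
  Domination in each direction rests on the distance and the tangent norm becoming small
  together.\<close>

theorem eta_sup_lipschitz:
  assumes lip: "lipschitz_at H Vs"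
  shows "eta_sup Nk H Vs = Limsup_tan Nk Vs (\<lambda>V. ereal (Nm (S V) / Nk (tan_Theta V Vs)))"
    "eta_sup Nk H Vs < \<infinity>"
proof -
  let ?T = "{V \<in> stiefel. \<forall>j. angle V Vs j < pi / 2}"
  have tan: "at_chart r V \<and> Zc V \<noteq> 0 \<and> Nk (tan_Theta V Vs) = Nm (Zc V)"
    if "V \<in> ?T" "0 < Nk (tan_Theta V Vs)" "Nk (tan_Theta V Vs) < r * Nm.lo" for V r
  proof -
    have "V \<in> stiefel" "chartable V" using that(1) chartable_iff by auto
    then show ?thesis
      using that(2,3) Nk_tan_Theta norm_le_of_Nm [of "Zc V" r] Nm.N_zero [of "Zc V"] by auto
  qed
  show eq: "eta_sup Nk H Vs = Limsup_tan Nk Vs (\<lambda>V. ereal (Nm (S V) / Nk (tan_Theta V Vs)))"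
    unfolding eta_sup_def Limsup_tan_def
  proof (rule antisym; rule Limsup_dominated)
    fix e :: real assume "0 < e"
    obtain \<delta>1 where \<delta>1: "0 < \<delta>1" "\<And>V W. at_chart \<delta>1 V \<and> Zc V \<noteq> 0 \<and> scf_step H V W \<Longrightarrow>
      0 < d V \<and> \<bar>d W / d V - Nm (S V) / Nm (Zc V)\<bar> \<le> e"
      using step_ratio [OF lip \<open>0 < e\<close>] by blast
    obtain \<delta>2 where \<delta>2: "0 < \<delta>2" "\<And>V. V \<in> stiefel \<Longrightarrow> d V \<le> \<delta>2 \<Longrightarrow> at_chart \<delta>1 V \<and> Nm (Zc V) \<le> 2 * d V"
      using chart_small [OF \<delta>1(1)] by blast
    have "\<exists>V\<in>?T. 0 < Nk (tan_Theta V Vs) \<and> Nk (tan_Theta V Vs) < e \<and>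
        d (R 1) / d (R 0) \<le> Nm (S V) / Nk (tan_Theta V Vs) + e"
      if R: "scf_run H R" and small: "0 < d (R 0)" "d (R 0) < min \<delta>2 (e / 2)" for R
    proof -
      have st: "R 0 \<in> stiefel" by (rule scf_run_stiefel [OF R])
      have c: "at_chart \<delta>1 (R 0)" "Nm (Zc (R 0)) \<le> 2 * d (R 0)" using \<delta>2(2) [OF st] small by auto
      have "Zc (R 0) \<noteq> 0" using Zc_nonzero st c(1) small(1) by blast
      then show ?thesis
        using \<delta>1(2) [of "R 0" "R 1"] R c small chartable_iff [OF st] Nk_tan_Theta [OF st] Nm.N_pos
        by (intro bexI [of _ "R 0"]) (auto simp: scf_run_def abs_le_iff)
    qed
    then show "\<exists>\<delta>>0. \<forall>R\<in>{R. scf_run H R}. 0 < d (R 0) \<and> d (R 0) < \<delta> \<longrightarrow>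
      (\<exists>V\<in>?T. 0 < Nk (tan_Theta V Vs) \<and> Nk (tan_Theta V Vs) < e \<and>
        d (R 1) / d (R 0) \<le> Nm (S V) / Nk (tan_Theta V Vs) + e)"
      using \<delta>2(1) \<open>0 < e\<close> by (intro exI [of _ "min \<delta>2 (e / 2)"]) auto
  next
    fix e :: real assume "0 < e"
    obtain \<delta>1 where \<delta>1: "0 < \<delta>1" "\<And>V W. at_chart \<delta>1 V \<and> Zc V \<noteq> 0 \<and> scf_step H V W \<Longrightarrow>
      0 < d V \<and> \<bar>d W / d V - Nm (S V) / Nm (Zc V)\<bar> \<le> e"
      using step_ratio [OF lip \<open>0 < e\<close>] by blast
    define \<delta>2 where "\<delta>2 = min \<delta>1 (e / (2 * dist_bound))"
    have "0 < \<delta>2" using \<delta>1(1) \<open>0 < e\<close> dist_bound_pos by (simp add: \<delta>2_def)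
    have "\<exists>R\<in>{R. scf_run H R}. 0 < d (R 0) \<and> d (R 0) < e \<and>
        Nm (S V) / Nk (tan_Theta V Vs) \<le> d (R 1) / d (R 0) + e"
      if V: "V \<in> ?T" "0 < Nk (tan_Theta V Vs)" "Nk (tan_Theta V Vs) < \<delta>2 * Nm.lo" for V
    proof -
      have c: "at_chart \<delta>2 V" "Zc V \<noteq> 0" "Nk (tan_Theta V Vs) = Nm (Zc V)" using tan [OF V] by auto
      obtain R where R: "scf_run H R" "R 0 = V" by (rule scf_run_exists [of V]) (use c in auto)
      have "norm (Zc V) \<le> e / (2 * dist_bound)" using c(1) by (simp add: \<delta>2_def)
      then have "dist_bound * norm (Zc V) \<le> e / 2" using dist_bound_pos by (simp add: field_simps)
      then have "d V < e" using d_le_norm [of V] c(1) \<open>0 < e\<close> by auto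
      moreover have "0 < d V \<and> \<bar>d (R 1) / d V - Nm (S V) / Nm (Zc V)\<bar> \<le> e"
        using R c by (intro \<delta>1(2)) (auto simp: \<delta>2_def scf_run_def)
      ultimately show ?thesis
        using R c(3) by (intro bexI [of _ R]) (auto simp: abs_le_iff)
    qed
    then show "\<exists>\<delta>>0. \<forall>V\<in>?T. 0 < Nk (tan_Theta V Vs) \<and> Nk (tan_Theta V Vs) < \<delta> \<longrightarrow>
      (\<exists>R\<in>{R. scf_run H R}. 0 < d (R 0) \<and> d (R 0) < e \<and>
        Nm (S V) / Nk (tan_Theta V Vs) \<le> d (R 1) / d (R 0) + e)"
      using \<open>0 < \<delta>2\<close> Nm.lo(1) by (intro exI [of _ "\<delta>2 * Nm.lo"]) auto
  qed
  obtain K where K: "0 < K" and near: "\<And>e. 0 < e \<Longrightarrow> \<exists>\<delta>>0. \<forall>V W. at_chart \<delta> V \<and> scf_step H V W \<longrightarrow>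
     chartable W \<and> norm (Zc W - S V) \<le> e * norm (S V) \<and> norm (S V) \<le> K * norm (Zc V)"
    by (rule scf_step_near [OF lip]) blast
  obtain \<delta> where \<delta>: "0 < \<delta>" "\<And>V W. at_chart \<delta> V \<and> scf_step H V W \<Longrightarrow> norm (S V) \<le> K * norm (Zc V)"
    using near [of 1] by auto
  have "Limsup_tan Nk Vs (\<lambda>V. ereal (Nm (S V) / Nk (tan_Theta V Vs))) \<le> ereal (Nm.hi / Nm.lo * K)"
    unfolding Limsup_tan_def
  proof (rule Limsup_bounded, unfold eventually_inf_at_right, intro exI [of _ "\<delta> * Nm.lo"] conjI ballI impI)
    show "0 < \<delta> * Nm.lo" using \<delta>(1) Nm.lo(1) by simp
    fix V assume "V \<in> ?T" "0 < Nk (tan_Theta V Vs) \<and> Nk (tan_Theta V Vs) < \<delta> * Nm.lo"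
    then have c: "at_chart \<delta> V" "Zc V \<noteq> 0" "Nk (tan_Theta V Vs) = Nm (Zc V)"
      using tan [of V \<delta>] by auto
    \<comment> \<open>The bound on \<open>S V\<close> was proved in company with a step, so a
      successor has to be supplied.\<close>
    obtain W where "scf_step H V W" by (rule scf_step_exists [OF H_herm card_le])
    then have "norm (S V) \<le> K * norm (Zc V)" using \<delta>(2) c(1) by blast
    then have "Nm (S V) \<le> Nm.hi / Nm.lo * K * Nm (Zc V)" using K by (intro Nm.N_le) auto
    then show "ereal (Nm (S V) / Nk (tan_Theta V Vs)) \<le> ereal (Nm.hi / Nm.lo * K)"
      using Nm.N_pos [OF c(2)] c(3) by (simp add: pos_divide_le_eq)
  qed
  then show "eta_sup Nk H Vs < \<infinity>" unfolding eq by (rule order_le_less_trans) simp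
qed

end

section \<open>Differentiable problems\<close>

lemma linear_bound:
  fixes f :: "'a::euclidean_space \<Rightarrow> 'a"
  assumes "linear f"
  shows "\<exists>B>0. \<forall>x. norm (f x) \<le> norm x * B"
  using bounded_linear.pos_bounded [OF linear_conv_bounded_linear [THEN iffD1, OF assms]] .

text \<open>\<open>M x\<close> is the supremum of \<open>norm ((L ^^ k) x) / q ^ k\<close> over all
  \<open>k\<close>. Applying \<open>L\<close> shifts this sequence by one place, at the price of a
  factor \<open>q\<close>.\<close>

lemma adapted_norm:
  fixes L :: "'a::euclidean_space \<Rightarrow> 'a"
  assumes L: "linear L" and q: "real_spectral_radius L < q"
  obtains M C where "0 < C" "\<And>x. norm x \<le> M x" "\<And>x. M x \<le> C * norm x"
    "\<And>x y. M (x + y) \<le> M x + M y" "\<And>x. M (- x) = M x" "\<And>x. M (L x) \<le> q * M x"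
proof -
  have "0 < q" using real_spectral_radius_nonneg [of L] q by linarith
  obtain C where C: "0 < C" "\<And>k x. norm ((L ^^ k) x) \<le> C * q ^ k * norm x"
    by (rule power_bound_above_spectral_radius [OF L q]) blast
  define t where "t x k = norm ((L ^^ k) x) / q ^ k" for x k
  define M where "M x = (SUP k. t x k)" for x
  have t_le: "t x k \<le> C * norm x" for x k
    using C(2) [of k x] \<open>0 < q\<close> by (simp add: t_def pos_divide_le_eq mult_ac)
  then have bdd: "bdd_above (range (t x))" for x by (intro bdd_aboveI2)
  have up: "t x k \<le> M x" for x k unfolding M_def using bdd by (intro cSUP_upper) auto
  have least: "M x \<le> c" if "\<And>k. t x k \<le> c" for x c
    unfolding M_def using that by (intro cSUP_least) auto
  have lin: "linear (L ^^ k)" for k by (rule linear_funpow [OF L])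
  show thesis
  proof
    show "0 < C" by (rule C)
    show "norm x \<le> M x" for x using up [of x 0] by (simp add: t_def)
    show "M x \<le> C * norm x" for x by (rule least) (rule t_le)
    show "M (x + y) \<le> M x + M y" for x y
    proof (rule least)
      fix k
      have "t (x + y) k \<le> t x k + t y k"
        unfolding t_def linear_add [OF lin] add_divide_distrib [symmetric]
        using \<open>0 < q\<close> by (intro divide_right_mono norm_triangle_ineq) auto
      then show "t (x + y) k \<le> M x + M y" using up [of x k] up [of y k] by linarith
    qed
    show "M (- x) = M x" for x
      by (simp add: M_def t_def linear_neg [OF lin])
    show "M (L x) \<le> q * M x" for x
    proof (rule least)
      fix k
      have "t (L x) k = q * t x (Suc k)"
        using \<open>0 < q\<close> by (simp add: t_def funpow_swap1)
      then show "t (L x) k \<le> q * M x" using up [of x "Suc k"] \<open>0 < q\<close> by simp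
    qed
  qed
qed

text \<open>An error \<open>e ^ m\<close> in a ratio costs only \<open>e\<close> after the root,
  even where the ratio is near 0 and the root is steep.\<close>

lemma root_add_power_le:
  assumes "0 < m" "0 \<le> a" "0 \<le> (e::real)"
  shows "root m (a + e ^ m) \<le> root m a + e"
proof -
  have pow: "x ^ n + y ^ n \<le> (x + y) ^ n" if "0 \<le> x" "0 \<le> y" "0 < n" for x y :: real and n :: nat
    using \<open>0 < n\<close>
  proof (induction n rule: nat_induct_non_zero)
    case (Suc n)
    have "x ^ Suc n + y ^ Suc n \<le> (x + y) * (x ^ n + y ^ n)"
      using that by (simp add: algebra_simps)
    also have "\<dots> \<le> (x + y) * (x + y) ^ n"
      using Suc that by (intro mult_left_mono) auto
    finally show ?case by simp
  qed simp
  have "a + e ^ m = (root m a) ^ m + e ^ m" using assms by simp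
  also have "\<dots> \<le> (root m a + e) ^ m" using assms by (intro pow) auto
  finally have "root m (a + e ^ m) \<le> root m ((root m a + e) ^ m)" using assms by simp
  also have "\<dots> = root m a + e" using assms by (simp add: real_root_power_cancel)
  finally show ?thesis .
qed

text \<open>A matrix is a finite sum of bounded linear images of its entries.\<close>

lemma matrix_has_derivative_componentwise:
  fixes F :: "'a::real_normed_vector \<Rightarrow> complex^'c^'r"
  assumes "\<And>i j. ((\<lambda>x. F x $ i $ j) has_derivative f i j) (at x)"
  shows "(F has_derivative (\<lambda>v. \<chi> i j. f i j v)) (at x)"
proof -
  have E: "(\<chi> i j. a i j) = (\<Sum>i\<in>UNIV. \<Sum>j\<in>UNIV. axis i (axis j (a i j)))" for a :: "'r \<Rightarrow> 'c \<Rightarrow> complex"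
  proof (rule matrix_eqI)
    fix r c
    have "axis i (axis j (a i j)) $ r $ c = (if i = r then if j = c then a i j else 0 else 0)" for i j
      by (simp add: axis_def)
    then show "(\<chi> i j. a i j) $ r $ c = (\<Sum>i\<in>UNIV. \<Sum>j\<in>UNIV. axis i (axis j (a i j))) $ r $ c"
      by (simp add: if_distrib [of "\<lambda>x. sum x _"] if_distribR sum.If_cases cong: if_cong)
  qed
  have bl: "bounded_linear (\<lambda>z. axis i (axis j z) :: complex^'c^'r)" for i j
    by (intro linear_conv_bounded_linear [THEN iffD1] linearI)
      (auto simp: Finite_Cartesian_Product.vec_eq_iff axis_def)
  have "((\<lambda>x. axis i (axis j (F x $ i $ j)) :: complex^'c^'r) has_derivative
      (\<lambda>v. axis i (axis j (f i j v)))) (at x)" for i j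
    by (rule bounded_linear.has_derivative [OF bl assms])
  then have "((\<lambda>x. \<Sum>i\<in>UNIV. \<Sum>j\<in>UNIV. axis i (axis j (F x $ i $ j)) :: complex^'c^'r) has_derivative
      (\<lambda>v. \<Sum>i\<in>UNIV. \<Sum>j\<in>UNIV. axis i (axis j (f i j v)))) (at x)"
    by (intro has_derivative_sum)
  moreover have "(\<lambda>x. \<Sum>i\<in>UNIV. \<Sum>j\<in>UNIV. axis i (axis j (F x $ i $ j))) = F"
  proof
    fix y
    have "(\<chi> i j. F y $ i $ j) = F y" by (rule matrix_eqI) simp
    then show "(\<Sum>i\<in>UNIV. \<Sum>j\<in>UNIV. axis i (axis j (F y $ i $ j))) = F y"
      using E [of "\<lambda>i j. F y $ i $ j"] by (rule trans [OF sym, rotated])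
  qed
  moreover have "(\<lambda>v. \<Sum>i\<in>UNIV. \<Sum>j\<in>UNIV. axis i (axis j (f i j v))) = (\<lambda>v. \<chi> i j. f i j v)"
    by (rule ext) (rule E [symmetric])
  ultimately show ?thesis by (simp only:)
qed

lemma smooth_near_has_derivative:
  assumes "smooth_near H V"
  obtains H' where "(H has_derivative H') (at V)"
proof -
  obtain U where U: "V \<in> U"
    "\<forall>i j. \<exists>h'. (\<forall>V\<in>U. ((\<lambda>W. H W $ i $ j) has_derivative h' V) (at V)) \<and>
        (\<forall>X. continuous_on U (\<lambda>V. h' V X))"
    using assms unfolding smooth_near_def by blast
  define h where "h i j = (SOME h. ((\<lambda>W. H W $ i $ j) has_derivative h) (at V))" for i j
  have "((\<lambda>W. H W $ i $ j) has_derivative h i j) (at V)" for i j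
  proof -
    obtain h' where "\<forall>V\<in>U. ((\<lambda>W. H W $ i $ j) has_derivative h' V) (at V)"
      using U(2) by blast
    then have "\<exists>h. ((\<lambda>W. H W $ i $ j) has_derivative h) (at V)" using U(1) by blast
    then show ?thesis unfolding h_def by (rule someI_ex)
  qed
  then have "(H has_derivative (\<lambda>v. \<chi> i j. h i j v)) (at V)"
    by (rule matrix_has_derivative_componentwise)
  then show thesis by (rule that)
qed

lemma has_derivative_lipschitz_at:
  assumes "(H has_derivative H') (at V)"
  shows "lipschitz_at H V"
proof -
  obtain B where B: "\<And>x. norm (H' x) \<le> norm x * B"
    using bounded_linear.bounded [OF has_derivative_bounded_linear [OF assms]] by blast
  have "\<exists>r>0. \<forall>y. norm (y - V) < r \<longrightarrow> norm (H y - H V - H' (y - V)) \<le> 1 * norm (y - V)"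
    using assms [unfolded has_derivative_at_alt, THEN conjunct2, THEN spec, of 1] by simp
  then obtain r where r: "r > 0" "\<And>y. norm (y - V) < r \<Longrightarrow> norm (H y - H V - H' (y - V)) \<le> 1 * norm (y - V)"
    by blast
  have "norm (H y - H V) \<le> (B + 1) * norm (y - V)" if "dist y V < r" for y
    using r(2) [of y] B [of "y - V"] norm_triangle_ineq2 [of "H y - H V" "H' (y - V)"] that
    by (simp add: dist_norm algebra_simps)
  then show ?thesis
    unfolding lipschitz_at_def eventually_nhds_metric using r(1) by blast
qed

lemma dir_deriv_eq:
  assumes "(H has_derivative H') (at V)"
  shows "dir_deriv H V X = H' X"
proof -
  have "((\<lambda>t::real. V + t *\<^sub>R X) has_derivative (\<lambda>t. t *\<^sub>R X)) (at 0)"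
    by (auto intro!: derivative_eq_intros)
  moreover have "(H has_derivative H') (at (V + 0 *\<^sub>R X))" using assms by simp
  ultimately have "((\<lambda>t::real. H (V + t *\<^sub>R X)) has_derivative (\<lambda>t. H' (t *\<^sub>R X))) (at 0)"
    by (rule has_derivative_compose)
  then have "((\<lambda>t::real. H (V + t *\<^sub>R X)) has_vector_derivative H' X) (at 0)"
    unfolding has_vector_derivative_def
    using linear_scale [OF has_derivative_linear [OF assms]] by simp
  then show ?thesis unfolding dir_deriv_def by (rule vector_derivative_at)
qed

locale nepv_diff = nepv_norm H Vs Vp Nk Nm
  for H :: "complex^'k^'n \<Rightarrow> complex^'n^'n" and Vs :: "complex^'k^'n" and Vp :: "complex^'m^'n"
    and Nk :: "complex^'k^'k \<Rightarrow> real" and Nm :: "complex^'k^'m \<Rightarrow> real" +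
  fixes H' :: "complex^'k^'n \<Rightarrow> complex^'n^'n"
  assumes deriv: "(H has_derivative H') (at Vs)"
begin

definition LL :: "complex^'k^'m \<Rightarrow> complex^'k^'m" where "LL = scf_L H Vs Vp"

lemma LL_eq: "LL Z = hadamard G (Vp\<^sup>H ** H' (Vp ** Z) ** Vs)"
  by (simp add: LL_def scf_L_def dir_deriv_eq [OF deriv])

lemma linear_H': "linear H'" by (rule has_derivative_linear [OF deriv])

lemma linear_LL: "linear LL"
proof
  fix X Y :: "complex^'k^'m" and r :: real
  show "LL (X + Y) = LL X + LL Y"
    by (simp add: LL_eq matrix_add_ldistrib matrix_add_rdistrib linear_add [OF linear_H'] hadamard_add)
  have s: "A ** (r *\<^sub>R B) = r *\<^sub>R (A ** B)" "(r *\<^sub>R B) ** C = r *\<^sub>R (B ** C)"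
    for A :: "complex^'x^'y" and B :: "complex^'z^'x" and C :: "complex^'w^'z"
    by (rule matrix_eqI, simp add: matrix_matrix_mult_def scaleR_sum_right)+
  show "LL (r *\<^sub>R X) = r *\<^sub>R LL X"
    by (simp add: LL_eq s linear_scale [OF linear_H'] hadamard_scaleR)
qed

lemma lip: "lipschitz_at H Vs" by (rule has_derivative_lipschitz_at [OF deriv])

text \<open>The minus sign arises because \<open>S V\<close> contains \<open>H Vs - H V\<close>. The
  rotated representative differs from \<open>Vs\<close> by \<open>Vp ** Zc V\<close> plus a
  remainder of second order, so the derivative at \<open>Vs\<close> sees only the former to first
  order.\<close>

lemma S_linearization:
  assumes "0 < e"
  shows "\<exists>\<delta>>0. \<forall>V. at_chart \<delta> V \<longrightarrow> norm (S V + LL (Zc V)) \<le> e * norm (Zc V)"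
proof -
  obtain K where K: "0 < K" "\<And>V. V \<in> stiefel \<Longrightarrow> chartable V \<Longrightarrow> norm (Zc V) \<le> 1 \<Longrightarrow>
      \<exists>Q\<in>stiefel. norm (V ** Q - (Vs + Vp ** Zc V)) \<le> K * (norm (Zc V))\<^sup>2"
    by (rule chart_representative_close) blast
  obtain B where B: "0 < B" "\<And>x. norm (H' x) \<le> norm x * B"
    using bounded_linear.pos_bounded [OF has_derivative_bounded_linear [OF deriv]] by blast
  define b where "b = K + norm Vp"
  have "0 < b" using K(1) by (simp add: b_def add_pos_nonneg)
  define a where "a = norm Vp * norm Vs / gam + 1"
  have "0 < a" using gam_pos by (simp add: a_def add_nonneg_pos)
  \<comment> \<open>Tolerance for the derivative remainder: after the factors \<open>a\<close> and
    \<open>b\<close> it contributes \<open>e / 2\<close>.\<close>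
  define e1 where "e1 = e / (2 * a * b)"
  have "0 < e1" using \<open>0 < e\<close> \<open>0 < a\<close> \<open>0 < b\<close> by (simp add: e1_def)
  then obtain r where r: "0 < r" "\<And>y. norm (y - Vs) < r \<Longrightarrow> norm (H y - H Vs - H' (y - Vs)) \<le> e1 * norm (y - Vs)"
    using deriv [unfolded has_derivative_at_alt, THEN conjunct2, THEN spec, of e1] by blast
  \<comment> \<open>The clauses give a close representative, place it in the range of the
    derivative, and limit the second-order remainder to the other \<open>e / 2\<close>.\<close>
  define \<delta> where "\<delta> = min 1 (min (r / (2 * b)) (e / (2 * a * (B * K))))"
  have "0 < \<delta>" using r(1) \<open>0 < b\<close> \<open>0 < e\<close> \<open>0 < a\<close> B(1) K(1) by (simp add: \<delta>_def)
  moreover have "norm (S V + LL (Zc V)) \<le> e * norm (Zc V)"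
    if "at_chart \<delta> V" for V
  proof -
    have V: "V \<in> stiefel" "chartable V" "norm (Zc V) \<le> \<delta>" using that by auto
    define z where "z = norm (Zc V)"
    have "z \<le> 1" "z \<le> r / (2 * b)" "z \<le> e / (2 * a * (B * K))"
      using V(3) by (auto simp: \<delta>_def z_def)
    moreover have "0 \<le> z" by (simp add: z_def)
    moreover have "b * z \<le> r / 2" using \<open>z \<le> r / (2 * b)\<close> \<open>0 < b\<close> by (simp add: field_simps)
    moreover have "a * (B * K * z) \<le> e / 2"
      using \<open>z \<le> e / (2 * a * (B * K))\<close> \<open>0 < a\<close> B(1) K(1) by (simp add: field_simps)
    ultimately have z: "0 \<le> z" "z \<le> 1" "b * z \<le> r / 2" "a * (B * K * z) \<le> e / 2" by auto
    obtain Q where Q: "Q \<in> stiefel" "norm (V ** Q - (Vs + Vp ** Zc V)) \<le> K * z\<^sup>2"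
      using K(2) [OF V(1,2)] z(2) by (auto simp: z_def)
    define Y where "Y = V ** Q - Vs"
    define R where "R = Y - Vp ** Zc V"
    have R: "norm R \<le> K * z\<^sup>2" using Q(2) by (simp add: R_def Y_def diff_diff_eq)
    have "Y = R + Vp ** Zc V" by (simp add: R_def)
    then have "norm Y \<le> norm R + norm (Vp ** Zc V)" by (simp add: norm_triangle_ineq)
    also have "\<dots> \<le> K * z\<^sup>2 + norm Vp * z"
      unfolding z_def by (intro add_mono R [unfolded z_def] norm_matrix_mult_le)
    also have "K * z\<^sup>2 \<le> K * z" using K(1) z by (intro mult_left_mono) (auto simp: power2_eq_square mult_left_le)
    finally have Y: "norm Y \<le> b * z" by (simp add: b_def distrib_right)
    then have "norm Y < r" using z(3) r(1) by linarith
    then have "norm (H (V ** Q) - H Vs - H' Y) \<le> e1 * norm Y" using r(2) [of "V ** Q"] by (simp add: Y_def)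
    also have "\<dots> \<le> e1 * (b * z)" using Y \<open>0 < e1\<close> by (intro mult_left_mono) auto
    finally have 1: "norm (H V - H Vs - H' Y) \<le> e1 * (b * z)" by (simp add: H_inv [OF Q(1)])
    have "H' Y = H' R + H' (Vp ** Zc V)"
      by (subst \<open>Y = R + Vp ** Zc V\<close>) (rule linear_add [OF linear_H'])
    moreover have "norm (H' R) \<le> K * z\<^sup>2 * B"
      using B(2) [of R] R B(1) mult_right_mono [OF R, of B] by linarith
    ultimately have 2: "norm (H V - H Vs - H' (Vp ** Zc V)) \<le> e1 * (b * z) + K * z\<^sup>2 * B"
      using 1 norm_triangle_ineq [of "H V - H Vs - H' Y" "H' R"] by (simp add: algebra_simps)
    define D where "D = H V - H Vs - H' (Vp ** Zc V)"
    have "S V + LL (Zc V) = hadamard G (Vp\<^sup>H ** (- D) ** Vs)"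
      by (simp add: scf_S_def LL_eq D_def matrix_diff_ldistrib matrix_diff_rdistrib
          matrix_mult_minus matrix_minus_mult hadamard_diff hadamard_add hadamard_minus)
    then have "norm (S V + LL (Zc V)) \<le> norm (Vp\<^sup>H ** (- D) ** Vs) / gam"
      by (simp only: norm_gap_hadamard_le)
    also have "\<dots> \<le> norm Vp * norm D * norm Vs / gam"
      using norm_matrix_mult3_le [of "Vp\<^sup>H" "- D" Vs] gam_pos by (intro divide_right_mono) auto
    also have "\<dots> \<le> a * norm D" by (simp add: a_def field_simps)
    also have "\<dots> \<le> a * (e1 * (b * z) + K * z\<^sup>2 * B)"
      using 2 \<open>0 < a\<close> by (intro mult_left_mono) (auto simp: D_def)
    also have "\<dots> = a * e1 * b * z + a * (B * K * z) * z" by (simp add: power2_eq_square algebra_simps)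
    also have "\<dots> \<le> e / 2 * z + e / 2 * z"
      using z \<open>0 < a\<close> \<open>0 < b\<close> by (intro add_mono mult_right_mono) (auto simp: e1_def)
    finally show ?thesis by (simp add: z_def)
  qed
  ultimately show ?thesis by blast
qed

lemma linear_step:
  assumes "0 < e"
  shows "\<exists>\<delta>>0. \<forall>V W. at_chart \<delta> V \<and> scf_step H V W \<longrightarrow>
     chartable W \<and> norm (Zc W + LL (Zc V)) \<le> e * norm (Zc V)"
proof -
  obtain K where K: "0 < K" and near: "\<And>e. 0 < e \<Longrightarrow> \<exists>\<delta>>0. \<forall>V W. at_chart \<delta> V \<and> scf_step H V W \<longrightarrow>
     chartable W \<and> norm (Zc W - S V) \<le> e * norm (S V) \<and> norm (S V) \<le> K * norm (Zc V)"
    by (rule scf_step_near [OF lip]) blast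
  have "0 < e / (2 * K)" using assms K by simp
  obtain \<delta>1 where \<delta>1: "0 < \<delta>1" "\<And>V W. at_chart \<delta>1 V \<Longrightarrow> scf_step H V W \<Longrightarrow>
     chartable W \<and> norm (Zc W - S V) \<le> e / (2 * K) * norm (S V) \<and> norm (S V) \<le> K * norm (Zc V)"
    using near [OF \<open>0 < e / (2 * K)\<close>] by blast
  obtain \<delta>2 where \<delta>2: "0 < \<delta>2" "\<And>V. at_chart \<delta>2 V \<Longrightarrow> norm (S V + LL (Zc V)) \<le> e / 2 * norm (Zc V)"
    using S_linearization [of "e / 2"] assms by auto
  have "chartable W \<and> norm (Zc W + LL (Zc V)) \<le> e * norm (Zc V)"
    if V: "at_chart (min \<delta>1 \<delta>2) V" and step: "scf_step H V W" for V W
  proof -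
    have 1: "chartable W" "norm (Zc W - S V) \<le> e / (2 * K) * norm (S V)" "norm (S V) \<le> K * norm (Zc V)"
      using \<delta>1(2) [OF _ step] V by auto
    have "e / (2 * K) * norm (S V) \<le> e / (2 * K) * (K * norm (Zc V))"
      using 1(3) assms K by (intro mult_left_mono) auto
    also have "\<dots> = e / 2 * norm (Zc V)" using K by simp
    finally have "norm (Zc W - S V) \<le> e / 2 * norm (Zc V)" using 1(2) by linarith
    moreover have "norm (S V + LL (Zc V)) \<le> e / 2 * norm (Zc V)" using \<delta>2(2) V by simp
    ultimately have "norm (Zc W + LL (Zc V)) \<le> e / 2 * norm (Zc V) + e / 2 * norm (Zc V)"
      using norm_triangle_ineq [of "Zc W - S V" "S V + LL (Zc V)"] by simp
    with 1(1) show ?thesis by simp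
  qed
  then show ?thesis using \<delta>1(1) \<delta>2(1) by (intro exI [of _ "min \<delta>1 \<delta>2"]) auto
qed

section \<open>Linearization of several steps\<close>

definition FF :: "complex^'k^'m \<Rightarrow> complex^'k^'m" where "FF Z = - LL Z"

lemma linear_FF: "linear FF"
  unfolding FF_def [abs_def] by (intro linear_compose_neg linear_LL)

lemma FF_pow: "(FF ^^ m) Z = (-1) ^ m *\<^sub>R (LL ^^ m) Z"
  by (induction m) (simp_all add: FF_def linear_scale [OF linear_LL])

text \<open>The iteration follows the negative of the operator in the theorem, a sign that no norm
  detects.\<close>

lemma Nm_FF_pow: "Nm ((FF ^^ m) Z) = Nm ((LL ^^ m) Z)"
  by (simp add: FF_pow Nm.N_hom power_abs)

text \<open>The radius depends on \<open>m\<close>. This suffices because the number of steps is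
  held fixed while the starting point tends to the solution.\<close>

lemma run_linearization:
  assumes "0 < e"
  shows "\<exists>\<delta>>0. \<forall>R. scf_run H R \<and> at_chart \<delta> (R 0) \<longrightarrow>
     chartable (R m) \<and> norm (Zc (R m) - (FF ^^ m) (Zc (R 0))) \<le> e * norm (Zc (R 0))"
  using assms
proof (induction m arbitrary: e)
  case 0
  then show ?case by (intro exI [of _ 1]) auto
next
  case (Suc m)
  obtain B where B: "0 < B" "\<And>x. norm (FF x) \<le> norm x * B"
    using linear_bound [OF linear_FF] by blast
  obtain B' where B': "0 < B'" "\<And>x. norm ((FF ^^ m) x) \<le> norm x * B'"
    using linear_bound [OF linear_funpow [OF linear_FF]] by blast
  \<comment> \<open>The inherited error is multiplied by \<open>B\<close> in the last step, and the
    error of that step scales with a coordinate of size at most \<open>B' + 1\<close> times the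
    first; each receives \<open>e / 2\<close>. The minimum with 1 justifies that size.\<close>
  define e1 where "e1 = min 1 (e / (2 * B))"
  define e2 where "e2 = e / (2 * (B' + 1))"
  have e: "0 < e1" "0 < e2" using \<open>0 < e\<close> B B' by (auto simp: e1_def e2_def)
  obtain \<delta>1 where \<delta>1: "0 < \<delta>1" "\<And>R. scf_run H R \<Longrightarrow> at_chart \<delta>1 (R 0) \<Longrightarrow>
     chartable (R m) \<and> norm (Zc (R m) - (FF ^^ m) (Zc (R 0))) \<le> e1 * norm (Zc (R 0))"
    using Suc.IH [OF e(1)] by blast
  obtain \<delta>2 where \<delta>2: "0 < \<delta>2" "\<And>V W. at_chart \<delta>2 V \<Longrightarrow> scf_step H V W \<Longrightarrow>
     chartable W \<and> norm (Zc W + LL (Zc V)) \<le> e2 * norm (Zc V)"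
    using linear_step [OF e(2)] by blast
  define \<delta> where "\<delta> = min \<delta>1 (\<delta>2 / (B' + 1))"
  have "0 < \<delta>" using \<delta>1 \<delta>2 B' by (simp add: \<delta>_def)
  moreover have "chartable (R (Suc m)) \<and> norm (Zc (R (Suc m)) - (FF ^^ Suc m) (Zc (R 0))) \<le> e * norm (Zc (R 0))"
    if R: "scf_run H R" "at_chart \<delta> (R 0)" for R
  proof -
    define z where "z = norm (Zc (R 0))"
    have m: "chartable (R m)" "norm (Zc (R m) - (FF ^^ m) (Zc (R 0))) \<le> e1 * z"
      using \<delta>1(2) [OF R(1)] R(2) by (auto simp: \<delta>_def z_def)
    have "e1 * z \<le> 1 * z" by (intro mult_right_mono) (auto simp: e1_def z_def)
    then have n: "norm (Zc (R m)) \<le> (B' + 1) * z"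
      using m(2) B'(2) [of "Zc (R 0)"] norm_triangle_ineq2 [of "Zc (R m)" "(FF ^^ m) (Zc (R 0))"]
      by (simp add: z_def algebra_simps)
    also have "(B' + 1) * z \<le> \<delta>2" using R(2) B'(1) by (simp add: \<delta>_def z_def field_simps)
    finally have small: "norm (Zc (R m)) \<le> \<delta>2" .
    have step: "scf_step H (R m) (R (Suc m))" using R(1) by (simp add: scf_run_def)
    have s: "chartable (R (Suc m))" "norm (Zc (R (Suc m)) + LL (Zc (R m))) \<le> e2 * norm (Zc (R m))"
      using \<delta>2(2) [OF _ step] scf_run_stiefel [OF R(1)] m(1) small by auto
    have "e2 * norm (Zc (R m)) \<le> e2 * ((B' + 1) * z)" using n e(2) by (intro mult_left_mono) auto
    also have "e2 * ((B' + 1) * z) = e / 2 * z" using B'(1) by (simp add: e2_def field_simps)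
    finally have a: "norm (Zc (R (Suc m)) - FF (Zc (R m))) \<le> e / 2 * z"
      using s(2) by (simp add: FF_def)
    have "FF (Zc (R m)) - (FF ^^ Suc m) (Zc (R 0)) = FF (Zc (R m) - (FF ^^ m) (Zc (R 0)))"
      by (simp add: linear_diff [OF linear_FF])
    then have "norm (FF (Zc (R m)) - (FF ^^ Suc m) (Zc (R 0))) \<le> norm (Zc (R m) - (FF ^^ m) (Zc (R 0))) * B"
      using B(2) by simp
    also have "\<dots> \<le> e1 * z * B" using m(2) B(1) by (intro mult_right_mono) auto
    also have "\<dots> \<le> e / (2 * B) * z * B" using B(1) by (intro mult_right_mono) (auto simp: e1_def z_def)
    also have "\<dots> = e / 2 * z" using B(1) by simp
    finally have b: "norm (FF (Zc (R m)) - (FF ^^ Suc m) (Zc (R 0))) \<le> e / 2 * z" .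
    have "norm (Zc (R (Suc m)) - (FF ^^ Suc m) (Zc (R 0))) \<le>
      norm (Zc (R (Suc m)) - FF (Zc (R m))) + norm (FF (Zc (R m)) - (FF ^^ Suc m) (Zc (R 0)))"
      using norm_triangle_ineq [of "Zc (R (Suc m)) - FF (Zc (R m))" "FF (Zc (R m)) - (FF ^^ Suc m) (Zc (R 0))"]
      by simp
    then show ?thesis using a b s(1) by (simp add: z_def)
  qed
  ultimately show ?case by blast
qed

section \<open>Contraction factors of a differentiable problem\<close>

lemma run_ratio:
  assumes "0 < e"
  shows "\<exists>\<delta>>0. \<forall>R. scf_run H R \<and> at_chart \<delta> (R 0) \<and> Zc (R 0) \<noteq> 0 \<longrightarrow>
    0 < d (R 0) \<and> \<bar>d (R m) / d (R 0) - Nm ((LL ^^ m) (Zc (R 0))) / Nm (Zc (R 0))\<bar> \<le> e"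
proof -
  obtain B where B: "0 < B" "\<And>x. norm ((FF ^^ m) x) \<le> norm x * B"
    using linear_bound [OF linear_funpow [OF linear_FF]] by blast
  obtain \<eta> \<delta>1 where \<eta>: "0 < \<eta>" "0 < \<delta>1"
    "\<And>V W Y. at_chart \<delta>1 V \<and> Zc V \<noteq> 0 \<and> W \<in> stiefel \<and> chartable W \<and>
      norm Y \<le> B * norm (Zc V) \<and> norm (Zc W - Y) \<le> \<eta> * norm (Zc V) \<Longrightarrow>
    0 < d V \<and> \<bar>d W / d V - Nm Y / Nm (Zc V)\<bar> \<le> e"
    using ratio_near [OF \<open>0 < e\<close> B(1)] by blast
  obtain \<delta>2 where \<delta>2: "0 < \<delta>2" "\<And>R. scf_run H R \<and> at_chart \<delta>2 (R 0) \<Longrightarrow>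
     chartable (R m) \<and> norm (Zc (R m) - (FF ^^ m) (Zc (R 0))) \<le> \<eta> * norm (Zc (R 0))"
    using run_linearization [OF \<eta>(1)] by blast
  have "0 < d (R 0) \<and> \<bar>d (R m) / d (R 0) - Nm ((LL ^^ m) (Zc (R 0))) / Nm (Zc (R 0))\<bar> \<le> e"
    if R: "scf_run H R" "at_chart (min \<delta>1 \<delta>2) (R 0)" "Zc (R 0) \<noteq> 0" for R
    using \<eta>(3) [of "R 0" "R m" "(FF ^^ m) (Zc (R 0))"] \<delta>2(2) [of R] B(2) [of "Zc (R 0)"] R
      scf_run_stiefel [OF R(1), of m] by (simp add: Nm_FF_pow mult.commute)
  then show ?thesis using \<eta>(2) \<delta>2(1) by (intro exI [of _ "min \<delta>1 \<delta>2"]) auto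
qed

text \<open>The ratio for the linear map is unchanged when \<open>Z\<close> is scaled, so every
  nonzero \<open>Z\<close> is represented by starting points arbitrarily close to the
  solution.\<close>

lemma eta_sup_m_eq:
  assumes "0 < m"
  shows "eta_sup_m m Nk H Vs = (SUP Z\<in>{Z. Z \<noteq> 0}. ereal (root m (Nm ((LL ^^ m) Z) / Nm Z)))"
  unfolding eta_sup_m_def
proof (rule Limsup_eq_SUP)
  fix e :: real assume "0 < e"
  then have "0 < e ^ m" by simp
  then obtain \<delta>1 where \<delta>1: "0 < \<delta>1" "\<And>R. scf_run H R \<and> at_chart \<delta>1 (R 0) \<and> Zc (R 0) \<noteq> 0 \<Longrightarrow>
    0 < d (R 0) \<and> \<bar>d (R m) / d (R 0) - Nm ((LL ^^ m) (Zc (R 0))) / Nm (Zc (R 0))\<bar> \<le> e ^ m"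
    using run_ratio [OF \<open>0 < e ^ m\<close>] by blast
  obtain \<delta>2 where \<delta>2: "0 < \<delta>2" "\<And>V. V \<in> stiefel \<Longrightarrow> d V \<le> \<delta>2 \<Longrightarrow> at_chart \<delta>1 V"
    using chart_small [OF \<delta>1(1)] by blast
  show "\<exists>\<delta>>0. \<forall>R\<in>{V. scf_run H V}. 0 < d (R 0) \<and> d (R 0) < \<delta> \<longrightarrow>
      (\<exists>Z\<in>{Z. Z \<noteq> 0}. root m (d (R m) / d (R 0)) \<le> root m (Nm ((LL ^^ m) Z) / Nm Z) + e)"
  proof (intro exI [of _ \<delta>2] conjI ballI impI \<delta>2(1))
    fix R assume "R \<in> {V. scf_run H V}" and small: "0 < d (R 0) \<and> d (R 0) < \<delta>2"
    then have R: "scf_run H R" by simp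
    note st = scf_run_stiefel [OF R, of 0]
    have c: "at_chart \<delta>1 (R 0)" using \<delta>2(2) [OF st] small by auto
    have nz: "Zc (R 0) \<noteq> 0" using Zc_nonzero c small by blast
    have "d (R m) / d (R 0) \<le> Nm ((LL ^^ m) (Zc (R 0))) / Nm (Zc (R 0)) + e ^ m"
      using \<delta>1(2) [of R] R c nz by (auto simp: abs_le_iff)
    then have "root m (d (R m) / d (R 0)) \<le> root m (Nm ((LL ^^ m) (Zc (R 0))) / Nm (Zc (R 0)) + e ^ m)"
      using assms by simp
    also have "\<dots> \<le> root m (Nm ((LL ^^ m) (Zc (R 0))) / Nm (Zc (R 0))) + e"
      using assms \<open>0 < e\<close> by (intro root_add_power_le) (auto simp: Nm.N_nonneg)
    finally show "\<exists>Z\<in>{Z. Z \<noteq> 0}. root m (d (R m) / d (R 0)) \<le> root m (Nm ((LL ^^ m) Z) / Nm Z) + e"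
      using nz by blast
  qed
next
  fix Z :: "complex^'k^'m" and e \<delta> :: real assume "Z \<in> {Z. Z \<noteq> 0}" "0 < e" "0 < \<delta>"
  then have "Z \<noteq> 0" "0 < e ^ m" by auto
  obtain \<delta>1 where \<delta>1: "0 < \<delta>1" "\<And>R. scf_run H R \<and> at_chart \<delta>1 (R 0) \<and> Zc (R 0) \<noteq> 0 \<Longrightarrow>
    0 < d (R 0) \<and> \<bar>d (R m) / d (R 0) - Nm ((LL ^^ m) (Zc (R 0))) / Nm (Zc (R 0))\<bar> \<le> e ^ m"
    using run_ratio [OF \<open>0 < e ^ m\<close>] by blast
  \<comment> \<open>Scales \<open>Z\<close> into the range of the linearization and makes the
    distance at most half of \<open>\<delta>\<close>, which secures a strict inequality.\<close>
  define t where "t = min (\<delta>1 / norm Z) (\<delta> / (2 * dist_bound * norm Z))"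
  have "0 < t" using \<delta>1(1) \<open>0 < \<delta>\<close> dist_bound_pos \<open>Z \<noteq> 0\<close> by (simp add: t_def)
  have "t \<le> \<delta>1 / norm Z" "t \<le> \<delta> / (2 * dist_bound * norm Z)"
    unfolding t_def by (rule min.cobounded1, rule min.cobounded2)
  then have t: "t * norm Z \<le> \<delta>1" "dist_bound * (t * norm Z) \<le> \<delta> / 2"
    using \<open>Z \<noteq> 0\<close> dist_bound_pos by (simp_all add: field_simps)
  obtain V where V: "V \<in> stiefel" "chartable V" "Zc V = t *\<^sub>R Z" by (rule chart_surj)
  obtain R where R: "scf_run H R" "R 0 = V" by (rule scf_run_exists [OF V(1)])
  have r: "0 < d V" "\<bar>d (R m) / d V - Nm ((LL ^^ m) (Zc V)) / Nm (Zc V)\<bar> \<le> e ^ m"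
    using \<delta>1(2) [of R] R V \<open>0 < t\<close> \<open>Z \<noteq> 0\<close> t(1) by auto
  have "d V < \<delta>" using d_le_norm [OF V(1,2)] t(2) \<open>0 < t\<close> \<open>0 < \<delta>\<close> by (simp add: V(3))
  have "Nm ((LL ^^ m) (Zc V)) / Nm (Zc V) = Nm ((LL ^^ m) Z) / Nm Z"
    using \<open>0 < t\<close> by (simp add: V(3) linear_scale [OF linear_funpow [OF linear_LL]] Nm.N_hom)
  then have "Nm ((LL ^^ m) Z) / Nm Z \<le> d (R m) / d V + e ^ m" using r(2) by (simp add: abs_le_iff)
  then have "root m (Nm ((LL ^^ m) Z) / Nm Z) \<le> root m (d (R m) / d V + e ^ m)" using assms by simp
  also have "\<dots> \<le> root m (d (R m) / d V) + e"
    using assms \<open>0 < e\<close> r(1) by (intro root_add_power_le) (auto simp: d_nonneg)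
  finally show "\<exists>R\<in>{V. scf_run H V}. 0 < d (R 0) \<and> d (R 0) < \<delta> \<and>
      root m (Nm ((LL ^^ m) Z) / Nm Z) \<le> root m (d (R m) / d (R 0)) + e"
    using R r(1) \<open>d V < \<delta>\<close> by (intro bexI [of _ R]) auto
qed

lemma eta_sup_eq: "eta_sup Nk H Vs = op_norm Nm LL"
proof -
  have "eta_sup Nk H Vs = eta_sup_m 1 Nk H Vs"
    by (simp add: eta_sup_def eta_sup_m_def)
  then show ?thesis by (simp add: eta_sup_m_eq op_norm_def)
qed

abbreviation rho :: real where "rho \<equiv> real_spectral_radius LL"

text \<open>Gelfand's formula: the constants of the power bound and of the norm equivalence stand
  under an m-th root and tend to 1. In the lower bound the vector may change with \<open>m\<close>,
  as each \<open>eta_sup_m\<close> is a supremum over all vectors.\<close>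

lemma eta_sup_inf_eq: "eta_sup_inf Nk H Vs = ereal rho"
proof (rule antisym)
  have rho0: "0 \<le> rho" by (rule real_spectral_radius_nonneg)
  define c where "c = Nm.hi / Nm.lo"
  have "0 < c" using Nm.hi(1) Nm.lo(1) by (simp add: c_def)
  show "eta_sup_inf Nk H Vs \<le> ereal rho"
  proof (rule ereal_le_epsilon2)
    fix e :: real assume "0 < e"
    define q where "q = rho + e / 2"
    have q: "rho < q" using \<open>0 < e\<close> by (simp add: q_def)
    obtain C where C: "0 < C" "\<And>k x. norm ((LL ^^ k) x) \<le> C * q ^ k * norm x"
      by (rule power_bound_above_spectral_radius [OF linear_LL q]) blast
    have "0 < q" using q rho0 by linarith
    have "(\<lambda>m. root m (c * C) * q) \<longlonglongrightarrow> 1 * q"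
      using \<open>0 < c\<close> C(1) by (intro tendsto_mult LIMSEQ_root_const tendsto_const) simp
    then have "eventually (\<lambda>m. root m (c * C) * q < rho + e) sequentially"
      using \<open>0 < e\<close> by (intro order_tendstoD(2)) (auto simp: q_def)
    then have "eventually (\<lambda>m. eta_sup_m m Nk H Vs \<le> ereal rho + ereal e) sequentially"
      using eventually_gt_at_top [of "0::nat"]
    proof eventually_elim
      case (elim m)
      have "root m (Nm ((LL ^^ m) Z) / Nm Z) \<le> rho + e" if "Z \<noteq> 0" for Z
      proof -
        have pos: "0 < Nm Z" using \<open>Z \<noteq> 0\<close> by (rule Nm.N_pos)
        have "Nm ((LL ^^ m) Z) \<le> c * (C * q ^ m) * Nm Z"
          unfolding c_def using C \<open>0 < q\<close> by (intro Nm.N_le) auto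
        then have "Nm ((LL ^^ m) Z) / Nm Z \<le> c * C * q ^ m"
          using pos by (simp add: pos_divide_le_eq mult_ac)
        then have "root m (Nm ((LL ^^ m) Z) / Nm Z) \<le> root m (c * C * q ^ m)" using elim by simp
        also have "\<dots> = root m (c * C) * q"
          using elim \<open>0 < q\<close> by (simp add: real_root_mult real_root_power_cancel)
        finally show ?thesis using elim by simp
      qed
      then show ?case unfolding eta_sup_m_eq [OF elim(2)] by (intro SUP_least) simp
    qed
    then show "eta_sup_inf Nk H Vs \<le> ereal rho + ereal e"
      unfolding eta_sup_inf_def by (rule Limsup_bounded)
  qed
  have "1 / c > 0" using \<open>0 < c\<close> by simp
  have low: "eventually (\<lambda>m. ereal (root m (1 / c) * rho) \<le> eta_sup_m m Nk H Vs) sequentially"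
    using eventually_gt_at_top [of "0::nat"]
  proof eventually_elim
    case (elim m)
    obtain Z where Z: "Z \<noteq> 0" "rho ^ m * norm Z \<le> norm ((LL ^^ m) Z)"
      by (rule power_bound_below_spectral_radius [OF linear_LL])
    have pos: "0 < Nm Z" using \<open>Z \<noteq> 0\<close> by (rule Nm.N_pos)
    have "norm (rho ^ m *\<^sub>R Z) \<le> 1 * norm ((LL ^^ m) Z)" using Z(2) rho0 by simp
    then have "Nm (rho ^ m *\<^sub>R Z) \<le> c * 1 * Nm ((LL ^^ m) Z)" unfolding c_def by (rule Nm.N_le) simp
    then have "1 / c * rho ^ m \<le> Nm ((LL ^^ m) Z) / Nm Z"
      using pos \<open>0 < c\<close> rho0 by (simp add: Nm.N_hom field_simps)
    then have "root m (1 / c * rho ^ m) \<le> root m (Nm ((LL ^^ m) Z) / Nm Z)" using elim by simp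
    moreover have "root m (1 / c * rho ^ m) = root m (1 / c) * rho"
      using elim rho0 unfolding real_root_mult by (simp add: real_root_power_cancel)
    ultimately have "ereal (root m (1 / c) * rho) \<le> ereal (root m (Nm ((LL ^^ m) Z) / Nm Z))" by simp
    also have "\<dots> \<le> eta_sup_m m Nk H Vs"
      unfolding eta_sup_m_eq [OF elim] using Z(1) by (intro SUP_upper) simp
    finally show ?case .
  qed
  have "(\<lambda>m. root m (1 / c) * rho) \<longlonglongrightarrow> 1 * rho"
    using \<open>0 < 1 / c\<close> by (intro tendsto_mult LIMSEQ_root_const tendsto_const)
  then have "(\<lambda>m. ereal (root m (1 / c) * rho)) \<longlonglongrightarrow> ereal rho"
    by (simp add: tendsto_ereal)
  then have "limsup (\<lambda>m. ereal (root m (1 / c) * rho)) = ereal rho"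
    by (rule lim_imp_Limsup [OF trivial_limit_sequentially])
  then have "ereal rho = limsup (\<lambda>m. ereal (root m (1 / c) * rho))" ..
  also have "\<dots> \<le> eta_sup_inf Nk H Vs"
    unfolding eta_sup_inf_def using low by (rule Limsup_mono)
  finally show "ereal rho \<le> eta_sup_inf Nk H Vs" .
qed

text \<open>Powers of \<open>LL\<close> are bounded by powers of its operator norm, so each averaged
  factor obeys the bound individually.\<close>

lemma eta_sup_inf_le: "eta_sup_inf Nk H Vs \<le> op_norm Nm LL"
  unfolding eta_sup_inf_def
proof (rule Limsup_bounded)
  show "eventually (\<lambda>m. eta_sup_m m Nk H Vs \<le> op_norm Nm LL) sequentially"
    using eventually_gt_at_top [of "0::nat"]
  proof eventually_elim
    case (elim m)
    show ?case
    proof (cases "op_norm Nm LL")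
      case (real b)
      have le1: "Nm (LL Z) \<le> b * Nm Z" for Z
      proof (cases "Z = 0")
        case False
        then have "ereal (Nm (LL Z) / Nm Z) \<le> ereal b"
          unfolding real [symmetric] op_norm_def by (intro SUP_upper) simp
        then show ?thesis using Nm.N_pos [OF False] by (simp add: pos_divide_le_eq)
      qed (use Nm.N_zero [of 0] in \<open>simp add: linear_0 [OF linear_LL]\<close>)
      \<comment> \<open>The exponent 0 merely supplies a nonzero matrix, needed to see that the
        bound \<open>b\<close> is not negative.\<close>
      obtain Z0 where Z0: "Z0 \<noteq> (0 :: complex^'k^'m)" using power_bound_below_spectral_radius [OF linear_LL, of 0] by blast
      have "0 \<le> b * Nm Z0" using le1 [of Z0] Nm.N_nonneg [of "LL Z0"] by linarith
      then have b: "0 \<le> b" using Nm.N_pos [OF Z0] by (simp add: zero_le_mult_iff)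
      have pow: "Nm ((LL ^^ k) Z) \<le> b ^ k * Nm Z" for k Z
      proof (induction k)
        case (Suc k)
        have "Nm ((LL ^^ Suc k) Z) \<le> b * Nm ((LL ^^ k) Z)" using le1 by simp
        also have "\<dots> \<le> b * (b ^ k * Nm Z)" using Suc b by (intro mult_left_mono)
        finally show ?case by simp
      qed simp
      have "root m (Nm ((LL ^^ m) Z) / Nm Z) \<le> b" if "Z \<noteq> 0" for Z
      proof -
        have "Nm ((LL ^^ m) Z) / Nm Z \<le> b ^ m" using pow [of m Z] Nm.N_pos [OF that] by (simp add: pos_divide_le_eq)
        then have "root m (Nm ((LL ^^ m) Z) / Nm Z) \<le> root m (b ^ m)" using elim by simp
        then show ?thesis using elim b by (simp add: real_root_power_cancel)
      qed
      then show ?thesis unfolding eta_sup_m_eq [OF elim] real by (intro SUP_least) simp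
    next
      case MInf
      obtain Z0 where Z0: "Z0 \<noteq> (0 :: complex^'k^'m)" using power_bound_below_spectral_radius [OF linear_LL, of 0] by blast
      have "ereal (Nm (LL Z0) / Nm Z0) \<le> op_norm Nm LL"
        unfolding op_norm_def using Z0 by (intro SUP_upper) simp
      with MInf show ?thesis by simp
    qed simp
  qed
qed

section \<open>Local convergence\<close>

lemma local_contraction:
  assumes q: "rho < q" "q < 1"
  obtains \<delta> C where "0 < \<delta>" "0 < C" "\<And>R i. scf_run H R \<Longrightarrow> at_chart \<delta> (R 0) \<Longrightarrow>
    chartable (R i) \<and> norm (Zc (R i)) \<le> C * q ^ i * norm (Zc (R 0))"
proof -
  define q0 where "q0 = (rho + q) / 2"
  have q0: "rho < q0" "q0 < q" using q by (auto simp: q0_def)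
  have "0 < q" using q real_spectral_radius_nonneg [of LL] by linarith
  obtain M C where C: "0 < C" and M: "\<And>x. norm x \<le> M x" "\<And>x. M x \<le> C * norm x"
    "\<And>x y. M (x + y) \<le> M x + M y" "\<And>x. M (- x) = M x" "\<And>x. M (LL x) \<le> q0 * M x"
    by (rule adapted_norm [OF linear_LL q0(1)]) blast
  \<comment> \<open>The nonlinear error, measured in the adapted norm, uses up exactly the slack
    between \<open>q0\<close> and \<open>q\<close>.\<close>
  define e where "e = (q - q0) / C"
  have "0 < e" using q0 C by (simp add: e_def)
  then obtain \<delta>1 where \<delta>1: "0 < \<delta>1" "\<And>V W. at_chart \<delta>1 V \<Longrightarrow> scf_step H V W \<Longrightarrow>
     chartable W \<and> norm (Zc W + LL (Zc V)) \<le> e * norm (Zc V)"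
    using linear_step [OF \<open>0 < e\<close>] by blast
  have step: "chartable W \<and> M (Zc W) \<le> q * M (Zc V)"
    if V: "at_chart \<delta>1 V" and s: "scf_step H V W" for V W
  proof -
    have 1: "chartable W" "norm (Zc W + LL (Zc V)) \<le> e * norm (Zc V)" using \<delta>1(2) [OF V s] by auto
    have "M (Zc W) \<le> M (Zc W + LL (Zc V)) + M (- LL (Zc V))"
      using M(3) [of "Zc W + LL (Zc V)" "- LL (Zc V)"] by simp
    also have "\<dots> \<le> C * (e * norm (Zc V)) + q0 * M (Zc V)"
    proof (rule add_mono)
      have "C * norm (Zc W + LL (Zc V)) \<le> C * (e * norm (Zc V))"
        using 1(2) C by (intro mult_left_mono) auto
      then show "M (Zc W + LL (Zc V)) \<le> C * (e * norm (Zc V))"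
        using M(2) [of "Zc W + LL (Zc V)"] by linarith
      show "M (- LL (Zc V)) \<le> q0 * M (Zc V)" using M(4,5) by simp
    qed
    also have "C * (e * norm (Zc V)) = (q - q0) * norm (Zc V)" using C by (simp add: e_def)
    also have "\<dots> \<le> (q - q0) * M (Zc V)" using M(1) q0 by (intro mult_left_mono) auto
    finally show ?thesis using 1(1) by (simp add: algebra_simps)
  qed
  \<comment> \<open>The adapted norm decreases, the Euclidean norm need not. Starting within
    \<open>\<delta>1 / C\<close> keeps the adapted norm, and with it the Euclidean one, below
    \<open>\<delta>1\<close> throughout.\<close>
  have main: "chartable (R i) \<and> M (Zc (R i)) \<le> q ^ i * M (Zc (R 0))"
    if R: "scf_run H R" "at_chart (\<delta>1 / C) (R 0)" for R i
  proof (induction i)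
    case (Suc i)
    have "norm (Zc (R i)) \<le> M (Zc (R i))" by (rule M)
    also have "\<dots> \<le> q ^ i * M (Zc (R 0))" using Suc by simp
    also have "\<dots> \<le> 1 * M (Zc (R 0))"
      using \<open>0 < q\<close> q(2) norm_ge_zero order_trans [OF norm_ge_zero M(1)]
      by (intro mult_right_mono) (auto intro: power_le_one)
    also have "\<dots> \<le> C * norm (Zc (R 0))" using M(2) by simp
    also have "\<dots> \<le> \<delta>1" using R(2) C by (simp add: field_simps)
    finally have small: "norm (Zc (R i)) \<le> \<delta>1" .
    have "chartable (R (Suc i)) \<and> M (Zc (R (Suc i))) \<le> q * M (Zc (R i))"
      using Suc small R(1) scf_run_stiefel [OF R(1)] by (intro step) (auto simp: scf_run_def)
    moreover have "q * M (Zc (R i)) \<le> q * (q ^ i * M (Zc (R 0)))"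
      using Suc \<open>0 < q\<close> by (intro mult_left_mono) auto
    ultimately show ?case by simp
  qed (use R in auto)
  show thesis
  proof
    show "0 < \<delta>1 / C" "0 < C" using \<delta>1(1) C by auto
    fix R i assume R: "scf_run H R" "at_chart (\<delta>1 / C) (R 0)"
    have "norm (Zc (R i)) \<le> q ^ i * M (Zc (R 0))" using main [OF R, of i] M(1) order_trans by blast
    also have "\<dots> \<le> q ^ i * (C * norm (Zc (R 0)))" using M(2) \<open>0 < q\<close> by (intro mult_left_mono) auto
    finally show "chartable (R i) \<and> norm (Zc (R i)) \<le> C * q ^ i * norm (Zc (R 0))"
      using main [OF R, of i] by (simp add: mult_ac)
  qed
qed

lemma local_decay:
  assumes q: "rho < q" "q < 1"
  shows "\<exists>\<epsilon>>0. \<forall>R. scf_run H R \<and> d (R 0) \<le> \<epsilon> \<longrightarrow> (\<exists>K>0. \<forall>i. d (R i) \<le> K * q ^ i)"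
proof -
  obtain \<delta> C where C: "0 < \<delta>" "0 < C" "\<And>R i. scf_run H R \<Longrightarrow> at_chart \<delta> (R 0) \<Longrightarrow>
    chartable (R i) \<and> norm (Zc (R i)) \<le> C * q ^ i * norm (Zc (R 0))"
    by (rule local_contraction [OF q]) blast
  have "0 < q" using q real_spectral_radius_nonneg [of LL] by linarith
  obtain \<epsilon> where \<epsilon>: "0 < \<epsilon>" "\<And>V. V \<in> stiefel \<Longrightarrow> d V \<le> \<epsilon> \<Longrightarrow> at_chart \<delta> V"
    using chart_small [OF C(1)] by blast
  have "\<exists>K>0. \<forall>i. d (R i) \<le> K * q ^ i" if R: "scf_run H R" "d (R 0) \<le> \<epsilon>" for R
  proof (intro exI [of _ "dist_bound * (C * \<delta>)"] conjI allI)
    show "0 < dist_bound * (C * \<delta>)" using dist_bound_pos C by simp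
    fix i
    have 0: "at_chart \<delta> (R 0)" using \<epsilon>(2) [OF scf_run_stiefel [OF R(1)] R(2)] by auto
    have i: "chartable (R i)" "norm (Zc (R i)) \<le> C * q ^ i * norm (Zc (R 0))" using C(3) [OF R(1) 0] by auto
    have "d (R i) \<le> dist_bound * norm (Zc (R i))"
      by (rule d_le_norm [OF scf_run_stiefel [OF R(1)] i(1)])
    also have "\<dots> \<le> dist_bound * (C * q ^ i * \<delta>)"
      using 0 C dist_bound_pos \<open>0 < q\<close> by (intro mult_left_mono order_trans [OF i(2)]) auto
    finally show "d (R i) \<le> dist_bound * (C * \<delta>) * q ^ i" by (simp add: mult_ac)
  qed
  then show ?thesis using \<epsilon>(1) by blast
qed

lemma decay_tendsto:
  assumes "0 < q" "q < (1::real)" "\<And>i. d (R i) \<le> K * q ^ i"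
  shows "(\<lambda>i. d (R i)) \<longlonglongrightarrow> 0"
proof (rule tendsto_sandwich [of "\<lambda>_. 0" _ _ "\<lambda>i. K * q ^ i"])
  show "(\<lambda>i. K * q ^ i) \<longlonglongrightarrow> 0"
    using assms by (intro tendsto_mult_right_zero LIMSEQ_power_zero) simp
qed (use assms d_nonneg in auto)

lemma convergence:
  assumes "rho < 1"
  shows "locally_convergent Nk H Vs" "avg_rate_bounded Nk H Vs rho"
proof -
  define q where "q = (rho + 1) / 2"
  have q: "rho < q" "q < 1" "0 < q"
    using assms real_spectral_radius_nonneg [of LL] by (auto simp: q_def)
  obtain \<epsilon> where \<epsilon>: "0 < \<epsilon>" "\<And>R. scf_run H R \<Longrightarrow> d (R 0) \<le> \<epsilon> \<Longrightarrow> \<exists>K>0. \<forall>i. d (R i) \<le> K * q ^ i"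
    using local_decay [OF q(1,2)] by blast
  have lim: "(\<lambda>i. d (R i)) \<longlonglongrightarrow> 0" if "scf_run H R" "d (R 0) \<le> \<epsilon>" for R
    using \<epsilon>(2) [OF that] decay_tendsto [OF q(3,2)] by blast
  then show "locally_convergent Nk H Vs"
    unfolding locally_convergent_def using \<epsilon>(1) by blast
  have "limsup (\<lambda>m. ereal (root m (d (R m)))) \<le> ereal rho" if R: "scf_run H R" "d (R 0) \<le> \<epsilon>" for R
  proof (rule ereal_le_epsilon2)
    fix e :: real assume "0 < e"
    define q' where "q' = min q (rho + e / 2)"
    have q': "rho < q'" "q' < 1" "q' < rho + e" using q \<open>0 < e\<close> by (auto simp: q'_def min_def)
    have "0 < q'" using q' real_spectral_radius_nonneg [of LL] by linarith
    \<comment> \<open>The radius for the rate \<open>q'\<close> shrinks with \<open>e\<close>,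
      whereas \<open>\<epsilon>\<close> must be chosen beforehand. The run converges at the fixed
      rate \<open>q\<close>, so it eventually enters the smaller neighbourhood, and the better rate
      is read off its tail.\<close>
    obtain \<epsilon>' where \<epsilon>': "0 < \<epsilon>'" "\<And>R. scf_run H R \<Longrightarrow> d (R 0) \<le> \<epsilon>' \<Longrightarrow> \<exists>K>0. \<forall>i. d (R i) \<le> K * q' ^ i"
      using local_decay [OF q'(1,2)] by blast
    have "eventually (\<lambda>i. d (R i) < \<epsilon>') sequentially"
      using lim [OF R] \<epsilon>'(1) by (rule order_tendstoD(2))
    then obtain j where j: "d (R j) < \<epsilon>'" by (auto simp: eventually_sequentially)
    obtain K where K: "0 < K" "\<And>i. d (R (j + i)) \<le> K * q' ^ i"
      using \<epsilon>'(2) [OF scf_run_tail [OF R(1)], of j] j by auto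
    \<comment> \<open>Absorbs the \<open>j\<close> steps made before the better rate
      applies.\<close>
    define K' where "K' = K / q' ^ j"
    have "0 < K'" using K(1) \<open>0 < q'\<close> by (simp add: K'_def)
    have "(\<lambda>m. root m K' * q') \<longlonglongrightarrow> 1 * q'"
      using \<open>0 < K'\<close> by (intro tendsto_mult LIMSEQ_root_const tendsto_const)
    then have "eventually (\<lambda>m. root m K' * q' < rho + e) sequentially"
      using q'(3) by (intro order_tendstoD(2)) auto
    then have "eventually (\<lambda>m. ereal (root m (d (R m))) \<le> ereal rho + ereal e) sequentially"
      using eventually_ge_at_top [of "j + 1"]
    proof eventually_elim
      case (elim m)
      then have "0 < m" "j \<le> m" by auto
      have "d (R m) \<le> K * q' ^ (m - j)" using K(2) [of "m - j"] \<open>j \<le> m\<close> by simp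
      also have "\<dots> = K' * q' ^ m" using \<open>j \<le> m\<close> \<open>0 < q'\<close> by (simp add: K'_def power_diff)
      finally have "root m (d (R m)) \<le> root m (K' * q' ^ m)" using \<open>0 < m\<close> by simp
      also have "\<dots> = root m K' * q'"
        using \<open>0 < m\<close> \<open>0 < q'\<close> by (simp add: real_root_mult real_root_power_cancel)
      finally show ?case using elim by simp
    qed
    then show "limsup (\<lambda>m. ereal (root m (d (R m)))) \<le> ereal rho + ereal e"
      by (rule Limsup_bounded)
  qed
  then show "avg_rate_bounded Nk H Vs rho"
    unfolding avg_rate_bounded_def using \<epsilon>(1) by blast
qed

section \<open>Local divergence\<close>

lemma divergence:
  assumes "1 < rho"
  shows "locally_divergent Nk H Vs"
proof -
  obtain b :: "'m \<times> 'k \<times> bool \<Rightarrow> complex^'k^'m" where b: "bij_betw b UNIV Basis"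
    by (rule complex_matrix_basis)
  obtain B c where B: "bounded_bilinear B" and c: "1 < c"
    and Stein: "\<And>x. B (LL x) (LL x) = c * B x x + (norm x)\<^sup>2" and "\<exists>x. B x x > (0::real)"
    by (rule expanding_form [OF linear_LL b assms]) blast
  interpret B: bounded_bilinear B by (rule B)
  obtain x where x: "B x x > 0" using \<open>\<exists>x. B x x > 0\<close> by blast
  obtain K where K: "0 < K" "\<And>x y. \<bar>B x y\<bar> \<le> norm x * norm y * K"
    using B.pos_bounded by auto
  obtain l where l: "0 < l" "\<And>x. norm (LL x) \<le> norm x * l"
    using linear_bound [OF linear_LL] by blast
  \<comment> \<open>Chosen so that the terms involving the error amount to at most
    \<open>(norm z)\<^sup>2\<close>: two mixed terms of size \<open>l * e * K\<close> and one pure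
    term of size \<open>e * K\<close>, the latter because \<open>e \<le> 1\<close>.\<close>
  define e where "e = min 1 (1 / (K * (2 * l + 1)))"
  have "0 < e" using K l by (simp add: e_def)
  have e: "e \<le> 1" "e * (K * (2 * l + 1)) \<le> 1"
  proof -
    have "e \<le> 1 / (K * (2 * l + 1))" unfolding e_def by (rule min.cobounded2)
    then show "e * (K * (2 * l + 1)) \<le> 1" using K l by (simp add: pos_le_divide_eq)
  qed (simp add: e_def)
  obtain \<delta> where \<delta>: "0 < \<delta>" "\<And>V W. at_chart \<delta> V \<Longrightarrow> scf_step H V W \<Longrightarrow>
     chartable W \<and> norm (Zc W + LL (Zc V)) \<le> e * norm (Zc V)"
    using linear_step [OF \<open>0 < e\<close>] by blast
  obtain r where r: "0 < r" "\<And>V. V \<in> stiefel \<Longrightarrow> d V \<le> r \<Longrightarrow> at_chart \<delta> V"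
    using chart_small [OF \<delta>(1)] by blast
  \<comment> \<open>The next coordinate is \<open>- LL z\<close> plus an error \<open>w\<close>. The
    sign drops out of the quadratic form, and the summand \<open>(norm z)\<^sup>2\<close> of the
    Stein equation covers all that \<open>w\<close> contributes.\<close>
  have grow: "c * B (Zc V) (Zc V) \<le> B (Zc W) (Zc W)"
    if V: "V \<in> stiefel" "d V \<le> r" and s: "scf_step H V W" for V W
  proof -
    define z where "z = Zc V"
    define u where "u = - LL z"
    define w where "w = Zc W + LL z"
    have "norm w \<le> e * norm z"
      using \<delta>(2) [OF _ s] r(2) [OF V] by (simp add: w_def z_def)
    have "norm u \<le> l * norm z" using l(2) [of z] by (simp add: u_def mult.commute)
    have "Zc W = u + w" by (simp add: u_def w_def)
    then have eq: "B (Zc W) (Zc W) = B u u + (B u w + B w u + B w w)"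
      by (simp add: B.add_left B.add_right)
    have Buw: "norm u * norm w \<le> (l * norm z) * (e * norm z)"
      using \<open>norm w \<le> _\<close> \<open>norm u \<le> _\<close> l(1) by (intro mult_mono) auto
    have Bww: "norm w * norm w \<le> (e * norm z) * (1 * norm z)"
      using \<open>norm w \<le> _\<close> e(1) \<open>0 < e\<close> order_trans [OF \<open>norm w \<le> _\<close> mult_right_mono [OF e(1)]]
      by (intro mult_mono) auto
    have "\<bar>B u w\<bar> \<le> norm u * norm w * K" "\<bar>B w u\<bar> \<le> norm u * norm w * K" "\<bar>B w w\<bar> \<le> norm w * norm w * K"
      using K(2) [of u w] K(2) [of w u] K(2) [of w w] by (simp_all add: mult_ac)
    moreover have "norm u * norm w * K \<le> (l * norm z) * (e * norm z) * K"
      "norm w * norm w * K \<le> (e * norm z) * (1 * norm z) * K"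
      using Buw Bww K(1) by (auto intro: mult_right_mono)
    ultimately have "\<bar>B u w + B w u + B w w\<bar> \<le> 2 * ((l * norm z) * (e * norm z) * K) + (e * norm z) * (1 * norm z) * K"
      by linarith
    also have "\<dots> = e * (K * (2 * l + 1)) * (norm z)\<^sup>2" by (simp add: power2_eq_square algebra_simps)
    also have "\<dots> \<le> 1 * (norm z)\<^sup>2" using e(2) by (intro mult_right_mono) auto
    finally have "\<bar>B u w + B w u + B w w\<bar> \<le> (norm z)\<^sup>2" by simp
    moreover have "B u u = c * B z z + (norm z)\<^sup>2"
      by (simp add: u_def B.minus_left B.minus_right Stein)
    ultimately show ?thesis using eq by (simp add: z_def)
  qed
  show ?thesis
    unfolding locally_divergent_def
  proof (intro exI [of _ r] conjI allI impI r(1))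
    fix \<epsilon> :: real assume "0 < \<epsilon>"
    \<comment> \<open>Every nonzero multiple of \<open>x\<close> keeps the form positive, so the
      start can be as close as desired.\<close>
    define t where "t = \<epsilon> / (dist_bound * (norm x + 1))"
    have "0 < norm x + 1" by (simp add: add_nonneg_pos)
    then have t: "0 < t" "dist_bound * (t * (norm x + 1)) = \<epsilon>"
      using \<open>0 < \<epsilon>\<close> dist_bound_pos by (simp_all add: t_def)
    obtain V where V: "V \<in> stiefel" "chartable V" "Zc V = t *\<^sub>R x" by (rule chart_surj)
    have "d V \<le> dist_bound * (t * norm x)" using d_le_norm [OF V(1,2)] t(1) by (simp add: V(3))
    also have "\<dots> \<le> dist_bound * (t * (norm x + 1))" using dist_bound_pos t(1) by (intro mult_left_mono) auto
    finally have "d V \<le> \<epsilon>" using t(2) by simp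
    have pos: "0 < B (Zc V) (Zc V)"
      using x t(1) by (simp add: V(3) B.scaleR_left B.scaleR_right)
    have "\<not> ((\<forall>i. d (R i) \<le> r) \<and> (\<lambda>i. d (R i)) \<longlonglongrightarrow> 0)" if R: "scf_run H R" "R 0 = V" for R
    proof
      assume "(\<forall>i. d (R i) \<le> r) \<and> (\<lambda>i. d (R i)) \<longlonglongrightarrow> 0"
      then have stay: "d (R i) \<le> r" for i by blast
      have "c ^ i * B (Zc V) (Zc V) \<le> B (Zc (R i)) (Zc (R i))" for i
      proof (induction i)
        case (Suc i)
        have "c ^ Suc i * B (Zc V) (Zc V) \<le> c * B (Zc (R i)) (Zc (R i))" using Suc c by simp
        also have "\<dots> \<le> B (Zc (R (Suc i))) (Zc (R (Suc i)))"
          using R(1) by (intro grow scf_run_stiefel [OF R(1)] stay) (simp add: scf_run_def)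
        finally show ?case .
      qed (simp add: R(2))
      moreover have "B (Zc (R i)) (Zc (R i)) \<le> \<delta> * \<delta> * K" for i
      proof -
        have n: "norm (Zc (R i)) \<le> \<delta>" using r(2) [OF scf_run_stiefel [OF R(1)] stay] by blast
        have "norm (Zc (R i)) * norm (Zc (R i)) * K \<le> \<delta> * \<delta> * K"
          using n K(1) \<delta>(1) by (intro mult_right_mono mult_mono) auto
        then show ?thesis using K(2) [of "Zc (R i)" "Zc (R i)"] by linarith
      qed
      ultimately have bound: "c ^ i * B (Zc V) (Zc V) \<le> \<delta> * \<delta> * K" for i
        using order_trans by blast
      \<comment> \<open>The form grows geometrically from a positive value, yet it is bounded on the
        neighbourhood, so the run has to leave.\<close>
      obtain i where "\<delta> * \<delta> * K / B (Zc V) (Zc V) < c ^ i"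
        using real_arch_pow [OF c] by blast
      then show False using bound [of i] pos by (simp add: pos_divide_less_eq)
    qed
    then show "\<exists>V0\<in>stiefel. d V0 \<le> \<epsilon> \<and> (\<forall>R. scf_run H R \<and> R 0 = V0 \<longrightarrow>
           \<not> ((\<forall>i. d (R i) \<le> r) \<and> (\<lambda>i. d (R i)) \<longlonglongrightarrow> 0))"
      using V(1) \<open>d V \<le> \<epsilon>\<close> by blast
  qed
qed

end

theorem theorem1:
  fixes H :: "complex^'k^'n \<Rightarrow> complex^'n^'n"
    and Vs :: "complex^'k^'n"
    and Vp :: "complex^'m^'n"
    and Nk :: "complex^'k^'k \<Rightarrow> real"
    and Nm :: "complex^'k^'m \<Rightarrow> real"
  assumes dims: "CARD('n) = CARD('k) + CARD('m)"
    and H_cont: "continuous_on UNIV H"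
    and H_herm: "\<And>V. (H V)\<^sup>H = H V"
    and H_inv: "\<And>V Q. Q \<in> stiefel \<Longrightarrow> H (V ** Q) = H V"
    and sol: "nepv_solution H Vs"
    and decomp: "eigendecomposition (H Vs) Vs Vp"
    and gap: "eigval (CARD('k) + 1) (H Vs) - eigval CARD('k) (H Vs) > 0"
    and ui_k: "ui_norm Nk" and ui_m: "ui_norm Nm" and ui_km: "ui_compatible Nk Nm"
  shows
    "(lipschitz_at H Vs \<longrightarrow>
        (\<forall>V X. Lam_perp TYPE('k) (H Vs) ** X - X ** Lam (H Vs) = Vp\<^sup>H ** (H Vs - H V) ** Vs
               \<longleftrightarrow> X = scf_S H Vs Vp V) \<and>
        eta_sup Nk H Vs =
          Limsup_tan Nk Vs (\<lambda>V. ereal (Nm (scf_S H Vs Vp V) / Nk (tan_Theta V Vs))) \<and>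
        eta_sup Nk H Vs < \<infinity>)
     \<and>
     (smooth_near H Vs \<longrightarrow>
        linear (scf_L H Vs Vp) \<and>
        eta_sup Nk H Vs = op_norm Nm (scf_L H Vs Vp) \<and>
        op_norm Nm (scf_L H Vs Vp) \<ge> eta_sup_inf Nk H Vs \<and>
        eta_sup_inf Nk H Vs = ereal (real_spectral_radius (scf_L H Vs Vp)) \<and>
        (real_spectral_radius (scf_L H Vs Vp) < 1 \<longrightarrow>
           locally_convergent Nk H Vs \<and>
           avg_rate_bounded Nk H Vs (real_spectral_radius (scf_L H Vs Vp))) \<and>
        (real_spectral_radius (scf_L H Vs Vp) > 1 \<longrightarrow> locally_divergent Nk H Vs))"
proof -
  interpret Nk: real_norm Nk by (rule ui_norm_real_norm [OF ui_k])
  interpret Nm: real_norm Nm by (rule ui_norm_real_norm [OF ui_m])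
  interpret nepv_norm H Vs Vp Nk Nm
    by unfold_locales (fact dims H_herm H_inv decomp gap ui_km)+
  have sylvester: "Lam_perp TYPE('k) (H Vs) ** X - X ** Lam (H Vs) = Vp\<^sup>H ** (H Vs - H V) ** Vs
      \<longleftrightarrow> X = scf_S H Vs Vp V" for V X
    unfolding Lam_perp_eq Lam_eq scf_S_def by (rule sylvester_iff)
  show ?thesis
  proof (intro conjI impI allI sylvester eta_sup_lipschitz)
    assume "smooth_near H Vs"
    then obtain H' where "(H has_derivative H') (at Vs)" by (rule smooth_near_has_derivative)
    then interpret nepv_diff H Vs Vp Nk Nm H' by unfold_locales
    note [simp] = LL_def [symmetric]
    show "linear (scf_L H Vs Vp)" using linear_LL by simp
    show "eta_sup Nk H Vs = op_norm Nm (scf_L H Vs Vp)" using eta_sup_eq by simp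
    show "eta_sup_inf Nk H Vs \<le> op_norm Nm (scf_L H Vs Vp)" using eta_sup_inf_le by simp
    show "eta_sup_inf Nk H Vs = ereal (real_spectral_radius (scf_L H Vs Vp))" using eta_sup_inf_eq by simp
    show "locally_convergent Nk H Vs" if "real_spectral_radius (scf_L H Vs Vp) < 1"
      using convergence that by simp
    show "avg_rate_bounded Nk H Vs (real_spectral_radius (scf_L H Vs Vp))" if "real_spectral_radius (scf_L H Vs Vp) < 1"
      using convergence that by simp
    show "locally_divergent Nk H Vs" if "real_spectral_radius (scf_L H Vs Vp) > 1"
      using divergence that by simp
  qed
qed

end
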